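(* Let $(\xi_j)_{j\ge 0}$ be a sequence of independent and identically distributed random variables taking values in $\mathbb{Z}$, and for $n\in\mathbb{N}$ let $P(z)=P_n(z)=\sum_{j=0}^n \xi_j z^j$. Suppose that there exists a constant $M\ge 1$ such that $\mathbb{P}(|\xi_0|\le M)=1$, and that $\max_{x\in\mathbb{Z}}\mathbb{P}(\xi_0=x)\le \frac12$. Then $$\mathbb{P}\big(P \text{ has a double root}\big)=\mathbb{P}\big(P\text{ has a double root at either } 0,\,-1\text{ or }1\big)+o(n^{-2})\quad\text{as } n\to\infty.$$ Moreover, if $\mathbb{P}(\xi_0=0)=0$, then $\mathbb{P}\big(P\text{ has a double root}\big)=O(n^{-2})$ as $n\to\infty$.
   Context: A double root of $P$ is a complex number $\alpha$ which is a root of multiplicity at least two, i.e. $P(\alpha)=P'(\alpha)=0$. The law of $\xi_0$ is fixed (independent of $n$). *)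

theory Defs
  imports "HOL-Probability.Probability" "HOL-Computational_Algebra.Polynomial"
begin

definition rand_poly :: "(nat \<Rightarrow> 'a \<Rightarrow> int) \<Rightarrow> nat \<Rightarrow> 'a \<Rightarrow> complex poly" where
  "rand_poly \<xi> n \<omega> = (\<Sum>j\<le>n. monom (of_int (\<xi> j \<omega>)) j)"

text \<open>Every complex number counts as a double root of the zero polynomial. The library's
  \<^const>\<open>order\<close> would leave that case unspecified.\<close>

definition double_root :: "complex poly \<Rightarrow> complex \<Rightarrow> bool" where
  "double_root p \<alpha> \<longleftrightarrow> poly p \<alpha> = 0 \<and> poly (pderiv p) \<alpha> = 0"

end

theory Submission
  imports Defs "HOL-Computational_Algebra.Computational_Algebra" "HOL-Number_Theory.Cong" "HOL-Real_Asymp.Real_Asymp"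
begin

text \<open>
  Let \<open>f\<close> be the primitive minimal polynomial of a double root of \<open>P\<close> other than 0 and the
  units \<open>-1, 1\<close>, so that \<open>f\<^sup>2\<close> divides \<open>P\<close>. Fix a prime \<open>l\<close> larger than \<open>2m\<close>, where \<open>m\<close> bounds the
  coefficients. For a polynomial \<open>H\<close> of degree \<open>D\<close>, the characters of \<open>\<int>[x]/(N, H)\<close> evaluated at the
  powers of \<open>x\<close> form linear recurrence sequences modulo \<open>N\<close>; none of them vanishes on \<open>D\<close> consecutive
  places, so \<open>P\<close> is equidistributed modulo \<open>(N, H)\<close> up to an error \<open>exp (- c n / (D N\<^sup>2))\<close>.

  \<^item> If \<open>deg f\<close> is at least \<open>k \<approx> (ln n)\<^sup>2\<close>, work modulo \<open>l\<close>. Either \<open>f\<close> has a divisor \<open>G\<close> of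
    degree in \<open>[k, 2k)\<close>, and equidistribution modulo \<open>G\<^sup>2\<close> beats the number of such \<open>G\<close>; or \<open>f\<close> has
    an irreducible factor of degree at least \<open>k\<close>, which is one of the few irreducible factors of
    \<open>P'\<close>. As \<open>P'\<close> modulo \<open>l\<close> ignores the coefficients at multiples of \<open>l\<close>, these are still free, and
    \<open>R(x\<^sup>l) = R(x)\<^sup>l\<close> shows that \<open>k\<close> of them are determined by the factor.
  \<^item> If \<open>5 \<le> deg f < k\<close>, the same count modulo a power \<open>N\<close> of \<open>l\<close> slightly below \<open>n\<^bsup>1/2\<^esup>\<close> gives \<open>N\<^bsup>-5\<^esup>\<close>.
  \<^item> There are finitely many \<open>f\<close> of degree at most 4. Degrees 3 and 4 cost \<open>N\<^bsup>-6\<^esup>\<close>. In degrees 1 and 2,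
    unless \<open>f\<close> is cyclotomic, some \<open>L\<close> is such that no nonzero \<open>Q(x\<^sup>L)\<close> with small coefficients is
    divisible by \<open>f\<close>, and the probability is exponentially small.
  \<^item> For \<open>f\<close> cyclotomic of degree \<open>d\<close> the probability is \<open>O(n\<^bsup>-2d\<^esup>)\<close>, by a Fourier estimate for the
    sums \<open>\<Sum> \<xi>\<^sub>j\<close> and \<open>\<Sum> j \<xi>\<^sub>j\<close> along arithmetic progressions. The case \<open>d = 1\<close> is the second claim.
\<close>

section \<open>Distance to the nearest integer\<close>

definition dist_int :: "real \<Rightarrow> real" where
  "dist_int x = \<bar>x - of_int (round x)\<bar>"

lemma dist_int_le: "dist_int x \<le> \<bar>x - of_int k\<bar>"
  unfolding dist_int_def by (simp add: round_diff_minimal abs_minus_commute)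

lemma dist_int_nonneg [simp]: "0 \<le> dist_int x"
  by (simp add: dist_int_def)

lemma dist_int_le_half: "dist_int x \<le> 1/2"
  unfolding dist_int_def using of_int_round_abs_le[of x] by (simp add: abs_minus_commute)

lemma dist_int_add_int [simp]: "dist_int (x + of_int k) = dist_int x"
proof -
  have "dist_int (x + of_int k) \<le> dist_int x" for x k
    using dist_int_le[of "x + of_int k" "round x + k"] by (simp add: dist_int_def)
  from this[of x k] this[of "x + of_int k" "-k"] show ?thesis by simp
qed

lemma dist_int_minus [simp]: "dist_int (- x) = dist_int x"
proof -
  have "dist_int (- x) \<le> dist_int x" for x
    using dist_int_le[of "- x" "- round x"] by (simp add: dist_int_def)
  from this[of x] this[of "- x"] show ?thesis by simp
qed

lemma dist_int_triangle: "dist_int (x + y) \<le> dist_int x + dist_int y"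
  using dist_int_le[of "x + y" "round x + round y"] by (simp add: dist_int_def)

lemma dist_int_triangle_diff: "dist_int (x - y) \<le> dist_int x + dist_int y"
  using dist_int_triangle[of x "- y"] by simp

lemma dist_int_mult_nat: "dist_int (real k * x) \<le> real k * dist_int x"
proof -
  have "dist_int (real k * x) \<le> \<bar>real k * x - of_int (int k * round x)\<bar>" by (rule dist_int_le)
  also have "\<dots> = \<bar>real k * (x - of_int (round x))\<bar>" by (simp add: algebra_simps)
  also have "\<dots> = real k * dist_int x" by (simp add: dist_int_def abs_mult)
  finally show ?thesis .
qed

lemma dist_int_eq: "\<bar>x\<bar> < 1/2 \<Longrightarrow> dist_int x = \<bar>x\<bar>"
  using round_unique'[of x 0] by (simp add: dist_int_def)

lemma dist_int_fraction_ge: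
  fixes t :: int
  assumes "N > 0" and "\<not> int N dvd t"
  shows "dist_int (real_of_int t / real N) \<ge> 1 / real N"
proof -
  define k where "k = round (real_of_int t / real N)"
  have "t - k * int N \<noteq> 0" using assms(2) by (metis dvd_triv_right eq_iff_diff_eq_0)
  hence "1 \<le> \<bar>real_of_int (t - k * int N)\<bar>" by linarith
  moreover have "dist_int (real_of_int t / real N) = \<bar>real_of_int (t - k * int N)\<bar> / real N"
  proof -
    have "real_of_int t / real N - of_int k = real_of_int (t - k * int N) / real N"
      using assms(1) by (simp add: field_simps)
    thus ?thesis using assms(1) by (simp add: dist_int_def k_def[symmetric])
  qed
  ultimately show ?thesis using assms(1) by (simp add: divide_right_mono)
qed

text \<open>A weak Jordan inequality: with \<open>y = pi * x\<close> at most 2, the cubic Taylor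
  bound gives \<open>sin y \<ge> y / 3\<close>, and \<open>pi > 3\<close>.\<close>

lemma sin_pi_ge:
  assumes "0 \<le> x" "x \<le> 1/2"
  shows "x \<le> sin (pi * x)"
proof -
  define y where "y = pi * x"
  have y: "0 \<le> y" "y \<le> pi / 2" using assms by (auto simp: y_def)
  have 1: "sin y \<ge> y - y^3 / 6"
  proof -
    define g where "g = (\<lambda>t::real. sin t - t + t^3/6)"
    have cos_ge: "cos t \<ge> 1 - t^2/2" for t :: real
    proof -
      have "cos t = 1 - 2 * (sin (t/2))^2" using cos_double_sin[of "t/2"] by simp
      moreover have "(sin (t/2))^2 \<le> (t/2)^2"
        using abs_sin_x_le_abs_x[of "t/2"] by (simp only: abs_le_square_iff)
      ultimately show ?thesis by (simp add: power_divide)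
    qed
    have "g 0 \<le> g y"
    proof (rule DERIV_nonneg_imp_nondecreasing[OF y(1)])
      fix t :: real assume "0 \<le> t" "t \<le> y"
      have "(g has_real_derivative (cos t - 1 + t^2/2)) (at t)"
        unfolding g_def by (auto intro!: derivative_eq_intros)
      thus "\<exists>d. (g has_real_derivative d) (at t) \<and> 0 \<le> d"
        using cos_ge[of t] by (intro exI[of _ "cos t - 1 + t^2/2"]) auto
    qed
    thus ?thesis by (simp add: g_def)
  qed
  have "y \<le> 2" using y pi_less_4 by linarith
  hence "y^2 \<le> 4" using y mult_mono[of y 2 y 2] by (simp add: power2_eq_square)
  hence "y * y^2 \<le> y * 4" using y by (intro mult_left_mono) auto
  hence "y^3 \<le> 4 * y" by (simp add: power3_eq_cube power2_eq_square)
  hence 2: "sin y \<ge> y / 3" using 1 by linarith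
  have "x * 3 \<le> x * pi" using assms pi_gt3 by (intro mult_left_mono) auto
  thus ?thesis using 2 by (simp add: y_def mult.commute)
qed

text \<open>Follows from \<open>sin^2 = (1 - |cos|) (1 + |cos|) \<le> 2 (1 - |cos|)\<close> and the
  lower bound for \<open>|sin (pi x)|\<close> by the distance to the nearest integer.\<close>

lemma one_minus_abs_cos_ge: "1 - \<bar>cos (pi * x)\<bar> \<ge> (dist_int x)^2 / 2"
proof -
  define y where "y = x - of_int (round x)"
  have ny: "dist_int x = \<bar>y\<bar>" by (simp add: dist_int_def y_def)
  have "\<bar>sin (pi * x)\<bar> = \<bar>sin (pi * y)\<bar>"
  proof -
    have "sin (pi * x) = sin (pi * y + pi * of_int (round x))" by (simp add: y_def algebra_simps)
    also have "\<bar>\<dots>\<bar> = \<bar>sin (pi * y)\<bar>"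
      by (simp only: sin_add sin_npi_int cos_npi_int) simp
    finally show ?thesis .
  qed
  also have "\<dots> = \<bar>sin (pi * \<bar>y\<bar>)\<bar>" by (cases "y \<ge> 0") auto
  also have "\<dots> \<ge> \<bar>y\<bar>"
    using sin_pi_ge[of "\<bar>y\<bar>"] dist_int_le_half[of x] by (simp add: ny)
  finally have "(dist_int x)^2 \<le> (sin (pi * x))^2" using ny by (metis abs_le_square_iff abs_idempotent)
  also have "\<dots> = (1 - \<bar>cos (pi * x)\<bar>) * (1 + \<bar>cos (pi * x)\<bar>)"
    using sin_squared_eq[of "pi * x"] by (simp add: algebra_simps power2_eq_square)
  also have "\<dots> \<le> (1 - \<bar>cos (pi * x)\<bar>) * 2"
    by (intro mult_left_mono) (auto simp: abs_cos_le_one)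
  finally show ?thesis by simp
qed

section \<open>Independent coefficients with a bounded law\<close>

locale bounded_law =
  fixes w :: "int \<Rightarrow> real" and m :: int
  assumes nonneg: "0 \<le> w x"
    and total: "(\<Sum>x\<in>{-m..m}. w x) = 1"
    and atom: "w x \<le> 1/2"
begin

definition box :: "nat \<Rightarrow> (nat \<Rightarrow> int) set" where
  "box n = PiE {..n} (\<lambda>_. {-m..m})"

text \<open>The product law of the \<open>n + 1\<close> coefficients as a finite weighted sum;
  measure theory enters only in \<open>prob_eq_prb\<close>.\<close>

definition prb :: "nat \<Rightarrow> ((nat \<Rightarrow> int) \<Rightarrow> bool) \<Rightarrow> real" where
  "prb n E = (\<Sum>a\<in>{a\<in>box n. E a}. \<Prod>j\<le>n. w (a j))"

text \<open>The modulus of the characteristic function of one coefficient, with frequencies counted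
  in full turns.\<close>

definition char_abs :: "real \<Rightarrow> real" where
  "char_abs \<theta> = cmod (\<Sum>x\<in>{-m..m}. of_real (w x) * cis (2 * pi * of_int x * \<theta>))"

lemma finite_box [simp]: "finite (box n)"
  unfolding box_def by (intro finite_PiE) auto

lemma box_abs_le: "a \<in> box n \<Longrightarrow> j \<le> n \<Longrightarrow> \<bar>a j\<bar> \<le> m"
  unfolding box_def by (force simp: PiE_iff)

lemma weight_nonneg: "0 \<le> (\<Prod>j\<in>J. w (a j))"
  by (intro prod_nonneg) (simp add: nonneg)

lemma sum_weight_PiE: "finite J \<Longrightarrow> (\<Sum>a\<in>PiE J (\<lambda>_. {-m..m}). \<Prod>j\<in>J. w (a j)) = 1"
  by (subst prod_sum_PiE[symmetric]) (auto simp: total)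

lemma prb_nonneg: "0 \<le> prb n E"
  unfolding prb_def by (intro sum_nonneg weight_nonneg)

lemma prb_mono: "(\<And>a. a \<in> box n \<Longrightarrow> E a \<Longrightarrow> F a) \<Longrightarrow> prb n E \<le> prb n F"
  unfolding prb_def by (intro sum_mono2) (auto intro: weight_nonneg)

lemma prb_disj: "prb n (\<lambda>a. E a \<or> F a) \<le> prb n E + prb n F"
proof -
  have "{a\<in>box n. E a \<or> F a} = {a\<in>box n. E a} \<union> {a\<in>box n. F a}" by auto
  thus ?thesis unfolding prb_def
    by (simp add: sum_Un sum_nonneg weight_nonneg)
qed

lemma prb_UN:
  assumes "finite I"
  shows "prb n (\<lambda>a. \<exists>i\<in>I. E i a) \<le> (\<Sum>i\<in>I. prb n (E i))"
  using assms
proof (induction rule: finite_induct)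
  case empty
  show ?case by (simp add: prb_def)
next
  case (insert i I)
  have "prb n (\<lambda>a. \<exists>i\<in>insert i I. E i a) \<le> prb n (\<lambda>a. E i a \<or> (\<exists>i\<in>I. E i a))"
    by (rule prb_mono) auto
  also have "\<dots> \<le> prb n (E i) + prb n (\<lambda>a. \<exists>i\<in>I. E i a)" by (rule prb_disj)
  finally show ?case using insert by simp
qed

lemma prb_UN_le:
  assumes "finite I" "\<And>i. i \<in> I \<Longrightarrow> prb n (E i) \<le> B"
  shows "prb n (\<lambda>a. \<exists>i\<in>I. E i a) \<le> real (card I) * B"
proof -
  have "(\<Sum>i\<in>I. prb n (E i)) \<le> (\<Sum>i\<in>I. B)" using assms(2) by (rule sum_mono)
  thus ?thesis using prb_UN[OF assms(1), of n E] by simp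
qed

lemma prb_fiber:
  assumes J: "J \<subseteq> {..n}"
    and K: "\<And>b. card {a\<in>box n. E a \<and> restrict a ({..n} - J) = b} \<le> K"
  shows "prb n E \<le> real K * (1/2) ^ card J"
proof -
  define S where "S = {a\<in>box n. E a}"
  define r where "r = (\<lambda>a::nat \<Rightarrow> int. restrict a ({..n} - J))"
  define f where "f = (\<lambda>b::nat \<Rightarrow> int. \<Prod>j\<in>{..n} - J. w (b j))"
  have finS: "finite S" unfolding S_def by simp
  have finJ: "finite J" using J finite_subset by blast
  have f0: "0 \<le> f b" for b unfolding f_def by (rule weight_nonneg)
  have "prb n E \<le> (\<Sum>a\<in>S. (1/2) ^ card J * f (r a))"
    unfolding prb_def S_def[symmetric]
  proof (rule sum_mono)
    fix a
    have "(\<Prod>j\<le>n. w (a j)) = (\<Prod>j\<in>{..n} - J. w (a j)) * (\<Prod>j\<in>J. w (a j))"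
      using J by (intro prod.subset_diff) auto
    also have "(\<Prod>j\<in>{..n} - J. w (a j)) = f (r a)" unfolding f_def r_def
      by (intro prod.cong) auto
    also have "f (r a) * (\<Prod>j\<in>J. w (a j)) \<le> f (r a) * (\<Prod>j\<in>J. 1/2)"
      by (intro mult_left_mono prod_mono f0 conjI nonneg atom)
    finally show "(\<Prod>j\<le>n. w (a j)) \<le> (1/2) ^ card J * f (r a)" by (simp add: mult.commute)
  qed
  also have "\<dots> = (1/2) ^ card J * (\<Sum>a\<in>S. f (r a))" by (simp add: sum_distrib_left)
  also have "(\<Sum>a\<in>S. f (r a)) = (\<Sum>b\<in>r ` S. \<Sum>a\<in>{a\<in>S. r a = b}. f (r a))"
    by (rule sum.image_gen[OF finS])
  also have "\<dots> = (\<Sum>b\<in>r ` S. real (card {a\<in>S. r a = b}) * f b)"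
    by (intro sum.cong refl) simp
  also have "\<dots> \<le> (\<Sum>b\<in>r ` S. real K * f b)"
    using K by (intro sum_mono mult_right_mono f0)
      (auto simp: S_def r_def conj_assoc)
  also have "\<dots> = real K * (\<Sum>b\<in>r ` S. f b)" by (simp add: sum_distrib_left)
  also have "(\<Sum>b\<in>r ` S. f b) \<le> (\<Sum>b\<in>PiE ({..n} - J) (\<lambda>_. {-m..m}). f b)"
    by (intro sum_mono2 f0 finite_PiE) (auto simp: r_def S_def box_def PiE_iff split: if_splits)
  also have "\<dots> = 1" unfolding f_def by (rule sum_weight_PiE) auto
  finally show ?thesis
    by (simp add: mult_left_mono mult.commute mult_right_mono)
qed

lemma prb_fiber_inj:
  assumes J: "J \<subseteq> {..n}"
    and inj: "\<And>a b. a \<in> box n \<Longrightarrow> b \<in> box n \<Longrightarrow> E a \<Longrightarrow> E b \<Longrightarrow> (\<And>j. j \<notin> J \<Longrightarrow> a j = b j) \<Longrightarrow> a = b"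
  shows "prb n E \<le> (1/2) ^ card J"
proof -
  have "prb n E \<le> real 1 * (1/2) ^ card J"
  proof (rule prb_fiber[OF J])
    fix b
    have "a = a'" if "a \<in> {a\<in>box n. E a \<and> restrict a ({..n} - J) = b}"
      "a' \<in> {a\<in>box n. E a \<and> restrict a ({..n} - J) = b}" for a a'
    proof (rule inj)
      fix j assume "j \<notin> J"
      have "restrict a ({..n} - J) j = restrict a' ({..n} - J) j" using that by simp
      thus "a j = a' j" using that \<open>j \<notin> J\<close>
        by (cases "j \<le> n") (auto simp: box_def PiE_def extensional_def)
    qed (use that in auto)
    moreover have "finite {a\<in>box n. E a \<and> restrict a ({..n} - J) = b}" by simp
    ultimately show "card {a\<in>box n. E a \<and> restrict a ({..n} - J) = b} \<le> 1"
      by (simp only: card_le_Suc0_iff_eq One_nat_def) blast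
  qed
  thus ?thesis by simp
qed

text \<open>On the event, the average over \<open>I\<close> of the characters \<open>exp (2 \<pi> i \<Sum> a\<^sub>j u\<^sub>j / N)\<close> equals 1, so the
  probability is at most the mean square of that average.\<close>

lemma prb_fourier:
  fixes u :: "'i \<Rightarrow> nat \<Rightarrow> int"
  assumes I: "finite I" "I \<noteq> {}" and N: "N > 0"
    and E: "\<And>a i. a \<in> box n \<Longrightarrow> E a \<Longrightarrow> i \<in> I \<Longrightarrow> int N dvd (\<Sum>j\<le>n. a j * u i j)"
  shows "prb n E \<le> (\<Sum>i\<in>I. \<Sum>i'\<in>I. \<Prod>j\<le>n. char_abs (of_int (u i j - u i' j) / real N)) / (real (card I))\<^sup>2"
proof -
  let ?P = "\<lambda>i i'. \<Prod>j\<le>n. char_abs (of_int (u i j - u i' j) / real N)"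
  define e where "e = (\<lambda>t. cis (2 * pi * (of_int t / real N)))"
  define L where "L = (\<lambda>a i. \<Sum>j\<le>n. a j * u i j)"
  define X where "X = (\<lambda>a. \<Sum>i\<in>I. e (L a i))"
  define W where "W = (\<lambda>a. \<Prod>j\<le>n. w (a j))"
  have W0: "0 \<le> W a" for a unfolding W_def by (rule weight_nonneg)
  have e_diff: "e (s - t) = e s * cnj (e t)" for s t
    by (simp add: e_def cis_mult cis_cnj diff_divide_distrib algebra_simps)
  have e_add: "e (s + t) = e s * e t" for s t
    by (simp add: e_def cis_mult add_divide_distrib algebra_simps)
  have e_sum: "e (\<Sum>j\<in>J. f j) = (\<Prod>j\<in>J. e (f j))" if "finite J" for J :: "nat set" and f
    using that by (induction rule: finite_induct) (auto simp: e_add, simp add: e_def)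
  have e_dvd: "e t = 1" if dvd: "int N dvd t" for t
  proof -
    obtain k where "t = int N * k" using dvd by (rule dvdE)
    hence "e t = cis (2 * pi * of_int k)" using N by (simp add: e_def mult.assoc)
    also have "\<dots> = 1" using cis_multiple_2pi[of "of_int k"] by (simp add: mult.assoc)
    finally show ?thesis .
  qed
  have X: "X a = of_nat (card I)" if "a \<in> box n" "E a" for a
    using E[OF that] by (simp add: X_def L_def e_dvd)
  have XX: "complex_of_real ((cmod (X a))\<^sup>2) = (\<Sum>i\<in>I. \<Sum>i'\<in>I. e (L a i - L a i'))" for a
    by (simp only: complex_norm_square X_def cnj_sum sum_product e_diff)
  have "prb n E * (real (card I))\<^sup>2 = (\<Sum>a\<in>{a\<in>box n. E a}. W a * (cmod (X a))\<^sup>2)"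
    unfolding prb_def sum_distrib_right W_def by (intro sum.cong refl) (simp add: X)
  \<comment> \<open>Dropping the event only adds nonnegative terms; the full second moment can then
    be expanded.\<close>
  also have "\<dots> \<le> (\<Sum>a\<in>box n. W a * (cmod (X a))\<^sup>2)"
    by (intro sum_mono2) (auto intro!: mult_nonneg_nonneg W0)
  also have "\<dots> \<le> cmod (\<Sum>a\<in>box n. of_real (W a) * (\<Sum>i\<in>I. \<Sum>i'\<in>I. e (L a i - L a i')))"
  proof -
    have "(\<Sum>a\<in>box n. of_real (W a) * (\<Sum>i\<in>I. \<Sum>i'\<in>I. e (L a i - L a i')))
        = complex_of_real (\<Sum>a\<in>box n. W a * (cmod (X a))\<^sup>2)"
      by (simp only: XX[symmetric] of_real_sum of_real_mult)
    thus ?thesis by (simp only: norm_of_real abs_ge_self)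
  qed
  also have "(\<Sum>a\<in>box n. of_real (W a) * (\<Sum>i\<in>I. \<Sum>i'\<in>I. e (L a i - L a i')))
      = (\<Sum>i\<in>I. \<Sum>i'\<in>I. \<Sum>a\<in>box n. of_real (W a) * e (L a i - L a i'))"
    by (simp only: sum_distrib_left) (subst sum.swap, rule sum.cong[OF refl], rule sum.swap)
  also have "cmod \<dots> \<le> (\<Sum>i\<in>I. \<Sum>i'\<in>I. cmod (\<Sum>a\<in>box n. of_real (W a) * e (L a i - L a i')))"
    by (intro order.trans[OF norm_sum] sum_mono order.refl)
  also have "\<dots> = (\<Sum>i\<in>I. \<Sum>i'\<in>I. ?P i i')"
  proof (intro sum.cong refl)
    fix i i'
    define d where "d = (\<lambda>j. u i j - u i' j)"
    \<comment> \<open>Independence: the mean of a character of the whole vector is a product of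
      one-coefficient means.\<close>
    have "(\<Sum>a\<in>box n. of_real (W a) * e (L a i - L a i'))
        = (\<Sum>a\<in>PiE {..n} (\<lambda>_. {-m..m}). \<Prod>j\<le>n. of_real (w (a j)) * e (a j * d j))"
    proof (unfold box_def, intro sum.cong refl)
      fix a
      have "L a i - L a i' = (\<Sum>j\<le>n. a j * d j)"
        by (simp add: L_def d_def right_diff_distrib sum_subtractf)
      thus "of_real (W a) * e (L a i - L a i') = (\<Prod>j\<le>n. of_real (w (a j)) * e (a j * d j))"
        by (simp add: e_sum W_def prod.distrib)
    qed
    also have "\<dots> = (\<Prod>j\<le>n. \<Sum>x\<in>{-m..m}. of_real (w x) * e (x * d j))"
      by (subst prod_sum_PiE) auto
    also have "cmod \<dots> = (\<Prod>j\<le>n. char_abs (of_int (d j) / real N))"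
      by (simp add: prod_norm[symmetric] char_abs_def e_def mult.assoc)
    finally show "cmod (\<Sum>a\<in>box n. of_real (W a) * e (L a i - L a i')) =
      ?P i i'" by (simp add: d_def)
  qed
  finally have "prb n E * (real (card I))\<^sup>2 \<le> \<dots>" .
  moreover have "real (card I) > 0" using I by (simp add: card_gt_0_iff)
  ultimately show ?thesis by (simp add: pos_le_divide_eq)
qed

lemma char_abs_nonneg [simp]: "0 \<le> char_abs \<theta>"
  by (simp add: char_abs_def)

text \<open>\<open>\<Delta>\<close> is the distance between two atoms of the law.\<close>

lemma char_abs_bound:
  obtains c :: real and \<Delta> :: nat where "c > 0" "\<Delta> \<ge> 1" "int \<Delta> \<le> 2 * m"
    "\<And>\<theta>. char_abs \<theta> \<le> exp (- c * (dist_int (real \<Delta> * \<theta>))\<^sup>2)"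
proof -
  obtain x1 where x1: "x1 \<in> {-m..m}" "w x1 > 0"
  proof (atomize_elim, rule ccontr)
    assume "\<not> (\<exists>x1. x1 \<in> {-m..m} \<and> w x1 > 0)"
    hence "w x \<le> 0" if "x \<in> {-m..m}" for x using that by force
    hence "(\<Sum>x\<in>{-m..m}. w x) \<le> 0" by (intro sum_nonpos)
    thus False using total by simp
  qed
  \<comment> \<open>A single atom holds at most half of the mass, so a second one exists.\<close>
  obtain x2 where x2: "x2 \<in> {-m..m}" "w x2 > 0" "x2 \<noteq> x1"
  proof (atomize_elim, rule ccontr)
    assume "\<not> (\<exists>x2. x2 \<in> {-m..m} \<and> w x2 > 0 \<and> x2 \<noteq> x1)"
    hence "w x \<le> 0" if "x \<in> {-m..m} - {x1}" for x using that by force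
    hence "(\<Sum>x\<in>{-m..m} - {x1}. w x) \<le> 0" by (intro sum_nonpos)
    thus False using total x1 atom[of x1] by (simp add: sum.remove[of _ x1])
  qed
  \<comment> \<open>Splitting off weight \<open>\<mu>\<close> at both atoms replaces a contribution
    of \<open>2 \<mu>\<close> by \<open>2 \<mu> |cos (pi \<Delta> \<theta>)|\<close>; the remaining
    mass is bounded by the triangle inequality.\<close>
  define \<mu> where "\<mu> = min (w x1) (w x2)"
  define \<Delta> where "\<Delta> = nat \<bar>x2 - x1\<bar>"
  have mu: "\<mu> > 0" "\<mu> \<le> w x1" "\<mu> \<le> w x2" using x1 x2 by (auto simp: \<mu>_def)
  have bound: "char_abs \<theta> \<le> exp (- \<mu> * (dist_int (real \<Delta> * \<theta>))\<^sup>2)" for \<theta>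
  proof -
    define E where "E = (\<lambda>x::int. cis (2 * pi * of_int x * \<theta>))"
    have nE: "cmod (E x) = 1" for x by (simp add: E_def)
    have nle: "cmod (of_real t * E x) = t" if "t \<ge> 0" for t x
      using that by (simp add: norm_mult nE)
    define R where "R = {-m..m} - {x1, x2}"
    have split: "(\<Sum>x\<in>{-m..m}. g x) = g x1 + g x2 + (\<Sum>x\<in>R. g x)" for g :: "int \<Rightarrow> 'z::comm_monoid_add"
    proof -
      have "{-m..m} = insert x1 (insert x2 R)" using x1 x2 by (auto simp: R_def)
      moreover have "finite R" "x1 \<notin> R" "x2 \<notin> R" by (auto simp: R_def)
      ultimately show ?thesis using x2(3) by (simp add: add.assoc)
    qed
    have cosE: "cmod (E x1 + E x2) = 2 * \<bar>cos (pi * (real \<Delta> * \<theta>))\<bar>"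
    proof -
      define s where "s = pi * of_int (x1 + x2) * \<theta>"
      define t where "t = pi * of_int (x2 - x1) * \<theta>"
      have "E x1 = cis s * cis (- t)" "E x2 = cis s * cis t"
        by (simp_all add: E_def s_def t_def cis_mult algebra_simps)
      hence "E x1 + E x2 = cis s * (cis t + cis (- t))" by (simp add: algebra_simps)
      also have "cis t + cis (- t) = of_real (2 * cos t)" by (simp add: complex_eq_iff)
      finally have "cmod (E x1 + E x2) = 2 * \<bar>cos t\<bar>" by (simp add: norm_mult)
      also have "\<bar>cos t\<bar> = \<bar>cos (pi * (real \<Delta> * \<theta>))\<bar>"
      proof (cases "x2 \<ge> x1")
        case True
        thus ?thesis by (simp add: t_def \<Delta>_def mult.assoc)
      next
        case False
        hence "t = - (pi * (real \<Delta> * \<theta>))" by (simp add: t_def \<Delta>_def algebra_simps)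
        thus ?thesis by simp
      qed
      finally show ?thesis .
    qed
    have "(\<Sum>x\<in>{-m..m}. of_real (w x) * E x)
        = of_real (w x1 - \<mu>) * E x1 + of_real (w x2 - \<mu>) * E x2
          + of_real \<mu> * (E x1 + E x2) + (\<Sum>x\<in>R. of_real (w x) * E x)"
      unfolding split by (simp add: algebra_simps)
    also have "cmod \<dots> \<le> cmod (of_real (w x1 - \<mu>) * E x1) + cmod (of_real (w x2 - \<mu>) * E x2)
          + cmod (of_real \<mu> * (E x1 + E x2)) + cmod (\<Sum>x\<in>R. of_real (w x) * E x)"
      by (intro order.trans[OF norm_triangle_ineq] add_mono order.refl)
    also have "\<dots> \<le> (w x1 - \<mu>) + (w x2 - \<mu>) + \<mu> * (2 * \<bar>cos (pi * (real \<Delta> * \<theta>))\<bar>) + (\<Sum>x\<in>R. w x)"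
    proof (intro add_mono)
      show "cmod (\<Sum>x\<in>R. of_real (w x) * E x) \<le> (\<Sum>x\<in>R. w x)"
        by (intro order.trans[OF norm_sum] sum_mono) (simp add: nle nonneg)
      show "cmod (of_real \<mu> * (E x1 + E x2)) \<le> \<mu> * (2 * \<bar>cos (pi * (real \<Delta> * \<theta>))\<bar>)"
        using mu by (simp add: norm_mult cosE)
    qed (rule eq_refl[OF nle], use mu in simp)+
    also have "\<dots> = 1 - 2 * \<mu> * (1 - \<bar>cos (pi * (real \<Delta> * \<theta>))\<bar>)"
      using total unfolding split by (simp add: algebra_simps)
    also have "\<dots> \<le> 1 - 2 * \<mu> * ((dist_int (real \<Delta> * \<theta>))\<^sup>2 / 2)"
      using mu one_minus_abs_cos_ge[of "real \<Delta> * \<theta>"] by (intro diff_left_mono mult_left_mono) auto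
    also have "\<dots> \<le> exp (- \<mu> * (dist_int (real \<Delta> * \<theta>))\<^sup>2)"
      using exp_ge_add_one_self[of "- \<mu> * (dist_int (real \<Delta> * \<theta>))\<^sup>2"] by simp
    finally show ?thesis by (simp add: char_abs_def E_def)
  qed
  have "\<Delta> \<ge> 1" "int \<Delta> \<le> 2 * m" using x1 x2 by (auto simp: \<Delta>_def)
  thus ?thesis using that mu(1) bound by blast
qed

lemma prod_char_abs_le:
  assumes "\<And>\<theta>. char_abs \<theta> \<le> exp (- c * (dist_int (real \<Delta> * \<theta>))\<^sup>2)"
  shows "(\<Prod>j\<in>J. char_abs (f j)) \<le> exp (- c * (\<Sum>j\<in>J. (dist_int (real \<Delta> * f j))\<^sup>2))"
proof (cases "finite J")
  case True
  have "(\<Prod>j\<in>J. char_abs (f j)) \<le> (\<Prod>j\<in>J. exp (- c * (dist_int (real \<Delta> * f j))\<^sup>2))"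
    using assms by (intro prod_mono) auto
  also have "\<dots> = exp (- c * (\<Sum>j\<in>J. (dist_int (real \<Delta> * f j))\<^sup>2))"
    using True by (simp add: exp_sum sum_distrib_left)
  finally show ?thesis .
qed simp

end

section \<open>Sums over linear families\<close>

text \<open>Differences of \<open>a + (i + k) b\<close> and \<open>a + i b\<close> bound \<open>k b\<close> modulo 1 for every \<open>k \<le> K / 2\<close>. If all of
  these are small, no wrap-around occurs and \<open>b\<close> itself is of order \<open>K\<^bsup>-1\<^esup>\<close> times smaller.\<close>

lemma sum_dist_int_line_ge:
  fixes a b :: real and K :: nat
  assumes K: "K \<ge> 2"
  defines "S \<equiv> \<Sum>i<K. (dist_int (a + real i * b))\<^sup>2"
  shows "S \<ge> real K / 250 \<or> S \<ge> (real K * (dist_int a)\<^sup>2 + real K ^ 3 * (dist_int b)\<^sup>2) / 250"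
proof (cases "S < real K / 250")
  case True
  define h where "h = K div 2"
  have h: "1 \<le> h" "K \<le> 3 * h" "2 * h \<le> K" using K by (auto simp: h_def)
  define g where "g = (\<lambda>i::nat. (dist_int (a + real i * b))\<^sup>2)"
  have g0: "0 \<le> g i" for i by (simp add: g_def)
  have S0: "0 \<le> S" by (simp add: S_def sum_nonneg)
  have sq: "(x::real)\<^sup>2 \<le> 2 * y\<^sup>2 + 2 * z\<^sup>2" if "x \<le> y + z" "0 \<le> x" for x y z
  proof -
    have "x\<^sup>2 \<le> (y + z)\<^sup>2" using that by (intro power_mono)
    also have "\<dots> \<le> 2 * y\<^sup>2 + 2 * z\<^sup>2"
      using zero_le_power2[of "y - z"] by (simp add: power2_eq_square algebra_simps)
    finally show ?thesis .
  qed
  \<comment> \<open>At least \<open>K / 2\<close> pairs of indices at distance \<open>k\<close> are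
    available since \<open>k \<le> h \<le> K / 2\<close>, and each index occurs in at most two of
    them.\<close>
  have shift: "real K * (dist_int (real k * b))\<^sup>2 \<le> 8 * S" if k: "k \<le> h" for k
  proof -
    have "real (K - k) * (dist_int (real k * b))\<^sup>2 = (\<Sum>i<K-k. (dist_int (real k * b))\<^sup>2)" by simp
    also have "\<dots> \<le> (\<Sum>i<K-k. 2 * g i + 2 * g (i + k))"
    proof (rule sum_mono)
      fix i
      have "dist_int (real k * b) \<le> dist_int (a + real (i + k) * b) + dist_int (a + real i * b)"
        using dist_int_triangle_diff[of "a + real (i + k) * b" "a + real i * b"] by (simp add: algebra_simps)
      from sq[OF this] show "(dist_int (real k * b))\<^sup>2 \<le> 2 * g i + 2 * g (i + k)" by (simp add: g_def)
    qed
    also have "\<dots> = 2 * (\<Sum>i<K-k. g i) + 2 * (\<Sum>i<K-k. g (i + k))"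
      by (simp add: sum.distrib sum_distrib_left)
    also have "(\<Sum>i<K-k. g i) \<le> S" unfolding S_def g_def[symmetric]
      by (intro sum_mono2 g0) auto
    also have "(\<Sum>i<K-k. g (i + k)) = (\<Sum>i=0+k..<(K-k)+k. g i)"
      by (simp only: sum.shift_bounds_nat_ivl lessThan_atLeast0)
    also have "\<dots> \<le> S" unfolding S_def g_def[symmetric]
      by (intro sum_mono2 g0) (use k h in auto)
    finally have 1: "real (K - k) * (dist_int (real k * b))\<^sup>2 \<le> 4 * S" by simp
    have "real K / 2 \<le> real (K - k)" using k h by simp
    hence "real K / 2 * (dist_int (real k * b))\<^sup>2 \<le> real (K - k) * (dist_int (real k * b))\<^sup>2"
      by (rule mult_right_mono) simp
    with 1 show ?thesis by simp
  qed
  have small: "dist_int (real k * b) < 1/4" if "k \<le> h" for k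
  proof (rule ccontr)
    assume "\<not> dist_int (real k * b) < 1/4"
    hence "(1/4)\<^sup>2 \<le> (dist_int (real k * b))\<^sup>2" by (intro power_mono) auto
    hence "real K * (1/16) \<le> real K * (dist_int (real k * b))\<^sup>2"
      by (intro mult_left_mono) (auto simp: power2_eq_square)
    with shift[OF that] True K show False by simp
  qed
  define \<beta> where "\<beta> = b - of_int (round b)"
  have beta: "\<bar>\<beta>\<bar> = dist_int b" by (simp add: \<beta>_def dist_int_def)
  have dist_intk: "dist_int (real k * b) = dist_int (real k * \<beta>)" for k
  proof -
    have "real k * b = real k * \<beta> + of_int (int k * round b)" by (simp add: \<beta>_def algebra_simps)
    thus ?thesis by (simp only: dist_int_add_int)
  qed
  \<comment> \<open>Multiples of \<open>\<beta>\<close> grow by steps below 1/4, so the next one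
    stays below 1/2, where \<open>dist_int\<close> is the absolute value; smallness modulo 1 then
    brings it back below 1/4.\<close>
  have lin: "\<bar>real k * \<beta>\<bar> < 1/4" if "k \<le> h" for k
    using that
  proof (induction k)
    case (Suc k)
    have "\<bar>\<beta>\<bar> < 1/4" using small[of 1] h beta by simp
    moreover have "\<bar>real k * \<beta>\<bar> < 1/4" using Suc by simp
    moreover have "real (Suc k) * \<beta> = real k * \<beta> + \<beta>" by (simp add: algebra_simps)
    ultimately have "\<bar>real (Suc k) * \<beta>\<bar> < 1/2" by linarith
    hence "dist_int (real (Suc k) * \<beta>) = \<bar>real (Suc k) * \<beta>\<bar>" by (rule dist_int_eq)
    thus ?case using small[OF Suc.prems] dist_intk[of "Suc k"] by simp
  qed simp
  have "dist_int (real h * b) = real h * dist_int b"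
    using dist_int_eq[of "real h * \<beta>"] lin[of h] dist_intk[of h] beta by (simp add: abs_mult)
  hence hb: "real K * ((real h)\<^sup>2 * (dist_int b)\<^sup>2) \<le> 8 * S" using shift[of h] by (simp add: power_mult_distrib)
  have "(real K)\<^sup>2 \<le> (3 * real h)\<^sup>2" using h by (intro power_mono) auto
  hence "real K * ((real K)\<^sup>2 * (dist_int b)\<^sup>2) \<le> real K * ((9 * (real h)\<^sup>2) * (dist_int b)\<^sup>2)"
    by (intro mult_left_mono mult_right_mono) (auto simp: power_mult_distrib)
  with hb have B: "real K ^ 3 * (dist_int b)\<^sup>2 \<le> 72 * S" by (simp add: power3_eq_cube power2_eq_square mult.assoc)
  \<comment> \<open>The offset \<open>a\<close> is recovered from \<open>a + i b\<close> by
    subtracting \<open>i b\<close>, which is already controlled.\<close>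
  have "real K * (dist_int a)\<^sup>2 = (\<Sum>i<K. (dist_int a)\<^sup>2)" by simp
  also have "\<dots> \<le> (\<Sum>i<K. 2 * g i + 2 * ((real K)\<^sup>2 * (dist_int b)\<^sup>2))"
  proof (rule sum_mono)
    fix i assume "i \<in> {..<K}"
    have "dist_int a \<le> dist_int (a + real i * b) + dist_int (real i * b)"
      using dist_int_triangle_diff[of "a + real i * b" "real i * b"] by simp
    also have "dist_int (real i * b) \<le> real K * dist_int b"
      using dist_int_mult_nat[of i b] mult_right_mono[of "real i" "real K" "dist_int b"] \<open>i \<in> {..<K}\<close> by simp
    finally have "dist_int a \<le> dist_int (a + real i * b) + real K * dist_int b" by simp
    from sq[OF this] show "(dist_int a)\<^sup>2 \<le> 2 * g i + 2 * ((real K)\<^sup>2 * (dist_int b)\<^sup>2)"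
      by (simp add: g_def power_mult_distrib)
  qed
  also have "\<dots> = 2 * S + 2 * (real K ^ 3 * (dist_int b)\<^sup>2)"
    by (simp add: sum.distrib sum_distrib_left[symmetric] S_def g_def power3_eq_cube power2_eq_square)
  \<comment> \<open>The constants: \<open>2 + 2 * 72\<close> for \<open>a\<close> and 72 for
    \<open>b\<close> total 218, below 250.\<close>
  finally have "real K * (dist_int a)\<^sup>2 + real K ^ 3 * (dist_int b)\<^sup>2 \<le> 250 * S" using B S0 by simp
  thus ?thesis by simp
qed auto

text \<open>\<open>\<rho>\<close> is the absolutely least residue of \<open>A - s\<close> modulo
  \<open>N\<close>, injective on a residue system; since
  \<open>exp (- y^2) \<le> 2 exp (- y)\<close>, the sum is dominated by two geometric series, one
  for each sign.\<close>

lemma sum_exp_dist_int_le: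
  fixes t :: real and N :: nat and s :: int
  assumes N: "N > 0" and t: "t > 0"
  shows "(\<Sum>A\<in>{0..<int N}. exp (- (t * dist_int (of_int (A - s) / real N))\<^sup>2)) \<le> 4 * (1 + real N / t)"
proof -
  define \<rho> where "\<rho> = (\<lambda>A. A - s - int N * round (of_int (A - s) / real N :: real))"
  define x where "x = exp (- t / real N)"
  define g where "g = (\<lambda>r::nat. 2 * x ^ r)"
  have x: "0 < x" "x < 1" using N t by (auto simp: x_def)
  have rho: "real_of_int \<bar>\<rho> A\<bar> = real N * dist_int (of_int (A - s) / real N)" for A
  proof -
    define q where "q = of_int (A - s) / real N"
    have "real N * q = of_int (A - s)" using N by (simp add: q_def)
    hence "real_of_int (\<rho> A) = real N * (q - of_int (round q))"
      unfolding \<rho>_def q_def[symmetric] right_diff_distrib by simp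
    hence "real_of_int \<bar>\<rho> A\<bar> = real N * dist_int q" by (simp add: dist_int_def abs_mult)
    thus ?thesis by (simp add: q_def)
  qed
  have rho_le: "\<bar>\<rho> A\<bar> \<le> int N" for A
  proof -
    have "real N * dist_int (of_int (A - s) / real N) \<le> real N * 1"
      using dist_int_le_half[of "of_int (A - s) / real N"] by (intro mult_left_mono) auto
    thus ?thesis unfolding rho[symmetric] by simp
  qed
  have inj: "inj_on \<rho> {0..<int N}"
  proof (rule inj_onI)
    fix A B assume AB: "A \<in> {0..<int N}" "B \<in> {0..<int N}" "\<rho> A = \<rho> B"
    have "A mod int N = (\<rho> A + s) mod int N" for A
      by (simp add: \<rho>_def mod_diff_right_eq[symmetric])
    hence "A mod int N = B mod int N" using AB(3) by metis
    thus "A = B" using AB(1,2) by simp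
  qed
  have bound: "exp (- (t * dist_int (of_int (A - s) / real N))\<^sup>2) \<le> g (nat \<bar>\<rho> A\<bar>)" for A
  proof -
    define y where "y = t * dist_int (of_int (A - s) / real N)"
    have "y = t / real N * real (nat \<bar>\<rho> A\<bar>)" using N rho[of A] by (simp add: y_def)
    hence xr: "x ^ nat \<bar>\<rho> A\<bar> = exp (- y)"
      by (simp add: x_def exp_of_nat_mult[symmetric] mult.commute)
    have "- y\<^sup>2 \<le> 1/4 - y" using zero_le_power2[of "y - 1/2"] by (simp add: power2_eq_square algebra_simps)
    hence "exp (- y\<^sup>2) \<le> exp (1/4) * exp (- y)" by (simp add: exp_add[symmetric])
    also have "exp (1/4::real) \<le> 2"
    proof -
      have "exp (1/4::real) * exp (- 1/4) = 1" by (simp add: exp_minus field_simps)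
      moreover have "exp (- 1/4::real) \<ge> 3/4" using exp_ge_add_one_self[of "-1/4"] by simp
      hence "exp (1/4::real) * (3/4) \<le> exp (1/4) * exp (- 1/4)" by (intro mult_left_mono) auto
      ultimately show ?thesis by simp
    qed
    finally show ?thesis unfolding g_def xr y_def[symmetric] by simp
  qed
  have "(\<Sum>A\<in>{0..<int N}. exp (- (t * dist_int (of_int (A - s) / real N))\<^sup>2)) \<le> (\<Sum>A\<in>{0..<int N}. g (nat \<bar>\<rho> A\<bar>))"
    by (rule sum_mono) (rule bound)
  also have "\<dots> = (\<Sum>r\<in>\<rho> ` {0..<int N}. g (nat \<bar>r\<bar>))" by (simp add: sum.reindex[OF inj])
  also have "\<dots> \<le> (\<Sum>r\<in>int ` {..N} \<union> (\<lambda>r. - int r) ` {..N}. g (nat \<bar>r\<bar>))"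
  proof (intro sum_mono2 subsetI)
    fix r assume "r \<in> \<rho> ` {0..<int N}"
    hence "\<bar>r\<bar> \<le> int N" using rho_le by auto
    hence "r = int (nat \<bar>r\<bar>) \<and> nat \<bar>r\<bar> \<le> N \<or> r = - int (nat \<bar>r\<bar>) \<and> nat \<bar>r\<bar> \<le> N" by linarith
    thus "r \<in> int ` {..N} \<union> (\<lambda>r. - int r) ` {..N}" by blast
  qed (use x in \<open>auto simp: g_def\<close>)
  also have "\<dots> \<le> (\<Sum>r\<in>int ` {..N}. g (nat \<bar>r\<bar>)) + (\<Sum>r\<in>(\<lambda>r. - int r) ` {..N}. g (nat \<bar>r\<bar>))"
    using x by (subst sum_Un) (auto intro!: sum_nonneg simp: g_def)
  also have "(\<Sum>r\<in>int ` {..N}. g (nat \<bar>r\<bar>)) = (\<Sum>r\<le>N. g r)"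
    by (subst sum.reindex) (auto simp: inj_on_def)
  also have "(\<Sum>r\<in>(\<lambda>r. - int r) ` {..N}. g (nat \<bar>r\<bar>)) = (\<Sum>r\<le>N. g r)"
    by (subst sum.reindex) (auto simp: inj_on_def)
  also have "(\<Sum>r\<le>N. g r) = 2 * (\<Sum>r<Suc N. x ^ r)" by (simp add: g_def sum_distrib_left lessThan_Suc_atMost)
  also have "(\<Sum>r<Suc N. x ^ r) \<le> 1 / (1 - x)"
    using x by (simp only: sum_gp_strict) (simp add: divide_right_mono)
  also have "1 / (1 - x) \<le> 1 + real N / t"
  proof -
    define s' where "s' = t / real N"
    have s': "s' > 0" using N t by (simp add: s'_def)
    have "x * exp s' = 1" by (simp add: x_def s'_def exp_minus field_simps)
    moreover have "1 + s' \<le> exp s'" by (rule exp_ge_add_one_self)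
    hence "x * (1 + s') \<le> x * exp s'" using x by (intro mult_left_mono) auto
    ultimately have "x * (1 + s') \<le> 1" by simp
    hence "s' \<le> (1 + s') * (1 - x)" by (simp add: algebra_simps)
    hence "1 / (1 - x) \<le> (1 + s') / s'" using x s' by (simp add: field_simps)
    also have "\<dots> = 1 + real N / t" using N t by (simp add: s'_def field_simps)
    finally show ?thesis .
  qed
  finally show ?thesis by simp
qed

text \<open>The last two factors have order \<open>K^(-1/2)\<close> and \<open>K^(-3/2)\<close>: the
  inverse standard deviations of the sums of \<open>\<xi>_i\<close> and \<open>i \<xi>_i\<close>
  over \<open>K\<close> terms, as in a local limit theorem. The terms \<open>1 / K^2\<close> are the
  cost of using characters modulo \<open>K^2\<close>.\<close>

definition line_bound :: "real \<Rightarrow> nat \<Rightarrow> real" where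
  "line_bound c K = exp (- (c / 250 * real K)) + 16 * (1 / real K ^ 2 + 1 / sqrt (c / 250 * real K))
     * (1 / real K ^ 2 + 1 / sqrt (c / 250 * real K ^ 3))"

text \<open>The two alternatives of \<open>sum_dist_int_line_ge\<close> bound each summand by a
  constant plus a product of a Gaussian in the offsets and a Gaussian in the slopes, so the double
  sum factorises.\<close>

lemma sum_line_family_le:
  fixes c :: real and K :: nat
  assumes c: "c > 0" and K: "K \<ge> 2"
  defines "R \<equiv> {0..<int (K^2)}"
  shows "(\<Sum>p\<in>R\<times>R. \<Sum>p'\<in>R\<times>R. exp (- c * (\<Sum>i<K.
      (dist_int (of_int (fst p - fst p' + int i * (snd p - snd p')) / real (K^2)))\<^sup>2)))
    / (real (card (R \<times> R)))\<^sup>2 \<le> line_bound c K"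
proof -
  define N where "N = K^2"
  have N: "N > 0" using K by (simp add: N_def)
  have RN: "R = {0..<int N}" by (simp add: R_def N_def)
  define ta where "ta = sqrt (c / 250 * real K)"
  define tb where "tb = sqrt (c / 250 * real K ^ 3)"
  have t: "ta > 0" "tb > 0" using c K by (auto simp: ta_def tb_def)
  define F where "F = (\<lambda>p p'. exp (- c * (\<Sum>i<K.
      (dist_int (of_int (fst p - fst p' + int i * (snd p - snd p')) / real N))\<^sup>2)))"
  define G where "G = (\<lambda>t (A::int) (A'::int). exp (- (t * dist_int (of_int (A - A') / real N))\<^sup>2))"
  have G0: "0 \<le> G t A A'" for t A A' by (simp add: G_def)
  have F: "F p p' \<le> exp (- (c / 250 * real K)) + G ta (fst p) (fst p') * G tb (snd p) (snd p')" for p p'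
  proof -
    define a where "a = real_of_int (fst p - fst p') / real N"
    define b where "b = real_of_int (snd p - snd p') / real N"
    have F_eq: "F p p' = exp (- c * (\<Sum>i<K. (dist_int (a + real i * b))\<^sup>2))"
      by (simp add: F_def a_def b_def add_divide_distrib)
    from sum_dist_int_line_ge[OF K, of a b] show ?thesis
    proof
      assume "(\<Sum>i<K. (dist_int (a + real i * b))\<^sup>2) \<ge> real K / 250"
      hence "c * (real K / 250) \<le> c * (\<Sum>i<K. (dist_int (a + real i * b))\<^sup>2)" using c by (intro mult_left_mono) auto
      hence "F p p' \<le> exp (- (c / 250 * real K))" unfolding F_eq by simp
      thus ?thesis using G0 by (simp add: add_increasing2)
    next
      assume "(\<Sum>i<K. (dist_int (a + real i * b))\<^sup>2) \<ge> (real K * (dist_int a)\<^sup>2 + real K ^ 3 * (dist_int b)\<^sup>2) / 250"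
      hence "c * ((real K * (dist_int a)\<^sup>2 + real K ^ 3 * (dist_int b)\<^sup>2) / 250) \<le> c * (\<Sum>i<K. (dist_int (a + real i * b))\<^sup>2)"
        using c by (intro mult_left_mono) auto
      hence "F p p' \<le> exp (- (c * ((real K * (dist_int a)\<^sup>2 + real K ^ 3 * (dist_int b)\<^sup>2) / 250)))" unfolding F_eq by simp
      also have "\<dots> = G ta (fst p) (fst p') * G tb (snd p) (snd p')"
        using c by (simp add: G_def ta_def tb_def a_def b_def exp_add[symmetric]
          power_mult_distrib, simp add: algebra_simps)
      finally show ?thesis by (simp add: add_increasing)
    qed
  qed
  have inner: "(\<Sum>p\<in>R\<times>R. F p p') \<le> real N ^ 2 * exp (- (c / 250 * real K)) +
     (4 * (1 + real N / ta)) * (4 * (1 + real N / tb))" for p'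
  proof -
    have "(\<Sum>p\<in>R\<times>R. F p p') \<le> (\<Sum>p\<in>R\<times>R. exp (- (c / 250 * real K)) + G ta (fst p) (fst p') * G tb (snd p) (snd p'))"
      by (rule sum_mono) (rule F)
    also have "\<dots> = real N ^ 2 * exp (- (c / 250 * real K)) + (\<Sum>A\<in>R. G ta A (fst p')) * (\<Sum>B\<in>R. G tb B (snd p'))"
      by (simp add: sum.distrib RN card_cartesian_product power2_eq_square sum_product sum.cartesian_product case_prod_beta)
    also have "(\<Sum>A\<in>R. G ta A (fst p')) * (\<Sum>B\<in>R. G tb B (snd p')) \<le> (4 * (1 + real N / ta)) * (4 * (1 + real N / tb))"
      unfolding G_def RN using N t by (intro mult_mono sum_exp_dist_int_le) (auto intro!: sum_nonneg)
    finally show ?thesis by simp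
  qed
  have "(\<Sum>p\<in>R\<times>R. \<Sum>p'\<in>R\<times>R. F p p') = (\<Sum>p'\<in>R\<times>R. \<Sum>p\<in>R\<times>R. F p p')" by (rule sum.swap)
  also have "\<dots> \<le> (\<Sum>p'\<in>R\<times>R. real N ^ 2 * exp (- (c / 250 * real K)) + (4 * (1 + real N / ta)) * (4 * (1 + real N / tb)))"
    by (rule sum_mono) (rule inner)
  also have "\<dots> = real N ^ 2 * (real N ^ 2 * exp (- (c / 250 * real K)) + (4 * (1 + real N / ta)) * (4 * (1 + real N / tb)))"
    by (simp add: RN card_cartesian_product power2_eq_square)
  also have "\<dots> = line_bound c K * (real N ^ 2)\<^sup>2"
  proof -
    define x y where "x = 1 / real N + 1 / ta" and "y = 1 / real N + 1 / tb"
    have eqs: "1 + real N / ta = real N * x" "1 + real N / tb = real N * y"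
      using N by (auto simp: x_def y_def field_simps)
    have "line_bound c K = exp (- (c / 250 * real K)) + 16 * x * y"
      by (simp add: line_bound_def ta_def tb_def N_def x_def y_def)
    thus ?thesis unfolding eqs by (simp add: power2_eq_square algebra_simps)
  qed
  finally have "(\<Sum>p\<in>R\<times>R. \<Sum>p'\<in>R\<times>R. F p p') \<le> line_bound c K * (real N ^ 2)\<^sup>2" .
  moreover have "real (card (R \<times> R)) = real N ^ 2" by (simp add: RN card_cartesian_product power2_eq_square)
  ultimately show ?thesis using N unfolding F_def N_def[symmetric] by (simp add: divide_le_eq)
qed

section \<open>Equidistribution modulo a polynomial\<close>

definition ipoly :: "nat \<Rightarrow> (nat \<Rightarrow> int) \<Rightarrow> int poly" where
  "ipoly n a = (\<Sum>j\<le>n. monom (a j) j)"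

lemma coeff_ipoly: "coeff (ipoly n a) j = (if j \<le> n then a j else 0)"
proof -
  have "coeff (ipoly n a) j = (\<Sum>i\<le>n. if i = j then a i else 0)"
    by (simp add: ipoly_def coeff_sum)
  thus ?thesis by (simp add: sum.delta')
qed

lemma degree_ipoly_le: "degree (ipoly n a) \<le> n"
  by (rule degree_le) (simp add: coeff_ipoly)

text \<open>The linear functional sending \<open>x^j\<close> to \<open>u j\<close>. It kills all
  multiples of \<open>H\<close> when \<open>u\<close> satisfies the linear recurrence with
  characteristic polynomial \<open>H\<close>.\<close>

definition pairing :: "(nat \<Rightarrow> int) \<Rightarrow> int poly \<Rightarrow> int" where
  "pairing u F = (\<Sum>j\<le>degree F. coeff F j * u j)"

lemma pairing_upto: "degree F \<le> B \<Longrightarrow> pairing u F = (\<Sum>j\<le>B. coeff F j * u j)"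
  unfolding pairing_def by (intro sum.mono_neutral_left) (auto simp: coeff_eq_0)

lemma pairing_add: "pairing u (F + G) = pairing u F + pairing u G"
proof -
  define B where "B = max (degree F) (degree G)"
  have "degree (F + G) \<le> B" by (simp add: B_def degree_add_le)
  moreover have "degree F \<le> B" "degree G \<le> B" by (auto simp: B_def)
  ultimately show ?thesis by (simp add: pairing_upto sum.distrib algebra_simps)
qed

lemma pairing_smult: "pairing u (smult c F) = c * pairing u F"
proof -
  have "degree (smult c F) \<le> degree F" by (rule degree_smult_le)
  from pairing_upto[OF this] show ?thesis by (simp add: pairing_def sum_distrib_left mult.assoc)
qed

lemma pairing_pCons_0: "pairing u (pCons 0 F) = pairing (\<lambda>j. u (Suc j)) F"
proof -
  have "pairing u (pCons 0 F) = (\<Sum>j\<le>Suc (degree F). coeff (pCons 0 F) j * u j)"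
    by (rule pairing_upto) (rule degree_pCons_le)
  also have "\<dots> = (\<Sum>j\<le>degree F. coeff F j * u (Suc j))"
    by (subst sum.atMost_Suc_shift) simp
  finally show ?thesis by (simp only: pairing_def)
qed

lemma pairing_ipoly: "pairing u (ipoly n a) = (\<Sum>j\<le>n. a j * u j)"
  by (subst pairing_upto[OF degree_ipoly_le]) (auto simp: coeff_ipoly intro!: sum.cong)

text \<open>The adjoint of multiplication by \<open>H\<close>: multiplication by \<open>x\<close>
  acts on sequences as the shift.\<close>

lemma pairing_mult:
  "pairing u (H * Q) = pairing (\<lambda>k. \<Sum>i\<le>degree H. coeff H i * u (k + i)) Q"
proof (induction Q arbitrary: u)
  case (pCons c Q)
  have "pairing u (pCons c F) = c * u 0 + pairing (\<lambda>j. u (Suc j)) F" for u c F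
  proof -
    have "pCons c F = [:c:] + pCons 0 F" by simp
    thus ?thesis by (simp only: pairing_add pairing_pCons_0) (simp add: pairing_def)
  qed
  thus ?case
    by (simp add: mult_pCons_right pairing_add pairing_smult pairing_pCons_0 pCons.IH)
      (simp add: pairing_def)
qed (simp add: pairing_def)

lemma pairing_recurrence:
  assumes "\<And>k. (\<Sum>i\<le>degree H. coeff H i * u (k + i)) = 0"
  shows "pairing u (H * Q) = 0"
  unfolding pairing_mult assms by (simp add: pairing_def)

text \<open>For monic \<open>H\<close>, the solution of its recurrence with the first
  \<open>degree H\<close> values prescribed by \<open>t\<close>.\<close>

fun rec_seq :: "int poly \<Rightarrow> (nat \<Rightarrow> int) \<Rightarrow> nat \<Rightarrow> int" where
  "rec_seq H t j = (if j < degree H then t j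
     else - (\<Sum>i\<in>{..<degree H}. coeff H i * rec_seq H t (j - degree H + i)))"

declare rec_seq.simps [simp del]

lemma rec_seq_init: "j < degree H \<Longrightarrow> rec_seq H t j = t j"
  by (subst rec_seq.simps) simp

lemma rec_seq_recurrence:
  assumes "lead_coeff H = 1"
  shows "(\<Sum>i\<le>degree H. coeff H i * rec_seq H t (k + i)) = 0"
proof -
  have "rec_seq H t (k + degree H) = - (\<Sum>i\<in>{..<degree H}. coeff H i * rec_seq H t (k + i))"
    by (subst rec_seq.simps) simp
  thus ?thesis using assms by (simp flip: lessThan_Suc_atMost)
qed

text \<open>Since \<open>H(0)\<close> is a unit, the recurrence can be run backwards, so a run of \<open>degree H\<close>
  zeros forces everything before it to vanish.\<close>

lemma recurrence_zero_window:
  fixes d :: "nat \<Rightarrow> int"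
  assumes rec: "\<And>k. (\<Sum>i\<le>degree H. coeff H i * d (k + i)) = 0"
    and cop: "coprime (coeff H 0) N" and deg: "degree H > 0"
    and window: "\<And>i. i < degree H \<Longrightarrow> N dvd d (k + i)"
  shows "i < degree H \<Longrightarrow> N dvd d i"
  using window
proof (induction k arbitrary: i)
  case (Suc k)
  note prems = Suc.prems
  have "N dvd d (k + j)" if "j < degree H" for j
  proof (cases j)
    case 0
    have "{..degree H} = insert 0 {1..degree H}" by auto
    hence "0 = coeff H 0 * d k + (\<Sum>i\<in>{1..degree H}. coeff H i * d (k + i))"
      using rec[of k] by simp
    moreover have "N dvd (\<Sum>i\<in>{1..degree H}. coeff H i * d (k + i))"
    proof (intro dvd_sum dvd_mult)
      fix i assume i: "i \<in> {1..degree H}"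
      then obtain i' where "i = Suc i'" by (cases i) auto
      thus "N dvd d (k + i)" using prems(2)[of i'] i by simp
    qed
    ultimately have "N dvd - (coeff H 0 * d k)" by (simp add: eq_neg_iff_add_eq_0[symmetric])
    moreover have "coprime N (coeff H 0)" using cop by (simp add: coprime_commute)
    ultimately have "N dvd d k" by (simp add: coprime_dvd_mult_right_iff)
    thus ?thesis using 0 by simp
  next
    case j: (Suc j')
    thus ?thesis using prems(2)[of j'] that by simp
  qed
  thus ?case using Suc.IH Suc.prems(1) by blast
qed simp

context bounded_law
begin

text \<open>The characters are the recurrence sequences with initial values in
  \<open>{0..<N}\<close>. The diagonal of the Fourier bound gives \<open>N^(-D)\<close>. A
  difference of two distinct ones solves the same recurrence, so by
  \<open>recurrence_zero_window\<close> it is nonzero modulo \<open>N\<close> somewhere in each of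
  the disjoint windows of length \<open>D\<close>, and each window adds at least
  \<open>1 / N^2\<close> to the sum of squared distances.\<close>

lemma prb_dvd_mod_le:
  fixes N \<Delta> :: nat and H :: "int poly"
  assumes char: "\<And>\<theta>. char_abs \<theta> \<le> exp (- c * (dist_int (real \<Delta> * \<theta>))\<^sup>2)" and c: "c > 0"
    and H: "lead_coeff H = 1" "degree H > 0" "coprime (coeff H 0) (int N)"
    and N: "N > 0" "coprime \<Delta> N"
  shows "prb n (\<lambda>a. \<exists>Q. [:int N:] dvd ipoly n a - H * Q)
    \<le> 1 / real N ^ degree H + exp (- (c * real ((n + 1) div degree H) / real N ^ 2))"
proof -
  define D where "D = degree H"
  define I where "I = PiE {..<D} (\<lambda>_. {0..<int N})"
  define u where "u = rec_seq H"
  define W where "W = (n + 1) div D"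
  define \<epsilon> where "\<epsilon> = exp (- (c * real W / real N ^ 2))"
  have D: "D > 0" using H by (simp add: D_def)
  have I: "finite I" "I \<noteq> {}" "card I = N ^ D"
    using N by (auto simp: I_def card_PiE PiE_eq_empty_iff intro!: finite_PiE)
  let ?P = "\<lambda>i i'. \<Prod>j\<le>n. char_abs (of_int (u i j - u i' j) / real N)"
  have off: "?P i i' \<le> \<epsilon>" if ii: "i \<in> I" "i' \<in> I" "i \<noteq> i'" for i i'
  proof -
    define d where "d = (\<lambda>j. u i j - u i' j)"
    define g where "g = (\<lambda>j. (dist_int (real \<Delta> * (of_int (d j) / real N)))\<^sup>2)"
    have g0: "0 \<le> g j" for j by (simp add: g_def)
    have rec: "(\<Sum>i\<le>degree H. coeff H i * d (k + i)) = 0" for k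
      using rec_seq_recurrence[OF H(1), of i k] rec_seq_recurrence[OF H(1), of i' k]
      by (simp add: d_def u_def algebra_simps sum_subtractf)
    have ex: "\<exists>j\<in>{k..<k+D}. \<not> int N dvd d j" for k
    proof (rule ccontr)
      assume "\<not> ?thesis"
      hence "int N dvd d (k + i)" if "i < degree H" for i using that by (auto simp: D_def)
      hence dv: "int N dvd d j" if "j < D" for j
        using recurrence_zero_window[OF rec H(3,2)] that unfolding D_def by blast
      have "i = i'"
      proof (rule PiE_ext[OF ii(1,2)[unfolded I_def]])
        fix j assume j: "j \<in> {..<D}"
        have "int N dvd i j - i' j" using dv[of j] j by (simp add: d_def u_def rec_seq_init D_def)
        hence "i j mod int N = i' j mod int N" by (simp add: mod_eq_dvd_iff)
        moreover have "i j \<in> {0..<int N}" "i' j \<in> {0..<int N}" using ii j unfolding I_def by blast+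
        ultimately show "i j = i' j" by simp
      qed
      thus False using ii by simp
    qed
    have win: "1 / real N ^ 2 \<le> (\<Sum>j\<in>{k..<k+D}. g j)" for k
    proof -
      obtain j where j: "j \<in> {k..<k+D}" "\<not> int N dvd d j" using ex by blast
      \<comment> \<open>Coprimality with \<open>N\<close> keeps the factor \<open>\<Delta>\<close>
        of the characteristic function bound from killing a nonzero residue.\<close>
      have "coprime (int N) (int \<Delta>)" using N(2) by (simp add: coprime_commute)
      hence "\<not> int N dvd int \<Delta> * d j" using j(2) by (simp add: coprime_dvd_mult_right_iff)
      from dist_int_fraction_ge[OF N(1) this] have "1 / real N \<le> dist_int (real \<Delta> * (of_int (d j) / real N))" by simp
      hence "(1 / real N)\<^sup>2 \<le> g j" unfolding g_def by (intro power_mono) auto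
      also have "g j \<le> (\<Sum>j\<in>{k..<k+D}. g j)" using j g0 by (intro member_le_sum) auto
      finally show ?thesis by (simp add: power_divide)
    qed
    have "W * D \<le> n + 1" unfolding W_def by (rule div_times_less_eq_dividend)
    have "real W / real N ^ 2 = (\<Sum>m<W. 1 / real N ^ 2)" by simp
    also have "\<dots> \<le> (\<Sum>m<W. \<Sum>j\<in>{m*D..<m*D+D}. g j)" by (rule sum_mono) (rule win)
    also have "\<dots> = (\<Sum>j<W*D. g j)" by (rule sum.nat_group)
    also have "\<dots> \<le> (\<Sum>j\<le>n. g j)" using \<open>W * D \<le> n + 1\<close> g0 by (intro sum_mono2) auto
    finally have "real W / real N ^ 2 \<le> (\<Sum>j\<le>n. g j)" .
    hence "c * (real W / real N ^ 2) \<le> c * (\<Sum>j\<le>n. g j)" using c by (intro mult_left_mono) auto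
    hence "exp (- c * (\<Sum>j\<le>n. g j)) \<le> \<epsilon>" by (simp add: \<epsilon>_def)
    thus ?thesis using prod_char_abs_le[OF char, of "\<lambda>j. of_int (d j) / real N" "{..n}"]
      by (simp add: g_def d_def)
  qed
  have one: "char_abs 0 \<le> 1" using char[of 0] by (simp add: dist_int_def)
  have "prb n (\<lambda>a. \<exists>Q. [:int N:] dvd ipoly n a - H * Q)
      \<le> (\<Sum>i\<in>I. \<Sum>i'\<in>I. ?P i i') / (real (card I))\<^sup>2"
  proof (rule prb_fourier[OF I(1,2) N(1)])
    fix a i assume "\<exists>Q. [:int N:] dvd ipoly n a - H * Q"
    then obtain Q R where "ipoly n a - H * Q = [:int N:] * R" by (auto elim: dvdE)
    hence "ipoly n a = H * Q + smult (int N) R" by (simp add: algebra_simps)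
    hence "pairing (u i) (ipoly n a) = int N * pairing (u i) R"
      using pairing_recurrence[OF rec_seq_recurrence[OF H(1)], of i Q]
      by (simp add: pairing_add pairing_smult u_def)
    thus "int N dvd (\<Sum>j\<le>n. a j * u i j)" by (simp add: pairing_ipoly)
  qed
  also have "\<dots> \<le> (\<Sum>i\<in>I. 1 + real (card I) * \<epsilon>) / (real (card I))\<^sup>2"
  proof (intro divide_right_mono sum_mono)
    fix i assume i: "i \<in> I"
    have "(\<Sum>i'\<in>I. ?P i i')
        \<le> (\<Sum>i'\<in>I. (if i' = i then 1 else 0) + \<epsilon>)"
    proof (rule sum_mono)
      fix i' assume i': "i' \<in> I"
      show "?P i i' \<le> (if i' = i then 1 else 0) + \<epsilon>"
      proof (cases "i' = i")
        case True
        have "(\<Prod>j\<le>n. char_abs 0) \<le> (\<Prod>j\<le>n. 1)" using one by (intro prod_mono) auto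
        thus ?thesis using True by (simp add: \<epsilon>_def add_increasing2)
      next
        case False
        thus ?thesis using off[OF i i'] by auto
      qed
    qed
    also have "\<dots> = 1 + real (card I) * \<epsilon>" using i I(1) by (simp add: sum.distrib)
    finally show "(\<Sum>i'\<in>I. ?P i i') \<le> 1 + real (card I) * \<epsilon>" .
  qed simp
  also have "\<dots> = 1 / real N ^ D + \<epsilon>"
    using N by (simp add: I(3) field_simps power2_eq_square)
  finally show ?thesis by (simp add: D_def \<epsilon>_def W_def)
qed

end

section \<open>Integer polynomials modulo an integer\<close>

definition monic :: "int poly \<Rightarrow> bool" where
  "monic G \<longleftrightarrow> lead_coeff G = 1"

text \<open>Divisibility in the polynomial ring over the integers modulo \<open>N\<close>, expressed
  with integer representatives.\<close>

definition mdvd :: "int \<Rightarrow> int poly \<Rightarrow> int poly \<Rightarrow> bool" where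
  "mdvd N G F \<longleftrightarrow> (\<exists>Q. [:N:] dvd F - G * Q)"

lemma mdvdI: "[:N:] dvd F - G * Q \<Longrightarrow> mdvd N G F"
  by (auto simp: mdvd_def)

lemma mdvd_refl [simp]: "mdvd N G G"
  by (rule mdvdI[of _ _ _ 1]) simp

lemma mdvd_mult [simp]: "mdvd N G (G * F)"
  by (rule mdvdI[of _ _ _ F]) simp

lemma mdvd_trans:
  assumes "mdvd N A B" "mdvd N B C"
  shows "mdvd N A C"
proof -
  obtain Q R where "[:N:] dvd B - A * Q" "[:N:] dvd C - B * R" using assms by (auto simp: mdvd_def)
  hence "[:N:] dvd (C - B * R) + (B - A * Q) * R" by (intro dvd_add dvd_mult2)
  thus ?thesis by (intro mdvdI[of _ _ _ "Q * R"]) (simp add: algebra_simps)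
qed

lemma mdvd_mult_right: "mdvd N A B \<Longrightarrow> mdvd N A (B * C)"
  using mdvd_trans mdvd_mult by blast

lemma mdvd_mult_left: "mdvd N A B \<Longrightarrow> mdvd N A (C * B)"
  using mdvd_mult_right[of N A B C] by (simp add: mult.commute)

lemma mdvd_add:
  assumes "mdvd N A B" "mdvd N A C"
  shows "mdvd N A (B + C)"
proof -
  obtain Q R where "[:N:] dvd B - A * Q" "[:N:] dvd C - A * R" using assms by (auto simp: mdvd_def)
  hence "[:N:] dvd (B - A * Q) + (C - A * R)" by (rule dvd_add)
  thus ?thesis by (intro mdvdI[of _ _ _ "Q + R"]) (simp add: algebra_simps)
qed

lemma mdvd_uminus: "mdvd N A B \<Longrightarrow> mdvd N A (- B)"
  using mdvd_mult_left[of N A B "-1"] by simp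

lemma mdvd_diff: "mdvd N A B \<Longrightarrow> mdvd N A C \<Longrightarrow> mdvd N A (B - C)"
  using mdvd_add[OF _ mdvd_uminus, of N A B C] by simp

lemma mdvd_const: "[:N:] dvd B \<Longrightarrow> mdvd N A B"
  by (rule mdvdI[of _ _ _ 0]) simp

lemma mdvd_cong_right: "[:N:] dvd B - C \<Longrightarrow> mdvd N A C \<Longrightarrow> mdvd N A B"
  using mdvd_add[OF mdvd_const, of N "B - C" A C] by simp

lemma mdvd_cong_left:
  assumes "[:N:] dvd A - A'" "mdvd N A B"
  shows "mdvd N A' B"
proof -
  obtain Q where "[:N:] dvd B - A * Q" using assms by (auto simp: mdvd_def)
  hence "[:N:] dvd (B - A * Q) + (A - A') * Q" using assms(1) by (intro dvd_add dvd_mult2)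
  thus ?thesis by (intro mdvdI[of _ _ _ Q]) (simp add: algebra_simps)
qed

section \<open>Monic divisors and division with remainder modulo N\<close>

lemma dvd_const_monic:
  assumes "monic G" "[:N:] dvd G"
  shows "is_unit N"
  using assms by (metis const_poly_dvd_iff monic_def)

lemma reduce_mod:
  fixes N :: int
  obtains R where "[:N:] dvd F - R" "\<And>i. coeff R i = coeff F i mod N" "degree R \<le> degree F"
proof
  let ?R = "map_poly (\<lambda>x. x mod N) F"
  show "coeff ?R i = coeff F i mod N" for i by (simp add: coeff_map_poly)
  thus "[:N:] dvd F - ?R" by (simp add: const_poly_dvd_iff)
  show "degree ?R \<le> degree F" by (rule degree_le) (simp add: coeff_map_poly coeff_eq_0)
qed

text \<open>After reduction modulo \<open>N\<close>, a nonzero cofactor has a leading coefficient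
  that is not divisible by \<open>N\<close>, and this survives in a degree at least
  \<open>degree A\<close>, where \<open>r\<close> has no terms.\<close>

lemma low_degree_multiple_of_monic:
  assumes A: "monic A" and deg: "degree r < degree A" and N: "N > 1" and "mdvd N A r"
  shows "[:N:] dvd r"
proof -
  obtain Q0 where Q0: "[:N:] dvd r - A * Q0" using assms by (auto simp: mdvd_def)
  obtain Q where Q: "[:N:] dvd Q0 - Q" "\<And>i. coeff Q i = coeff Q0 i mod N"
    by (rule reduce_mod[of N Q0]) blast
  have "[:N:] dvd (r - A * Q0) + A * (Q0 - Q)" using Q0 Q(1) by (intro dvd_add dvd_mult)
  hence D: "[:N:] dvd r - A * Q" by (simp add: algebra_simps)
  have "Q = 0"
  proof (rule ccontr)
    assume "Q \<noteq> 0"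
    define i where "i = degree A + degree Q"
    have "coeff (r - A * Q) i = - lead_coeff Q"
      using deg A by (simp add: i_def coeff_eq_0 coeff_mult_degree_sum monic_def)
    hence "N dvd lead_coeff Q" using D by (metis const_poly_dvd_iff dvd_minus_iff)
    moreover have "0 < lead_coeff Q" "lead_coeff Q < N"
      using \<open>Q \<noteq> 0\<close> Q(2)[of "degree Q"] N
        pos_mod_bound[of N "coeff Q0 (degree Q)"] pos_mod_sign[of N "coeff Q0 (degree Q)"]
      by (auto simp: order_less_le)
    ultimately show False using zdvd_not_zless by blast
  qed
  thus ?thesis using D by simp
qed

text \<open>Multiply by an inverse \<open>a'\<close> of the leading coefficient modulo
  \<open>N\<close> and reduce.\<close>

lemma monic_normalize:
  assumes N: "N > 1" and cop: "coprime (lead_coeff f) N"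
  obtains G a a' where "monic G" "degree G = degree f" "\<And>i. coeff G i \<in> {0..<N}"
    "[:N:] dvd f - smult a G" "[:N:] dvd G - smult a' f" "coprime a N"
proof -
  define a where "a = lead_coeff f"
  obtain a' where "[a * a' = 1] (mod N)" using cong_solve_coprime_int[of a N] cop a_def by auto
  hence a': "(a' * a) mod N = 1" using N by (simp add: cong_def mult.commute)
  define G where "G = map_poly (\<lambda>x. (a' * x) mod N) f"
  have cG: "coeff G i = (a' * coeff f i) mod N" for i by (simp add: G_def coeff_map_poly)
  have dG: "degree G = degree f"
  proof (rule antisym)
    show "degree G \<le> degree f" by (rule degree_le) (simp add: cG coeff_eq_0)
    show "degree f \<le> degree G" using a' by (intro le_degree) (simp add: cG a_def)
  qed
  show ?thesis
  proof
    show "monic G" using a' by (simp add: monic_def dG cG a_def)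
    show "coeff G i \<in> {0..<N}" for i using N by (simp add: cG)
    show "[:N:] dvd G - smult a' f" by (simp add: const_poly_dvd_iff cG mod_eq_dvd_iff[symmetric])
    show "[:N:] dvd f - smult a G"
      unfolding const_poly_dvd_iff
    proof
      fix i
      have "(a * coeff G i) mod N = (a * (a' * coeff f i)) mod N" by (simp add: cG mod_mult_right_eq)
      also have "a * (a' * coeff f i) = (a' * a) * coeff f i" by (simp add: mult_ac)
      also have "\<dots> mod N = ((a' * a) mod N * coeff f i) mod N" by (simp only: mod_mult_left_eq)
      finally have "coeff f i mod N = (a * coeff G i) mod N" using a' by simp
      thus "N dvd coeff (f - smult a G) i" by (simp add: mod_eq_dvd_iff)
    qed
    show "coprime a N" using cop by (simp add: a_def)
  qed (rule dG)
qed

text \<open>The leading coefficient may vanish modulo \<open>l\<close>, so the degree can drop: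
  reduce first, then normalize.\<close>

lemma monic_normalize_prime:
  assumes l: "prime (l::int)" and f: "\<not> [:l:] dvd f"
  obtains G a a' where "monic G" "degree G \<le> degree f"
    "[:l:] dvd f - smult a G" "[:l:] dvd G - smult a' f"
proof -
  obtain R where R: "[:l:] dvd f - R" "\<And>i. coeff R i = coeff f i mod l" "degree R \<le> degree f"
    by (rule reduce_mod[of l f]) blast
  have "R \<noteq> 0" using R f by auto
  hence "\<not> l dvd lead_coeff R" using R(2)[of "degree R"] by (metis leading_coeff_0_iff mod_mod_trivial dvd_imp_mod_0)
  hence "coprime (lead_coeff R) l" using l by (metis prime_imp_coprime coprime_commute)
  then obtain G a a' where G: "monic G" "degree G = degree R" "[:l:] dvd R - smult a G" "[:l:] dvd G - smult a' R"
    using monic_normalize[of l R] prime_gt_1_int[OF l] by metis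
  have "[:l:] dvd (f - R) + (R - smult a G)" by (rule dvd_add[OF R(1) G(3)])
  hence 1: "[:l:] dvd f - smult a G" by simp
  have "[:l:] dvd (G - smult a' R) - smult a' (f - R)" by (rule dvd_diff[OF G(4) dvd_smult[OF R(1)]])
  hence "[:l:] dvd G - smult a' f" by (simp add: smult_diff_right)
  with 1 show ?thesis using that[of G a a'] G R by simp
qed

lemma monic_division:
  assumes "monic A"
  obtains q r where "F = A * q + r" "degree r < degree A \<or> r = 0"
proof -
  have A0: "A \<noteq> 0" using assms by (auto simp: monic_def)
  \<comment> \<open>With leading coefficient 1 the scaling factor of pseudo-division is 1.\<close>
  obtain q r where qr: "pseudo_divmod F A = (q, r)" by fastforce
  show ?thesis using that[of q r] pseudo_divmod[OF A0 qr] assms by (auto simp: monic_def)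
qed

lemma monic_mult: "monic A \<Longrightarrow> monic B \<Longrightarrow> monic (A * B)"
  by (simp add: monic_def lead_coeff_mult)

lemma degree_mult_monic: "monic A \<Longrightarrow> monic B \<Longrightarrow> degree (A * B) = degree A + degree B"
  by (rule degree_mult_eq) (auto simp: monic_def)

lemma monic_prod: "(\<And>x. x \<in> S \<Longrightarrow> monic (f x)) \<Longrightarrow> monic (prod f S)"
  by (induction S rule: infinite_finite_induct) (auto intro: monic_mult simp: monic_def lead_coeff_mult)

lemma degree_prod_monic: "(\<And>x. x \<in> S \<Longrightarrow> monic (f x)) \<Longrightarrow> degree (prod f S) = (\<Sum>x\<in>S. degree (f x))"
  by (induction S rule: infinite_finite_induct) (auto simp: degree_mult_monic monic_prod)

lemma mdvd_degree_le:
  assumes "monic D" "mdvd N D W" "N > 1" "\<not> [:N:] dvd W"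
  shows "degree D \<le> degree W"
  using low_degree_multiple_of_monic[of D W N] assms by linarith

lemma monic_not_dvd: "monic G \<Longrightarrow> N > 1 \<Longrightarrow> \<not> [:N:] dvd G"
  using dvd_const_monic[of G N] by auto

lemma mdvd_monic_cofactor:
  assumes A: "monic A" and G: "monic G" and N: "N > 1" and AG: "mdvd N A G"
  obtains B where "monic B" "degree G = degree A + degree B" "[:N:] dvd G - A * B"
proof -
  obtain B r where Br: "G = A * B + r" "degree r < degree A \<or> r = 0" by (rule monic_division[OF A])
  have le: "degree A \<le> degree G" by (rule mdvd_degree_le[OF A AG N monic_not_dvd[OF G N]])
  have "mdvd N A (G - A * B)" by (intro mdvd_diff AG mdvd_mult)
  hence rA: "mdvd N A r" using Br(1) by simp
  have r: "[:N:] dvd r"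
    using low_degree_multiple_of_monic[OF A _ N rA] Br(2) by auto
  have B0: "B \<noteq> 0"
  proof
    assume "B = 0"
    hence "[:N:] dvd G" using Br r by simp
    thus False using monic_not_dvd[OF G N] by simp
  qed
  have A0: "A \<noteq> 0" using A by (auto simp: monic_def)
  have dAB: "degree (A * B) = degree A + degree B" using A0 B0 by (rule degree_mult_eq)
  have lead: "degree G = degree A + degree B \<and> lead_coeff G = lead_coeff A * lead_coeff B"
  proof (cases "r = 0")
    case True
    thus ?thesis using Br dAB by (simp add: coeff_mult_degree_sum)
  next
    case False
    hence "degree r < degree (A * B)" using Br(2) dAB by simp
    thus ?thesis using Br(1) dAB by (simp add: degree_add_eq_left coeff_eq_0 coeff_mult_degree_sum)
  qed
  show ?thesis
    by (rule that[of B]) (use A G lead r Br in \<open>auto simp: monic_def\<close>)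
qed

section \<open>Irreducible polynomials modulo a prime\<close>

definition irred_mod :: "int \<Rightarrow> int poly \<Rightarrow> bool" where
  "irred_mod N G \<longleftrightarrow> monic G \<and> degree G > 0 \<and>
     (\<forall>A. monic A \<longrightarrow> mdvd N A G \<longrightarrow> degree A = 0 \<or> degree A \<ge> degree G)"

lemma monic_degree_0: "monic A \<Longrightarrow> degree A = 0 \<Longrightarrow> A = 1"
  by (auto simp: monic_def elim!: degree_eq_zeroE)

text \<open>Euclid's lemma. A monic combination \<open>K\<close> of \<open>G\<close> and
  \<open>A\<close> of least degree divides both modulo \<open>l\<close>. If \<open>K\<close> is 1,
  multiply the Bezout relation by \<open>B\<close>; otherwise irreducibility makes \<open>K\<close>
  equal to \<open>G\<close> modulo \<open>l\<close>, contradicting \<open>nA\<close>.\<close>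

lemma irred_mod_prime:
  assumes l: "prime (l::int)" and G: "irred_mod l G" and AB: "mdvd l G (A * B)" and nA: "\<not> mdvd l G A"
  shows "mdvd l G B"
proof -
  note l1 = prime_gt_1_int[OF l]
  have monG: "monic G" using G by (simp add: irred_mod_def)
  define S where "S = {K. monic K \<and> (\<exists>X Y. [:l:] dvd K - (X * G + Y * A))}"
  have GS: "G \<in> S"
  proof -
    have "[:l:] dvd G - (1 * G + 0 * A)" by simp
    thus ?thesis unfolding S_def using monG by blast
  qed
  define K where "K = arg_min degree (\<lambda>K. K \<in> S)"
  have KS: "K \<in> S" and Kmin: "\<And>K'. K' \<in> S \<Longrightarrow> degree K \<le> degree K'"
    using GS arg_min_nat_lemma[of "\<lambda>K. K \<in> S" G degree] by (auto simp: K_def)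
  have monK: "monic K" using KS by (simp add: S_def)
  obtain X Y where XY: "[:l:] dvd K - (X * G + Y * A)" using KS by (auto simp: S_def)
  have comb: "mdvd l K T" if T: "T = X' * G + Y' * A" for T X' Y'
  proof -
    obtain q r where qr: "T = K * q + r" "degree r < degree K \<or> r = 0" by (rule monic_division[OF monK])
    have "[:l:] dvd r"
    proof (rule ccontr)
      assume nr: "\<not> [:l:] dvd r"
      \<comment> \<open>A nonzero remainder, made monic, would be a combination of smaller degree
        than \<open>K\<close>.\<close>
      then obtain G1 a a' where G1: "monic G1" "degree G1 \<le> degree r" "[:l:] dvd G1 - smult a' r"
        using monic_normalize_prime[OF l nr] by metis
      define b where "b = [:a':]"
      have sm: "smult a' p = b * p" for p by (simp add: b_def)
      define X2 Y2 where "X2 = b * (X' - X * q)" and "Y2 = b * (Y' - Y * q)"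
      have eq: "G1 - (X2 * G + Y2 * A) = (G1 - smult a' r) + smult a' (- q * (K - (X * G + Y * A)))"
      proof -
        have r: "r = X' * G + Y' * A - K * q" using qr(1) T by simp
        show ?thesis unfolding X2_def Y2_def sm unfolding r by (simp add: algebra_simps)
      qed
      have "[:l:] dvd G1 - (X2 * G + Y2 * A)"
        unfolding eq by (intro dvd_add G1(3) dvd_smult dvd_mult XY)
      hence "G1 \<in> S" using G1(1) by (auto simp: S_def)
      hence "degree K \<le> degree r" using Kmin G1(2) by fastforce
      thus False using qr(2) nr by auto
    qed
    thus ?thesis using qr(1) by (intro mdvdI[of _ _ _ q]) simp
  qed
  have KG: "mdvd l K G" by (rule comb[of G 1 0]) simp
  have KA: "mdvd l K A" by (rule comb[of A 0 1]) simp
  show ?thesis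
  proof (cases "degree K = 0")
    case True
    hence "K = 1" using monic_degree_0 monK by blast
    hence 1: "[:l:] dvd (1 - (X * G + Y * A)) * B" using XY by (intro dvd_mult2) simp
    have "mdvd l G (G * (X * B) + (A * B) * Y)"
      by (intro mdvd_add mdvd_mult mdvd_mult_right[OF AB])
    thus ?thesis
      by (rule mdvd_cong_right[rotated]) (use 1 in \<open>simp add: algebra_simps\<close>)
  next
    case False
    hence ge: "degree K \<ge> degree G" using G KG monK by (auto simp: irred_mod_def)
    obtain B' where B': "monic B'" "degree G = degree K + degree B'" "[:l:] dvd G - K * B'"
      by (rule mdvd_monic_cofactor[OF monK monG l1 KG])
    hence "B' = 1" using ge monic_degree_0 by auto
    hence "[:l:] dvd - (G - K)" using B'(3) by (simp only: dvd_minus_iff) simp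
    hence "[:l:] dvd K - G" by simp
    from mdvd_cong_left[OF this KA] nA show ?thesis by simp
  qed
qed

lemma irred_mod_power:
  assumes l: "prime (l::int)" and G: "irred_mod l G"
  shows "mdvd l G (A ^ k) \<Longrightarrow> mdvd l G A"
proof (induction k)
  case 0
  have "monic G" "degree G > 0" using G by (auto simp: irred_mod_def)
  thus ?case using mdvd_degree_le[of G l 1] 0 prime_gt_1_int[OF l] monic_not_dvd[of 1 l]
    by (auto simp: monic_def)
next
  case (Suc k)
  thus ?case using irred_mod_prime[OF l G, of A "A ^ k"] by auto
qed

text \<open>Canonical representatives modulo \<open>N\<close>, which allow counting and turn
  congruence into equality.\<close>

definition reduced :: "int \<Rightarrow> int poly \<Rightarrow> bool" where
  "reduced N G \<longleftrightarrow> (\<forall>i. coeff G i \<in> {0..<N})"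

lemma reduced_eqI:
  assumes "reduced N G" "reduced N H" "[:N:] dvd G - H"
  shows "G = H"
proof (rule poly_eqI)
  fix i
  have "N dvd coeff G i - coeff H i" using assms(3) by (metis const_poly_dvd_iff coeff_diff)
  hence "coeff G i mod N = coeff H i mod N" by (simp add: mod_eq_dvd_iff)
  thus "coeff G i = coeff H i" using assms(1,2) by (simp add: reduced_def)
qed

text \<open>Induction on \<open>S\<close>: a new \<open>G\<close> does not divide the previous
  product, so by Euclid's lemma it divides the cofactor that this product leaves in
  \<open>W\<close>.\<close>

lemma irred_mod_distinct_prod:
  assumes l: "prime (l::int)" and fin: "finite S"
    and S: "\<And>G. G \<in> S \<Longrightarrow> irred_mod l G \<and> reduced l G \<and> mdvd l G W"
  shows "mdvd l (\<Prod>S) W"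
  using fin S
proof (induction S rule: finite_induct)
  case empty
  show ?case using mdvd_mult[of l 1 W] by simp
next
  case (insert G S)
  note l1 = prime_gt_1_int[OF l]
  have G: "irred_mod l G" "reduced l G" "mdvd l G W" using insert.prems by auto
  have "mdvd l (\<Prod>S) W" using insert by blast
  then obtain V where V: "[:l:] dvd W - \<Prod>S * V" by (auto simp: mdvd_def)
  have "[:l:] dvd - (W - \<Prod>S * V)" using V by (simp only: dvd_minus_iff)
  hence "[:l:] dvd \<Prod>S * V - W" by simp
  from mdvd_cong_right[OF this G(3)] have "mdvd l G (\<Prod>S * V)" .
  moreover have "\<not> mdvd l G (\<Prod>S)"
  proof
    assume "mdvd l G (\<Prod>S)"
    moreover have "\<not> mdvd l G (\<Prod>T)" if "T \<subseteq> S" for T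
      using finite_subset[OF that insert.hyps(1)] that
    proof (induction T rule: finite_induct)
      case empty
      show ?case using irred_mod_power[OF l G(1), of 0 0] mdvd_degree_le[of G l 1] l1 monic_not_dvd[of 1 l] G(1)
        by (auto simp: monic_def irred_mod_def)
    next
      case (insert H T)
      have H: "irred_mod l H" "reduced l H" "H \<noteq> G"
        using insert.prems \<open>\<And>G'. G' \<in> insert G S \<Longrightarrow> irred_mod l G' \<and> reduced l G' \<and> mdvd l G' W\<close> \<open>G \<notin> S\<close>
        by auto
      \<comment> \<open>One monic irreducible dividing another has the same degree, hence equals it
        modulo \<open>l\<close>; reduced representatives then coincide.\<close>
      have "\<not> mdvd l G H"
      proof
        assume GH: "mdvd l G H"
        have mon: "monic G" "monic H" "degree G > 0" using G H by (auto simp: irred_mod_def)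
        obtain B where B: "monic B" "degree H = degree G + degree B" "[:l:] dvd H - G * B"
          by (rule mdvd_monic_cofactor[OF mon(1,2) l1 GH])
        have "degree G \<ge> degree H" using H(1) GH mon by (auto simp: irred_mod_def)
        hence "B = 1" using B monic_degree_0 by auto
        hence "[:l:] dvd H - G" using B(3) by simp
        thus False using reduced_eqI[OF H(2) G(2)] H(3) by blast
      qed
      thus ?case using irred_mod_prime[OF l G(1), of H "\<Prod>T"] insert by auto
    qed
    ultimately show False by blast
  qed
  ultimately have "mdvd l G V" by (rule irred_mod_prime[OF l G(1)])
  then obtain U where U: "[:l:] dvd V - G * U" by (auto simp: mdvd_def)
  have "[:l:] dvd (W - \<Prod>S * V) + \<Prod>S * (V - G * U)" by (intro dvd_add dvd_mult U V)
  thus ?case using insert.hyps by (intro mdvdI[of _ _ _ U]) (simp add: algebra_simps)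
qed

text \<open>Each member has degree at least 1, and the product of any finite subset divides
  \<open>W\<close> modulo \<open>l\<close>.\<close>

lemma card_irred_mod_divisors_le:
  assumes l: "prime (l::int)" and W: "\<not> [:l:] dvd W"
    and S: "\<And>G. G \<in> S \<Longrightarrow> irred_mod l G \<and> reduced l G \<and> mdvd l G W"
  shows "finite S \<and> card S \<le> degree W"
proof (rule finite_if_finite_subsets_card_bdd)
  fix T assume T: "T \<subseteq> S" "finite T"
  have T': "irred_mod l G \<and> reduced l G \<and> mdvd l G W" if "G \<in> T" for G using S T that by auto
  hence mon: "monic G" if "G \<in> T" for G using that by (auto simp: irred_mod_def)
  have "card T \<le> (\<Sum>G\<in>T. degree G)"
    using sum_mono[of T "\<lambda>_. 1" degree] T' by (auto simp: irred_mod_def Suc_le_eq)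
  also have "\<dots> = degree (\<Prod>T)" using degree_prod_monic[of T "\<lambda>G. G"] mon by simp
  also have "\<dots> \<le> degree W"
    using mdvd_degree_le[OF _ irred_mod_distinct_prod[OF l T(2) T'] prime_gt_1_int[OF l] W]
      monic_prod[of T "\<lambda>G. G"] mon by simp
  finally show "card T \<le> degree W" .
qed

text \<open>A reducible divisor of least degree \<open>\<ge> k\<close> splits into two factors of degree \<open>< k\<close>.\<close>

lemma moderate_monic_divisor:
  assumes l: "prime (l::int)" and f: "\<not> l dvd lead_coeff f" and k: "1 \<le> k" "k \<le> degree f"
  obtains G where "monic G" "reduced l G" "k \<le> degree G" "mdvd l G f" "degree G < 2 * k \<or> irred_mod l G"
proof -
  note l1 = prime_gt_1_int[OF l]
  have "coprime (lead_coeff f) l" using l f by (metis prime_imp_coprime coprime_commute)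
  then obtain G0 a where G0: "monic G0" "degree G0 = degree f" "[:l:] dvd f - smult a G0"
    using monic_normalize[OF l1, of f] by metis
  have "[:l:] dvd f - G0 * [:a:]" using G0(3) by simp
  hence G0f: "mdvd l G0 f" by (rule mdvdI)
  define P where "P = (\<lambda>G. monic G \<and> k \<le> degree G \<and> mdvd l G f)"
  define G1 where "G1 = arg_min degree P"
  have "P G0" using G0 G0f k by (simp add: P_def)
  hence G1: "P G1" and min: "\<And>G. P G \<Longrightarrow> degree G1 \<le> degree G"
    using arg_min_nat_lemma[of P G0 degree] by (auto simp: G1_def)
  obtain G a a' where G: "monic G" "degree G = degree G1" "\<And>i. coeff G i \<in> {0..<l}"
    "[:l:] dvd G1 - smult a G" "[:l:] dvd G - smult a' G1"
  proof (rule monic_normalize[OF l1, of G1])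
    show "coprime (lead_coeff G1) l" using G1 by (simp add: P_def monic_def)
  qed blast
  have "mdvd l G G1" using mdvdI[of l G1 G "[:a:]"] G(4) by simp
  hence Gf: "mdvd l G f" using G1 mdvd_trans by (auto simp: P_def)
  have PG: "P G" using G G1 Gf by (auto simp: P_def)
  have "irred_mod l G" if big: "\<not> degree G < 2 * k"
    unfolding irred_mod_def
  proof (intro conjI allI impI)
    fix A assume A: "monic A" "mdvd l A G"
    obtain B where B: "monic B" "degree G = degree A + degree B" "[:l:] dvd G - A * B"
      by (rule mdvd_monic_cofactor[OF A(1) G(1) l1 A(2)])
    have "[:l:] dvd G - B * A" using B(3) by (simp add: mult.commute)
    hence "mdvd l B G" by (rule mdvdI)
    show "degree A = 0 \<or> degree A \<ge> degree G"
    proof (rule ccontr)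
      assume "\<not> ?thesis"
      hence lt: "degree A < degree G1" "degree B < degree G1" using B(2) G(2) by auto
      have "\<not> P A" "\<not> P B" using lt min by (meson not_le)+
      hence "degree A < k" "degree B < k"
        using A B(1) \<open>mdvd l B G\<close> mdvd_trans[OF _ Gf] by (auto simp: P_def)
      thus False using big B(2) by simp
    qed
  qed (use G PG k in \<open>auto simp: P_def\<close>)
  thus ?thesis using that[of G] PG G(3) by (auto simp: P_def reduced_def)
qed

section \<open>Frobenius modulo a prime\<close>

lemma freshman_dvd:
  fixes A B :: "'a::comm_ring_1"
  assumes l: "prime (l::nat)"
  shows "of_nat l dvd (A + B) ^ l - (A ^ l + B ^ l)"
proof -
  have l0: "l > 0" using l by (rule prime_gt_0_nat)
  define t where "t = (\<lambda>k. of_nat (l choose k) * A ^ k * B ^ (l - k))"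
  have "{..l} = insert 0 (insert l {1..<l})" using l0 by auto
  hence "(A + B) ^ l = t 0 + t l + (\<Sum>k\<in>{1..<l}. t k)"
    using l0 unfolding binomial_ring t_def by (simp add: add.assoc)
  hence "(A + B) ^ l - (A ^ l + B ^ l) = (\<Sum>k\<in>{1..<l}. t k)" by (simp add: t_def)
  also have "of_nat l dvd \<dots>"
  proof (rule dvd_sum)
    fix k assume k: "k \<in> {1..<l}"
    have "l dvd (l choose k)" using l k by (intro dvd_choose_prime) auto
    then obtain j where "l choose k = l * j" by (auto elim: dvdE)
    thus "of_nat l dvd t k" by (simp add: t_def mult.assoc)
  qed
  finally show ?thesis .
qed

lemma int_power_prime_cong:
  assumes l: "prime (l::nat)"
  shows "int l dvd c ^ l - c"
proof -
  have nat: "int l dvd int x ^ l - int x" for x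
  proof (induction x)
    case (Suc x)
    have "int l dvd ((int x + 1) ^ l - (int x ^ l + 1 ^ l)) + (int x ^ l - int x)"
      using freshman_dvd[OF l, of "int x" 1] Suc by (intro dvd_add) simp_all
    thus ?case by (simp add: algebra_simps)
  qed (use l in \<open>simp add: power_0_left prime_gt_0_nat\<close>)
  define x where "x = nat (c mod int l)"
  have "int x = c mod int l" using l by (simp add: x_def prime_gt_0_nat)
  with nat[of x] have "(c mod int l) ^ l mod int l = c mod int l" by (simp add: mod_eq_dvd_iff[symmetric])
  hence "c ^ l mod int l = c mod int l" by (simp add: power_mod)
  thus ?thesis by (simp add: mod_eq_dvd_iff)
qed

text \<open>Split off the constant term \<open>c\<close> and combine the freshman's dream, Fermat's
  little theorem for \<open>c\<close> and the induction hypothesis.\<close>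

lemma frobenius_int_poly:
  assumes l: "prime (l::nat)"
  shows "[:int l:] dvd R ^ l - pcompose R (monom 1 l)"
proof (induction R)
  case 0
  show ?case using prime_gt_0_nat[OF l] by (simp add: power_0_left)
next
  case (pCons c R)
  define x where "x = (monom 1 1 :: int poly)"
  have xR: "pCons 0 R = x * R" by (simp add: x_def monom_altdef)
  have xl: "x ^ l = monom 1 l" by (simp add: x_def monom_power)
  have 1: "[:int l:] dvd ([:c:] + x * R) ^ l - ([:c:] ^ l + (x * R) ^ l)"
    using freshman_dvd[OF l, of "[:c:]" "x * R"] by (simp add: of_nat_poly)
  have "[:c:] ^ l - [:c:] = [:c ^ l - c:]" by (simp add: poly_const_pow)
  hence 2: "[:int l:] dvd [:c:] ^ l - [:c:]" using int_power_prime_cong[OF l, of c] by simp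
  have 3: "[:int l:] dvd x ^ l * (R ^ l - pcompose R (monom 1 l))" using pCons.IH by (rule dvd_mult)
  have "pCons c R = [:c:] + x * R" using xR by (metis add.right_neutral add_pCons add_0)
  moreover have "pcompose (pCons c R) (monom 1 l) = [:c:] + x ^ l * pcompose R (monom 1 l)"
    by (simp add: pcompose_pCons xl)
  ultimately have "pCons c R ^ l - pcompose (pCons c R) (monom 1 l) =
     (([:c:] + x * R) ^ l - ([:c:] ^ l + (x * R) ^ l)) + ([:c:] ^ l - [:c:])
     + x ^ l * (R ^ l - pcompose R (monom 1 l))"
    by (simp only: power_mult_distrib) (simp add: algebra_simps)
  thus ?case using 1 2 3 by (simp only: dvd_add)
qed

section \<open>Probability of a square factor\<close>

lemma monic_reduced_finite:
  assumes N: "N > 0"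
  shows "finite {G. monic G \<and> degree G = d \<and> reduced (int N) G}" (is "finite ?S")
    and "card {G. monic G \<and> degree G = d \<and> reduced (int N) G} \<le> N ^ d"
proof -
  define T where "T = PiE {..<d} (\<lambda>_. {0..<int N})"
  define \<phi> where "\<phi> = (\<lambda>G::int poly. restrict (coeff G) {..<d})"
  have T: "finite T" "card T = N ^ d" by (auto simp: T_def card_PiE intro!: finite_PiE)
  have inj: "inj_on \<phi> ?S"
  proof (rule inj_onI)
    fix G H assume GH: "G \<in> ?S" "H \<in> ?S" "\<phi> G = \<phi> H"
    show "G = H"
    proof (rule poly_eqI)
      fix i
      consider "i < d" | "i = d" | "i > d" by linarith
      thus "coeff G i = coeff H i"
      proof cases
        case 1
        thus ?thesis using fun_cong[OF GH(3), of i] by (simp add: \<phi>_def)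
      qed (use GH in \<open>auto simp: monic_def coeff_eq_0\<close>)
    qed
  qed
  have sub: "\<phi> ` ?S \<subseteq> T" by (auto simp: \<phi>_def T_def reduced_def split: if_splits)
  show "finite ?S" using inj_on_finite[OF inj sub T(1)] .
  show "card ?S \<le> N ^ d" using card_inj_on_le[OF inj sub T(1)] T(2) by simp
qed

text \<open>Writing \<open>f = a G\<close> modulo \<open>N\<close> with \<open>G\<close> monic, the
  cofactor of \<open>G^2\<close> is \<open>a^2 g\<close>; an integral square factor is thus replaced
  by one of finitely many residues.\<close>

lemma square_factor_mod:
  assumes N: "N > 1" and cop: "coprime (lead_coeff f) N" "coprime (coeff f 0) N"
  obtains G where "monic G" "degree G = degree f" "reduced N G" "coprime (coeff G 0) N" "mdvd N G f"
    "\<And>g. mdvd N (G * G) (f * f * g)"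
proof -
  obtain G a a' where G: "monic G" "degree G = degree f" "\<And>i. coeff G i \<in> {0..<N}"
    "[:N:] dvd f - smult a G" "coprime a N"
    by (rule monic_normalize[OF N cop(1)]) blast
  have "coprime (coeff G 0) N"
  proof -
    have "N dvd coeff f 0 - a * coeff G 0" using G(4) by (metis const_poly_dvd_iff coeff_diff coeff_smult)
    hence "coeff f 0 mod N = (a * coeff G 0) mod N" by (simp add: mod_eq_dvd_iff)
    hence "coprime (a * coeff G 0) N"
      using cop(2) N coprime_mod_left_iff[of N "coeff f 0"] coprime_mod_left_iff[of N "a * coeff G 0"]
      by simp
    thus ?thesis by simp
  qed
  moreover have "mdvd N G f" using G(4) by (intro mdvdI[of _ _ _ "[:a:]"]) simp
  moreover have "mdvd N (G * G) (f * f * g)" for g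
  proof (rule mdvdI[of _ _ _ "smult (a * a) g"])
    define b where "b = [:a:]"
    have "smult a p = b * p" "smult (a * a) p = b * (b * p)" for p by (simp_all add: b_def)
    hence "f * f * g - G * G * smult (a * a) g = (f - smult a G) * ((f + smult a G) * g)"
      by (simp add: algebra_simps)
    thus "[:N:] dvd f * f * g - G * G * smult (a * a) g" using G(4) by (simp only: dvd_mult2)
  qed
  ultimately show ?thesis using that[of G] G by (auto simp: reduced_def)
qed

text \<open>The coefficient \<open>a j\<close> enters the derivative as \<open>j * a j\<close>,
  which vanishes modulo \<open>l\<close> when \<open>l\<close> divides \<open>j\<close>.\<close>

lemma ipoly_pderiv_mod:
  assumes "\<And>j. j \<le> n \<Longrightarrow> \<not> l dvd j \<Longrightarrow> a j = b j"
  shows "[:int l:] dvd pderiv (ipoly n a) - pderiv (ipoly n b)"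
  unfolding const_poly_dvd_iff
proof
  fix i
  show "int l dvd coeff (pderiv (ipoly n a) - pderiv (ipoly n b)) i"
  proof (cases "Suc i \<le> n \<and> l dvd Suc i")
    case True
    hence "int l dvd int (Suc i)" using int_dvd_int_iff by blast
    hence "int l dvd int (Suc i) * (a (Suc i) - b (Suc i))" by (rule dvd_mult2)
    thus ?thesis using True by (simp add: coeff_pderiv coeff_ipoly algebra_simps)
  next
    case False
    thus ?thesis using assms[of "Suc i"] by (auto simp: coeff_pderiv coeff_ipoly)
  qed
qed

lemma pcompose_monom: "pcompose (monom (c::int) i) q = smult c (q ^ i)"
  by (induction i) (simp_all add: monom_0 monom_Suc pcompose_pCons)

lemma ipoly_diff_sparse:
  assumes ab: "\<And>j. j \<notin> (\<lambda>i. l * i) ` {..<k} \<Longrightarrow> a j = b j" and l: "l > 0" and le: "\<And>i. i < k \<Longrightarrow> l * i \<le> n"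
  shows "ipoly n a - ipoly n b = (\<Sum>i<k. monom (a (l * i) - b (l * i)) (l * i))"
proof -
  have "ipoly n a - ipoly n b = (\<Sum>j\<le>n. monom (a j - b j) j)"
    by (simp add: ipoly_def diff_monom flip: sum_subtractf)
  also have "\<dots> = (\<Sum>j\<in>(\<lambda>i. l * i) ` {..<k}. monom (a j - b j) j)"
    by (rule sum.mono_neutral_right) (use ab le in auto)
  also have "\<dots> = (\<Sum>i<k. monom (a (l * i) - b (l * i)) (l * i))"
    using l by (subst sum.reindex) (auto simp: inj_on_def)
  finally show ?thesis .
qed

lemma sparse_eq_pcompose: "(\<Sum>i<k. monom (q i :: int) (l * i)) = pcompose (\<Sum>i<k. monom (q i) i) (monom 1 l)"
  by (simp add: pcompose_sum pcompose_monom monom_power smult_monom)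

text \<open>\<open>c\<close> and \<open>\<Delta>\<close> are supplied by
  \<open>char_abs_bound\<close>. As \<open>l > 2 m\<close>, a coefficient, a difference of two
  coefficients or \<open>\<Delta>\<close> is divisible by \<open>l\<close> only if it is
  zero.\<close>

locale bounded_law_prime = bounded_law +
  fixes c :: real and \<Delta> l :: nat
  assumes char_le: "char_abs \<theta> \<le> exp (- c * (dist_int (real \<Delta> * \<theta>))\<^sup>2)"
    and c_pos: "c > 0" and \<Delta>: "\<Delta> \<ge> 1" "int \<Delta> \<le> 2 * m"
    and l: "prime l" "2 * m < int l"
begin

lemma prime_int_l: "prime (int l)"
  using l by simp

lemma l_gt_1: "l > 1" and int_l_gt_1: "int l > 1"
  using prime_gt_1_nat[OF l(1)] by auto

lemma coprime_\<Delta>_power: "coprime \<Delta> (l ^ s)"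
proof -
  have "\<not> l dvd \<Delta>" using \<Delta> l by (auto dest!: dvd_imp_le)
  thus ?thesis using l(1) by (metis coprime_commute coprime_power_right_iff prime_imp_coprime)
qed

abbreviation unit_ends :: "int poly \<Rightarrow> bool" where
  "unit_ends f \<equiv> \<not> int l dvd lead_coeff f \<and> \<not> int l dvd coeff f 0"

abbreviation square_divisor :: "nat \<Rightarrow> nat \<Rightarrow> nat \<Rightarrow> (nat \<Rightarrow> int) \<Rightarrow> bool" where
  "square_divisor N d n a \<equiv> \<exists>G. monic G \<and> degree G = d \<and> reduced (int N) G \<and> coprime (coeff G 0) (int N)
      \<and> mdvd (int N) (G * G) (ipoly n a)"

text \<open>The derivative is kept nonzero modulo \<open>l\<close>, since otherwise every
  \<open>G\<close> divides it and the candidates cannot be counted; that case is left to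
  \<open>prb_pderiv_zero_mod_le\<close>.\<close>

abbreviation irred_divisor :: "nat \<Rightarrow> nat \<Rightarrow> (nat \<Rightarrow> int) \<Rightarrow> bool" where
  "irred_divisor k n a \<equiv> \<exists>G. irred_mod (int l) G \<and> reduced (int l) G \<and> k \<le> degree G \<and> mdvd (int l) G (ipoly n a)
      \<and> mdvd (int l) G (pderiv (ipoly n a)) \<and> \<not> [:int l:] dvd pderiv (ipoly n a)"

text \<open>\<open>prb_dvd_mod_le\<close> for the divisor \<open>G * G\<close> of degree
  \<open>2 d\<close>: the equidistributed value plus the Fourier error.\<close>

definition sq_bound :: "nat \<Rightarrow> nat \<Rightarrow> nat \<Rightarrow> real" where
  "sq_bound N n d = 1 / real N ^ (2 * d) + exp (- (c * real ((n + 1) div (2 * d)) / real N ^ 2))"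

lemma prb_mdvd_square_le:
  assumes G: "monic G" "degree G > 0" "coprime (coeff G 0) (int N)" and N: "N > 0" "coprime \<Delta> N"
  shows "prb n (\<lambda>a. mdvd (int N) (G * G) (ipoly n a)) \<le> sq_bound N n (degree G)"
proof -
  have deg: "degree (G * G) = 2 * degree G" using degree_mult_monic[OF G(1,1)] by simp
  have "prb n (\<lambda>a. \<exists>Q. [:int N:] dvd ipoly n a - (G * G) * Q) \<le> 1 / real N ^ degree (G * G)
     + exp (- (c * real ((n + 1) div degree (G * G)) / real N ^ 2))"
  proof (rule prb_dvd_mod_le[OF char_le c_pos])
    show "lead_coeff (G * G) = 1" using monic_mult[OF G(1,1)] by (simp add: monic_def)
    show "degree (G * G) > 0" using deg G by simp
    show "coprime (coeff (G * G) 0) (int N)" using G(3) by (simp add: coeff_mult_0)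
  qed (use N in auto)
  thus ?thesis by (simp only: mdvd_def sq_bound_def deg)
qed

lemma prb_fixed_square_le:
  assumes f: "degree f > 0" "coprime (lead_coeff f) (int N)" "coprime (coeff f 0) (int N)"
    and N: "N > 1" "coprime \<Delta> N"
  shows "prb n (\<lambda>a. \<exists>g. ipoly n a = f * f * g) \<le> sq_bound N n (degree f)"
proof -
  obtain G where G: "monic G" "degree G = degree f" "coprime (coeff G 0) (int N)"
    "\<And>g. mdvd (int N) (G * G) (f * f * g)"
    using square_factor_mod[of "int N" f] f N by (metis of_nat_1 of_nat_less_iff)
  have "prb n (\<lambda>a. \<exists>g. ipoly n a = f * f * g) \<le> prb n (\<lambda>a. mdvd (int N) (G * G) (ipoly n a))"
    using G(4) by (intro prb_mono) auto
  also have "\<dots> \<le> sq_bound N n (degree G)" using G f N by (intro prb_mdvd_square_le) auto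
  finally show ?thesis using G(2) by simp
qed

text \<open>There are at most \<open>N^d\<close> monic residues of degree \<open>d\<close>, so the
  union bound leaves a main term \<open>N^(-d)\<close>.\<close>

lemma prb_UN_monic_square_le:
  assumes d: "d > 0" and N: "N > 1" "coprime \<Delta> N"
  shows "prb n (\<lambda>a. square_divisor N d n a) \<le> real N ^ d * sq_bound N n d"
proof -
  define S where "S = {G. monic G \<and> degree G = d \<and> reduced (int N) G}"
  define S' where "S' = {G \<in> S. coprime (coeff G 0) (int N)}"
  have S: "finite S" "card S \<le> N ^ d" using monic_reduced_finite[of N d] N by (auto simp: S_def)
  have S': "finite S'" "card S' \<le> card S" using S(1) by (auto simp: S'_def intro: card_mono)
  have sq0: "0 \<le> sq_bound N n d" by (simp add: sq_bound_def)
  have "prb n (\<lambda>a. square_divisor N d n a) \<le> prb n (\<lambda>a. \<exists>G\<in>S'. mdvd (int N) (G * G) (ipoly n a))"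
    by (rule prb_mono) (auto simp: S'_def S_def)
  also have "\<dots> \<le> real (card S') * sq_bound N n d"
    using S'(1)
  proof (rule prb_UN_le)
    fix G assume "G \<in> S'"
    thus "prb n (\<lambda>a. mdvd (int N) (G * G) (ipoly n a)) \<le> sq_bound N n d"
      using prb_mdvd_square_le[of G N n] d N by (auto simp: S'_def S_def)
  qed
  also have "real (card S') \<le> real (N ^ d)" using S S' by linarith
  finally show ?thesis using sq0 by (simp add: mult_right_mono)
qed

lemma prb_square_degree_le:
  assumes d: "d > 0" and N: "N > 1" "coprime \<Delta> N"
  shows "prb n (\<lambda>a. \<exists>f g. ipoly n a = f * f * g \<and> degree f = d \<and> coprime (lead_coeff f) (int N)
      \<and> coprime (coeff f 0) (int N)) \<le> real N ^ d * sq_bound N n d"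
proof (rule order.trans[OF prb_mono prb_UN_monic_square_le[OF assms]])
  fix a assume "\<exists>f g. ipoly n a = f * f * g \<and> degree f = d \<and> coprime (lead_coeff f) (int N)
      \<and> coprime (coeff f 0) (int N)"
  then obtain f g where f: "ipoly n a = f * f * g" "degree f = d" "coprime (lead_coeff f) (int N)"
      "coprime (coeff f 0) (int N)" by blast
  obtain G where "monic G" "degree G = degree f" "reduced (int N) G" "coprime (coeff G 0) (int N)"
    "mdvd (int N) G f" "\<And>g. mdvd (int N) (G * G) (f * f * g)"
    using square_factor_mod[of "int N" f] f N by (metis of_nat_1 of_nat_less_iff)
  thus "square_divisor N d n a" using f by metis
qed

text \<open>Coefficients at multiples of \<open>l\<close> do not enter \<open>P'\<close> modulo \<open>l\<close>. So \<open>P'\<close> leaves at most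
  \<open>n\<close> candidates for \<open>G\<close>, and by Frobenius each candidate determines \<open>k\<close> of those coefficients.\<close>

lemma prb_irred_double_le:
  assumes k: "l * k \<le> n"
  shows "prb n (\<lambda>a. irred_divisor k n a) \<le> real n * (1/2) ^ k"
    (is "prb n ?E \<le> _")
proof -
  define J where "J = (\<lambda>i. l * i) ` {..<k}"
  have l0: "l > 0" using l_gt_1 by simp
  have le: "l * i \<le> n" if "i < k" for i
    using that k mult_le_mono2[of i k l] by linarith
  have cardJ: "card J = k" unfolding J_def using l0 by (subst card_image) (auto simp: inj_on_def)
  \<comment> \<open>The difference of two multiples of \<open>G\<close> that agree off
    \<open>J\<close> is \<open>R(x^l)\<close>, congruent to \<open>R^l\<close>; so \<open>G\<close>
    divides \<open>R\<close>, whose degree is below \<open>k \<le> degree G\<close>. Hence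
    \<open>R\<close> is 0 modulo \<open>l\<close>, and truly 0 because
    \<open>2 m < l\<close>.\<close>
  have same: "a = b" if a: "a \<in> box n" and b: "b \<in> box n" and ab: "\<And>j. j \<notin> J \<Longrightarrow> a j = b j"
    and G: "irred_mod (int l) G" "k \<le> degree G" "mdvd (int l) G (ipoly n a)" "mdvd (int l) G (ipoly n b)" for a b G
  proof -
    define R where "R = (\<Sum>i<k. monom (a (l * i) - b (l * i)) i)"
    have cR: "coeff R i = (if i < k then a (l * i) - b (l * i) else 0)" for i
    proof -
      have "coeff R i = (\<Sum>j<k. if j = i then a (l * j) - b (l * j) else 0)" by (simp add: R_def coeff_sum)
      thus ?thesis by (simp add: sum.delta')
    qed
    have diff: "ipoly n a - ipoly n b = pcompose R (monom 1 l)"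
      unfolding R_def sparse_eq_pcompose[symmetric]
      by (rule ipoly_diff_sparse[OF _ l0 le]) (use ab in \<open>auto simp: J_def\<close>)
    have "mdvd (int l) G (pcompose R (monom 1 l))" unfolding diff[symmetric] by (rule mdvd_diff[OF G(3,4)])
    hence "mdvd (int l) G (R ^ l)" by (rule mdvd_cong_right[OF frobenius_int_poly[OF l(1)]])
    hence GR: "mdvd (int l) G R" by (rule irred_mod_power[OF prime_int_l G(1)])
    have "[:int l:] dvd R"
    proof (cases "k = 0")
      case True
      thus ?thesis by (simp add: R_def)
    next
      case False
      hence "degree R < k" by (intro degree_lessI) (auto simp: cR)
      thus ?thesis using low_degree_multiple_of_monic[OF _ _ int_l_gt_1 GR] G by (auto simp: irred_mod_def)
    qed
    hence dv: "int l dvd a (l * i) - b (l * i)" if "i < k" for i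
      using that cR[of i] unfolding const_poly_dvd_iff by metis
    show "a = b"
    proof
      fix j
      show "a j = b j"
      proof (cases "j \<in> J")
        case True
        then obtain i where i: "i < k" "j = l * i" by (auto simp: J_def)
        have "\<bar>a j\<bar> \<le> m" "\<bar>b j\<bar> \<le> m" using i le a b box_abs_le by auto
        hence "\<bar>a j - b j\<bar> < int l" using l(2) by linarith
        thus ?thesis using dv[OF i(1)] i(2) by (metis dvd_imp_le_int not_le right_minus_eq abs_of_nat)
      qed (rule ab)
    qed
  qed
  have "prb n ?E \<le> real n * (1/2) ^ card J"
  proof (rule prb_fiber)
    show "J \<subseteq> {..n}" using le by (auto simp: J_def)
    fix b
    define A where "A = {a \<in> box n. ?E a \<and> restrict a ({..n} - J) = b}"
    have agree: "a j = a' j" if "a \<in> A" "a' \<in> A" "j \<notin> J" for a a' j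
    proof -
      have "restrict a ({..n} - J) j = restrict a' ({..n} - J) j" using that by (simp add: A_def)
      thus ?thesis using that
        by (cases "j \<le> n") (auto simp: A_def box_def PiE_def extensional_def)
    qed
    show "card {a \<in> box n. ?E a \<and> restrict a ({..n} - J) = b} \<le> n"
    proof (cases "A = {}")
      case True
      hence "card A \<le> n" by simp
      thus ?thesis by (simp only: A_def)
    next
      case False
      then obtain a0 where a0: "a0 \<in> A" by blast
      \<comment> \<open>The derivative modulo \<open>l\<close> is constant on the fibre, so one
        member fixes the list of possible \<open>G\<close>; \<open>g\<close> below assigns each
        member its divisor, injectively by \<open>same\<close>.\<close>
      define W where "W = pderiv (ipoly n a0)"
      have W0: "\<not> [:int l:] dvd W" using a0 by (auto simp: A_def W_def)
      define S where "S = {G. irred_mod (int l) G \<and> reduced (int l) G \<and> mdvd (int l) G W}"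
      have S: "finite S" "card S \<le> degree W"
        using card_irred_mod_divisors_le[OF prime_int_l W0, of S] by (auto simp: S_def)
      have degW: "degree W \<le> n"
        using degree_ipoly_le[of n a0] by (simp add: W_def degree_pderiv)
      have "\<exists>G\<in>S. k \<le> degree G \<and> mdvd (int l) G (ipoly n a)" if a: "a \<in> A" for a
      proof -
        obtain G where G: "irred_mod (int l) G" "reduced (int l) G" "k \<le> degree G"
          "mdvd (int l) G (ipoly n a)" "mdvd (int l) G (pderiv (ipoly n a))"
          using a by (auto simp: A_def)
        have "[:int l:] dvd W - pderiv (ipoly n a)" unfolding W_def
        proof (rule ipoly_pderiv_mod)
          fix j assume "\<not> l dvd j"
          hence "j \<notin> J" by (auto simp: J_def)
          thus "a0 j = a j" using agree a0 a by blast
        qed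
        from mdvd_cong_right[OF this G(5)] G show ?thesis by (auto simp: S_def)
      qed
      then obtain g where g: "\<And>a. a \<in> A \<Longrightarrow> g a \<in> S \<and> k \<le> degree (g a) \<and> mdvd (int l) (g a) (ipoly n a)"
        by metis
      have "inj_on g A"
      proof (rule inj_onI)
        fix a a' assume aa: "a \<in> A" "a' \<in> A" "g a = g a'"
        show "a = a'"
          by (rule same[of a a' "g a"]) (use aa g[of a] g[of a'] agree[of a a'] in \<open>auto simp: A_def S_def\<close>)
      qed
      hence "card A \<le> card S" using g S(1) by (intro card_inj_on_le[of g]) auto
      thus ?thesis using S(2) degW by (simp add: A_def)
    qed
  qed
  thus ?thesis by (simp add: cardJ)
qed

text \<open>At positions \<open>j\<close> congruent to 1 modulo \<open>l\<close> the factor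
  \<open>j\<close> is a unit, so \<open>a j\<close> is 0 modulo \<open>l\<close>, hence 0;
  \<open>k\<close> such positions are used.\<close>

lemma prb_pderiv_zero_mod_le:
  assumes k: "l * k + 1 \<le> n"
  shows "prb n (\<lambda>a. [:int l:] dvd pderiv (ipoly n a)) \<le> (1/2) ^ k"
proof -
  define J where "J = (\<lambda>i. l * i + 1) ` {..<k}"
  have l0: "l > 0" using l_gt_1 by simp
  have le: "l * i + 1 \<le> n" if "i < k" for i
    using that k mult_le_mono2[of i k l] by linarith
  have cardJ: "card J = k" unfolding J_def using l0 by (subst card_image) (auto simp: inj_on_def)
  have zero: "a j = 0" if a: "a \<in> box n" "[:int l:] dvd pderiv (ipoly n a)" and j: "j \<in> J" for a j
  proof -
    obtain i where i: "i < k" "j = l * i + 1" using j by (auto simp: J_def)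
    have jn: "j \<le> n" using le[OF i(1)] i(2) by simp
    have "int l dvd coeff (pderiv (ipoly n a)) (l * i)" using a(2) by (simp add: const_poly_dvd_iff)
    hence "int l dvd int j * a j" using i(2) jn by (simp add: coeff_pderiv coeff_ipoly)
    moreover have "\<not> int l dvd int j"
    proof
      assume "int l dvd int j"
      hence "l dvd l * i + 1" using i(2) int_dvd_int_iff by blast
      hence "l dvd 1" using dvd_add_right_iff[of l "l * i" 1] by simp
      thus False using l_gt_1 by simp
    qed
    ultimately have "int l dvd a j" using prime_int_l prime_dvd_mult_iff by blast
    moreover have "\<bar>a j\<bar> < int l" using box_abs_le[OF a(1) jn] l(2) by linarith
    ultimately show ?thesis by (metis dvd_imp_le_int not_le abs_of_nat)
  qed
  have "prb n (\<lambda>a. [:int l:] dvd pderiv (ipoly n a)) \<le> (1/2) ^ card J"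
  proof (rule prb_fiber_inj)
    show "J \<subseteq> {..n}" using le by (auto simp: J_def)
    fix a b assume "a \<in> box n" "b \<in> box n" "[:int l:] dvd pderiv (ipoly n a)" "[:int l:] dvd pderiv (ipoly n b)"
      "\<And>j. j \<notin> J \<Longrightarrow> a j = b j"
    thus "a = b" using zero by (intro ext) metis
  qed
  thus ?thesis by (simp add: cardJ)
qed

text \<open>Take \<open>G\<close> from \<open>moderate_monic_divisor\<close>. If
  \<open>degree G < 2 k\<close>, its square divides \<open>P\<close> modulo \<open>l\<close>;
  otherwise \<open>G\<close> is irreducible and divides both \<open>P\<close> and \<open>P'\<close>.
  The case that \<open>P'\<close> vanishes modulo \<open>l\<close> is counted separately.\<close>

lemma prb_high_degree_square_le:
  assumes k: "1 \<le> k" "l * k + 1 \<le> n"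
  shows "prb n (\<lambda>a. \<exists>f g. ipoly n a = f * f * g \<and> k \<le> degree f \<and> unit_ends f)
    \<le> (\<Sum>d=k..<2*k. real l ^ d * sq_bound l n d) + (real n + 1) * (1/2) ^ k"
proof -
  define E1 where "E1 = (\<lambda>d. square_divisor l d n)"
  define E2 where "E2 = (\<lambda>a. irred_divisor k n a)"
  define E3 where "E3 = (\<lambda>a. [:int l:] dvd pderiv (ipoly n a))"
  have "prb n (\<lambda>a. \<exists>f g. ipoly n a = f * f * g \<and> k \<le> degree f \<and> unit_ends f)
     \<le> prb n (\<lambda>a. (\<exists>d\<in>{k..<2*k}. E1 d a) \<or> (E2 a \<or> E3 a))"
  proof (rule prb_mono)
    fix a assume "\<exists>f g. ipoly n a = f * f * g \<and> k \<le> degree f \<and> unit_ends f"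
    then obtain f g where f: "ipoly n a = f * f * g" "k \<le> degree f" "\<not> int l dvd lead_coeff f" "\<not> int l dvd coeff f 0"
      by blast
    obtain G where G: "monic G" "reduced (int l) G" "k \<le> degree G" "mdvd (int l) G f"
      "degree G < 2 * k \<or> irred_mod (int l) G"
      by (rule moderate_monic_divisor[OF prime_int_l f(3) k(1) f(2)]) blast
    obtain Q where Q: "[:int l:] dvd f - G * Q" using G(4) by (auto simp: mdvd_def)
    show "(\<exists>d\<in>{k..<2*k}. E1 d a) \<or> (E2 a \<or> E3 a)"
    proof (cases "degree G < 2 * k")
      case True
      \<comment> \<open>\<open>coeff G 0\<close> divides \<open>coeff f 0\<close> modulo
        \<open>l\<close>, so it is a unit as well.\<close>
      have "int l dvd coeff f 0 - coeff G 0 * coeff Q 0"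
        using Q by (metis const_poly_dvd_iff coeff_diff coeff_mult_0)
      hence "int l dvd coeff f 0" if "int l dvd coeff G 0"
        using dvd_add[OF \<open>int l dvd coeff f 0 - coeff G 0 * coeff Q 0\<close> dvd_mult2[OF that, of "coeff Q 0"]] by simp
      hence "\<not> int l dvd coeff G 0" using f(4) by blast
      hence "coprime (coeff G 0) (int l)" using prime_int_l by (metis prime_imp_coprime coprime_commute)
      moreover have "mdvd (int l) (G * G) (ipoly n a)"
      proof (rule mdvdI[of _ _ _ "Q * Q * g"])
        have "ipoly n a - G * G * (Q * Q * g) = (f - G * Q) * ((f + G * Q) * g)"
          unfolding f(1) by (simp add: algebra_simps)
        thus "[:int l:] dvd ipoly n a - G * G * (Q * Q * g)" using Q by (simp only: dvd_mult2)
      qed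
      ultimately have "E1 (degree G) a" using G by (auto simp: E1_def)
      thus ?thesis using G(3) True by auto
    next
      case False
      have "mdvd (int l) G (ipoly n a)" unfolding f(1) by (intro mdvd_mult_right G(4))
      moreover have "mdvd (int l) G (pderiv (ipoly n a))"
        unfolding f(1) pderiv_mult by (intro mdvd_add mdvd_mult_right mdvd_mult_left G(4))
      ultimately show ?thesis using False G by (auto simp: E2_def E3_def)
    qed
  qed
  also have "\<dots> \<le> prb n (\<lambda>a. \<exists>d\<in>{k..<2*k}. E1 d a) + (prb n E2 + prb n E3)"
    by (intro order.trans[OF prb_disj] add_mono order.refl)
  also have "prb n (\<lambda>a. \<exists>d\<in>{k..<2*k}. E1 d a) \<le> (\<Sum>d=k..<2*k. prb n (E1 d))" by (rule prb_UN) simp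
  also have "\<dots> \<le> (\<Sum>d=k..<2*k. real l ^ d * sq_bound l n d)" unfolding E1_def
    using k l_gt_1 coprime_\<Delta>_power[of 1] by (intro sum_mono prb_UN_monic_square_le) auto
  also have "prb n E2 \<le> real n * (1/2) ^ k" unfolding E2_def using k by (intro prb_irred_double_le) simp
  also have "prb n E3 \<le> (1/2) ^ k" unfolding E3_def by (rule prb_pderiv_zero_mod_le[OF k(2)])
  finally show ?thesis by (simp add: algebra_simps)
qed

end

section \<open>Minimal polynomials of double roots\<close>

definition evi :: "int poly \<Rightarrow> complex \<Rightarrow> complex" where
  "evi F \<alpha> = poly (map_poly of_int F) \<alpha>"

lemma evi_0 [simp]: "evi 0 \<alpha> = 0"
  by (simp add: evi_def)

lemma evi_pCons [simp]: "evi (pCons x F) \<alpha> = of_int x + \<alpha> * evi F \<alpha>"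
  by (simp add: evi_def map_poly_pCons)

lemma evi_add: "evi (F + G) \<alpha> = evi F \<alpha> + evi G \<alpha>"
  by (induction F G rule: poly_induct2) (simp_all add: algebra_simps)

lemma evi_smult: "evi (smult x F) \<alpha> = of_int x * evi F \<alpha>"
  by (induction F) (simp_all add: algebra_simps)

lemma evi_mult: "evi (F * G) \<alpha> = evi F \<alpha> * evi G \<alpha>"
  by (induction F) (simp_all add: evi_add evi_smult algebra_simps mult_pCons_left)

lemma evi_sum: "evi (\<Sum>i\<in>S. F i) \<alpha> = (\<Sum>i\<in>S. evi (F i) \<alpha>)"
  by (induction S rule: infinite_finite_induct) (simp_all add: evi_add)

lemma evi_monom: "evi (monom x i) \<alpha> = of_int x * \<alpha> ^ i"
  by (induction i) (simp_all add: monom_0 monom_Suc)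

text \<open>Take the primitive part of an annihilating polynomial of least degree: pseudo-division
  gives divisibility up to an integer factor, which Gauss's lemma on contents removes.\<close>

lemma minimal_int_poly:
  assumes P: "P \<noteq> 0" "evi P \<alpha> = 0"
  obtains f where "content f = 1" "degree f > 0" "evi f \<alpha> = 0" "\<And>g. evi g \<alpha> = 0 \<Longrightarrow> f dvd g"
proof -
  define R where "R = (\<lambda>F. F \<noteq> 0 \<and> evi F \<alpha> = 0)"
  define f0 where "f0 = arg_min degree R"
  have f0: "R f0" and min: "\<And>F. R F \<Longrightarrow> degree f0 \<le> degree F"
    using arg_min_nat_lemma[of R P degree] P by (auto simp: R_def f0_def)
  define f where "f = primitive_part f0"
  have f00: "f0 \<noteq> 0" using f0 by (simp add: R_def)
  have content: "content f = 1" using f00 by (simp add: f_def)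
  have "evi f0 \<alpha> = of_int (content f0) * evi f \<alpha>"
    by (subst content_times_primitive_part[of f0, symmetric]) (simp only: evi_smult f_def)
  hence ev: "evi f \<alpha> = 0" using f0 f00 by (simp add: R_def)
  have fn0: "f \<noteq> 0" using f00 by (simp add: f_def)
  have deg: "degree f = degree f0" by (simp add: f_def)
  have dvd: "f dvd g" if g: "evi g \<alpha> = 0" for g
  proof -
    obtain x q where xq: "x \<noteq> 0" "smult x g = f * q + pseudo_mod g f"
      using pseudo_mod(1)[OF fn0, of g] by blast
    have "evi (pseudo_mod g f) \<alpha> = 0"
      using arg_cong[OF xq(2), of "\<lambda>F. evi F \<alpha>"] by (simp add: evi_add evi_smult evi_mult ev g)
    have "pseudo_mod g f = 0"
    proof (rule ccontr)
      assume "pseudo_mod g f \<noteq> 0"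
      moreover from this have "degree f0 \<le> degree (pseudo_mod g f)"
        using \<open>evi (pseudo_mod g f) \<alpha> = 0\<close> by (intro min) (simp add: R_def)
      ultimately show False using pseudo_mod(2)[OF fn0, of g] deg by simp
    qed
    hence eq: "smult x g = f * q" using xq(2) by simp
    have "content (smult x g) = content q" unfolding eq content_mult by (simp add: content)
    hence "x dvd content q" by (simp flip: \<open>content (smult x g) = content q\<close>)
    then obtain q' where "q = [:x:] * q'" by (auto simp: const_poly_dvd_iff_dvd_content[symmetric] elim: dvdE)
    hence "q = smult x q'" by simp
    hence "smult x g = smult x (f * q')" using eq by simp
    hence "g = f * q'" using xq(1) by (simp only: poly_eq_iff coeff_smult mult_cancel_left) simp
    thus ?thesis by simp
  qed
  have "degree f > 0"
  proof (rule ccontr)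
    assume "\<not> degree f > 0"
    then obtain x where "f = [:x:]" by (auto elim: degree_eq_zeroE)
    thus False using ev fn0 by simp
  qed
  thus ?thesis using that content ev dvd by blast
qed

text \<open>The root is simple for \<open>f\<close>, because \<open>f\<close> does not divide its
  derivative, which has smaller degree. With \<open>P = f h\<close>, the condition on
  \<open>P'\<close> thus forces \<open>h\<close> to vanish at the root.\<close>

lemma double_root_imp_square_dvd:
  assumes f: "degree f > 0" "evi f \<alpha> = 0" "\<And>g. evi g \<alpha> = 0 \<Longrightarrow> f dvd g"
    and P: "evi P \<alpha> = 0" "evi (pderiv P) \<alpha> = 0"
  obtains g where "P = f * f * g"
proof -
  obtain h where h: "P = f * h" using f(3)[OF P(1)] by (auto elim: dvdE)
  have "evi (pderiv f) \<alpha> \<noteq> 0"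
  proof
    assume "evi (pderiv f) \<alpha> = 0"
    hence "f dvd pderiv f" by (rule f(3))
    thus False using f(1) by simp
  qed
  hence "evi h \<alpha> = 0" using P(2) f(2) by (simp add: h pderiv_mult evi_add evi_mult)
  then obtain g where "h = f * g" using f(3) by (auto elim: dvdE)
  thus ?thesis using that[of g] h by (simp add: mult.assoc)
qed

section \<open>Root bounds and finiteness of divisors of bounded degree\<close>

lemma dominated_sum_zero:
  fixes y :: complex and q :: "nat \<Rightarrow> int"
  assumes y: "cmod y > of_int B + 1" and B: "B \<ge> 0"
  shows "(\<And>j. j \<le> J \<Longrightarrow> \<bar>q j\<bar> \<le> B) \<Longrightarrow> (\<Sum>j\<le>J. of_int (q j) * y ^ j) = 0 \<Longrightarrow> \<forall>j\<le>J. q j = 0"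
proof (induction J)
  case 0
  thus ?case by simp
next
  case (Suc J)
  define s where "s = cmod y"
  have s: "s > 1" "of_int B \<le> s - 1" using y B by (auto simp: s_def)
  \<comment> \<open>A nonzero top term has modulus at least \<open>s ^ Suc J\<close>, while the
    others sum to at most \<open>(s - 1) (1 + s + ... + s^J) = s ^ Suc J - 1\<close>.\<close>
  have "q (Suc J) = 0"
  proof (rule ccontr)
    assume "q (Suc J) \<noteq> 0"
    hence "1 \<le> \<bar>real_of_int (q (Suc J))\<bar>" by linarith
    hence "1 * s ^ Suc J \<le> \<bar>real_of_int (q (Suc J))\<bar> * s ^ Suc J" using s by (intro mult_right_mono) auto
    also have "\<dots> = cmod (of_int (q (Suc J)) * y ^ Suc J)" by (simp add: s_def norm_mult norm_power)
    also have "of_int (q (Suc J)) * y ^ Suc J = - (\<Sum>j\<le>J. of_int (q j) * y ^ j)"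
      using Suc.prems(2) by (simp add: eq_neg_iff_add_eq_0 add.commute)
    also have "cmod \<dots> \<le> (\<Sum>j\<le>J. cmod (of_int (q j) * y ^ j))" by (simp add: norm_sum)
    also have "\<dots> \<le> (\<Sum>j\<le>J. (s - 1) * s ^ j)"
    proof (rule sum_mono)
      fix j assume "j \<in> {..J}"
      hence "\<bar>q j\<bar> \<le> B" using Suc.prems(1)[of j] by simp
      hence "\<bar>real_of_int (q j)\<bar> \<le> s - 1" using s(2) by linarith
      thus "cmod (of_int (q j) * y ^ j) \<le> (s - 1) * s ^ j"
        using s by (simp add: norm_mult norm_power s_def mult_right_mono)
    qed
    also have "\<dots> = (s - 1) * (\<Sum>j<Suc J. s ^ j)" by (simp add: sum_distrib_left lessThan_Suc_atMost)
    also have "\<dots> = s ^ Suc J - 1" by (rule power_diff_1_eq[symmetric])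
    finally show False by simp
  qed
  moreover have "\<forall>j\<le>J. q j = 0"
    by (rule Suc.IH) (use Suc.prems \<open>q (Suc J) = 0\<close> in auto)
  ultimately show ?case by (simp add: le_Suc_eq)
qed

text \<open>Reverse the order of the coefficients and apply the previous bound to
  \<open>1 / y\<close>.\<close>

lemma dominated_sum_zero':
  fixes y :: complex and q :: "nat \<Rightarrow> int"
  assumes y: "y \<noteq> 0" "cmod y * (of_int B + 1) < 1" and B: "B \<ge> 0"
    and q: "\<And>j. j \<le> J \<Longrightarrow> \<bar>q j\<bar> \<le> B" "(\<Sum>j\<le>J. of_int (q j) * y ^ j) = 0" and j: "j \<le> J"
  shows "q j = 0"
proof -
  have "(\<Sum>i\<le>J. of_int (q (J - i)) * (1 / y) ^ i) = (\<Sum>i\<le>J. of_int (q i) * (1 / y) ^ (J - i))"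
    by (rule sum.reindex_bij_witness[of _ "\<lambda>i. J - i" "\<lambda>i. J - i"]) auto
  also have "\<dots> = (\<Sum>i\<le>J. (1 / y) ^ J * (of_int (q i) * y ^ i))"
  proof (rule sum.cong[OF refl])
    fix i assume "i \<in> {..J}"
    hence "y ^ J = y ^ i * y ^ (J - i)" by (simp flip: power_add)
    thus "of_int (q i) * (1 / y) ^ (J - i) = (1 / y) ^ J * (of_int (q i) * y ^ i)"
      using y(1) by (simp add: field_simps)
  qed
  also have "\<dots> = 0" by (simp only: sum_distrib_left[symmetric] q(2)) simp
  finally have sum0: "(\<Sum>i\<le>J. of_int (q (J - i)) * (1 / y) ^ i) = 0" .
  have "cmod (1 / y) > of_int B + 1" using y by (simp add: norm_divide field_simps)
  from dominated_sum_zero[OF this B, of J "\<lambda>i. q (J - i)"] sum0 q(1)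
  have "\<forall>i\<le>J. q (J - i) = 0" by simp
  from this[rule_format, of "J - j"] j show ?thesis by simp
qed

lemma int_root_norm_le:
  assumes P: "P \<noteq> 0" "\<And>j. \<bar>coeff P j\<bar> \<le> B" and B: "B \<ge> 0" and y: "evi P y = 0"
  shows "cmod y \<le> of_int B + 1"
proof (rule ccontr)
  assume "\<not> ?thesis"
  hence gt: "cmod y > of_int B + 1" by simp
  have "P = (\<Sum>j\<le>degree P. monom (coeff P j) j)" by (simp add: poly_as_sum_of_monoms)
  hence "(\<Sum>j\<le>degree P. of_int (coeff P j) * y ^ j) = 0" using y by (metis (no_types, lifting) evi_sum evi_monom sum.cong)
  from dominated_sum_zero[OF gt B _ this] P(2) have "lead_coeff P = 0" by simp
  thus False using P(1) by simp
qed

lemma coeff_prod_linear_le: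
  fixes r :: "nat \<Rightarrow> complex"
  assumes "\<And>i. i < n \<Longrightarrow> cmod (r i) \<le> R" and R: "R \<ge> 0"
  shows "cmod (coeff (\<Prod>i<n. [:- r i, 1:]) k) \<le> (1 + R) ^ n"
  using assms(1)
proof (induction n arbitrary: k)
  case 0
  show ?case by (simp add: coeff_pCons split: nat.split)
next
  case (Suc n)
  define p where "p = (\<Prod>i<n. [:- r i, 1:])"
  have IH: "cmod (coeff p k) \<le> (1 + R) ^ n" for k unfolding p_def by (rule Suc.IH) (use Suc.prems in auto)
  have "(\<Prod>i<Suc n. [:- r i, 1:]) = smult (- r n) p + pCons 0 p"
    by (simp add: p_def mult.commute)
  hence "cmod (coeff (\<Prod>i<Suc n. [:- r i, 1:]) k) \<le> cmod (r n) * cmod (coeff p k) + cmod (coeff (pCons 0 p) k)"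
    by (simp add: norm_mult[symmetric]) (metis norm_triangle_ineq add.commute norm_minus_cancel diff_conv_add_uminus)
  also have "\<dots> \<le> R * (1 + R) ^ n + (1 + R) ^ n"
    using IH Suc.prems[of n] R by (intro add_mono mult_mono) (auto simp: coeff_pCons split: nat.split)
  finally show ?case by (simp add: algebra_simps)
qed

lemma finite_int_polys_bounded: "finite {f::int poly. degree f \<le> D \<and> (\<forall>i. \<bar>coeff f i\<bar> \<le> B)}" (is "finite ?S")
proof -
  define \<phi> where "\<phi> = (\<lambda>f::int poly. restrict (coeff f) {..D})"
  have "inj_on \<phi> ?S"
  proof (rule inj_onI)
    fix f g assume fg: "f \<in> ?S" "g \<in> ?S" "\<phi> f = \<phi> g"
    show "f = g"
    proof (rule poly_eqI)
      fix i
      show "coeff f i = coeff g i"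
        using fun_cong[OF fg(3), of i] fg(1,2) by (cases "i \<le> D") (auto simp: \<phi>_def coeff_eq_0)
    qed
  qed
  moreover have "\<phi> ` ?S \<subseteq> PiE {..D} (\<lambda>_. {-B..B})"
    by (auto simp: \<phi>_def abs_le_iff minus_le_iff split: if_splits)
  ultimately show ?thesis by (rule inj_on_finite) (auto intro!: finite_PiE)
qed

text \<open>The leading coefficient of \<open>f\<close> divides that of \<open>P\<close>, and the
  roots of \<open>f\<close> are roots of \<open>P\<close>, hence bounded by \<open>B + 1\<close>;
  multiplying out the linear factors bounds all coefficients of \<open>f\<close>.\<close>

lemma finite_low_degree_divisors:
  assumes B: "B \<ge> 0"
  shows "finite {f::int poly. degree f \<le> D \<and> (\<exists>P. P \<noteq> 0 \<and> (\<forall>j. \<bar>coeff P j\<bar> \<le> B) \<and> f dvd P)}" (is "finite ?S")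
proof -
  define C where "C = \<lceil>real_of_int B * (1 + (of_int B + 1)) ^ D\<rceil>"
  have "\<bar>coeff f i\<bar> \<le> C" if f: "f \<in> ?S" for f i
  proof -
    obtain P where P: "P \<noteq> 0" "\<And>j. \<bar>coeff P j\<bar> \<le> B" "f dvd P" and deg: "degree f \<le> D" using f by auto
    obtain h where h: "P = f * h" using P(3) by (auto elim: dvdE)
    have f0: "f \<noteq> 0" using h P(1) by auto
    define F where "F = map_poly complex_of_int f"
    have dF: "degree F = degree f" by (simp add: F_def degree_map_poly)
    obtain r where r: "smult (lead_coeff F) (\<Prod>i<degree F. [:- r i, 1:]) = F"
      by (rule complex_poly_decompose')
    have root: "cmod (r i) \<le> of_int B + 1" if "i < degree F" for i
    proof (rule int_root_norm_le[OF P(1,2) B])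
      have "poly F (r i) = 0" using that by (subst r[symmetric]) (auto simp: poly_prod intro!: prod_zero bexI[of _ i])
      hence "evi f (r i) = 0" by (simp add: evi_def F_def)
      thus "evi P (r i) = 0" by (simp add: h evi_mult)
    qed
    have "lead_coeff f dvd lead_coeff P" by (simp add: h lead_coeff_mult)
    hence "\<bar>lead_coeff f\<bar> \<le> \<bar>lead_coeff P\<bar>" using P(1) by (simp add: dvd_imp_le_int)
    also have "\<dots> \<le> B" by (rule P(2))
    finally have lead: "\<bar>lead_coeff f\<bar> \<le> B" .
    have "real_of_int \<bar>coeff f i\<bar> = cmod (coeff F i)" by (simp add: F_def coeff_map_poly)
    also have "\<dots> = cmod (lead_coeff F) * cmod (coeff (\<Prod>i<degree F. [:- r i, 1:]) i)"
      by (subst r[symmetric]) (simp add: norm_mult)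
    also have "\<dots> \<le> of_int B * (1 + (of_int B + 1)) ^ degree F"
    proof (intro mult_mono coeff_prod_linear_le root)
      have "cmod (lead_coeff F) = real_of_int \<bar>lead_coeff f\<bar>" by (simp only: dF) (simp add: F_def coeff_map_poly)
      thus "cmod (lead_coeff F) \<le> real_of_int B" using lead by simp
    qed (use B in auto)
    also have "\<dots> \<le> of_int B * (1 + (of_int B + 1)) ^ D"
      using B deg dF by (intro mult_left_mono power_increasing) auto
    finally show ?thesis unfolding C_def by linarith
  qed
  hence "?S \<subseteq> {f. degree f \<le> D \<and> (\<forall>i. \<bar>coeff f i\<bar> \<le> C)}" by auto
  thus ?thesis by (rule finite_subset) (rule finite_int_polys_bounded)
qed

section \<open>Factors of degree one and two\<close>

text \<open>With \<open>B = 2 m\<close> it implies that two coefficient vectors agreeing off the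
  multiples of \<open>L\<close> and both giving multiples of \<open>f\<close> are equal.\<close>

definition sparse_free :: "int \<Rightarrow> nat \<Rightarrow> int poly \<Rightarrow> bool" where
  "sparse_free B L f \<longleftrightarrow> (\<forall>q J. (\<forall>i. \<bar>q i\<bar> \<le> B) \<longrightarrow> f dvd (\<Sum>i<J. monom (q i) (L * i)) \<longrightarrow> (\<forall>i<J. q i = 0))"

text \<open>A high power of \<open>\<alpha>\<close> is so large or so small that a nonzero
  polynomial in \<open>\<alpha>^L\<close> with bounded coefficients is dominated by its top or
  bottom term.\<close>

lemma sparse_free_off_circle:
  assumes B: "B \<ge> 0" and \<alpha>: "evi f \<alpha> = 0" "\<alpha> \<noteq> 0" "cmod \<alpha> \<noteq> 1"
  obtains L where "L > 0" "sparse_free B L f"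
proof -
  have key: "sparse_free B L f" if "cmod (\<alpha> ^ L) > of_int B + 1 \<or> cmod (\<alpha> ^ L) * (of_int B + 1) < 1" for L
    unfolding sparse_free_def
  proof (intro allI impI)
    fix q :: "nat \<Rightarrow> int" and J i
    assume q: "\<forall>i. \<bar>q i\<bar> \<le> B" and dvd: "f dvd (\<Sum>i<J. monom (q i) (L * i))" and i: "i < J"
    obtain J' where J': "J = Suc J'" using i by (cases J) auto
    obtain g where "(\<Sum>i<J. monom (q i) (L * i)) = f * g" using dvd by (rule dvdE)
    hence "evi (\<Sum>i<J. monom (q i) (L * i)) \<alpha> = 0" by (simp only: evi_mult \<alpha>(1)) simp
    hence sum0: "(\<Sum>i\<le>J'. of_int (q i) * (\<alpha> ^ L) ^ i) = 0"
      by (simp only: evi_sum evi_monom power_mult J' lessThan_Suc_atMost)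
    from that show "q i = 0"
    proof
      assume "cmod (\<alpha> ^ L) > of_int B + 1"
      from dominated_sum_zero[OF this B _ sum0] q i J' show ?thesis by simp
    next
      assume "cmod (\<alpha> ^ L) * (of_int B + 1) < 1"
      from dominated_sum_zero'[OF _ this B _ sum0] q i J' \<alpha>(2) show ?thesis by simp
    qed
  qed
  show ?thesis
  proof (cases "cmod \<alpha> > 1")
    case True
    then obtain L where L: "of_int B + 1 < cmod \<alpha> ^ L" using real_arch_pow by blast
    have "L > 0" using L B by (cases L) auto
    thus ?thesis using that key[of L] L by (simp add: norm_power)
  next
    case False
    hence "cmod \<alpha> < 1" using \<alpha>(3) by simp
    then obtain L where L: "cmod \<alpha> ^ L < 1 / (of_int B + 2)"
      using real_arch_pow_inv[of "1 / (of_int B + 2)" "cmod \<alpha>"] B by auto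
    have "L > 0" using L B by (cases L) auto
    moreover have "cmod (\<alpha> ^ L) * (of_int B + 1) < 1"
    proof -
      have "cmod (\<alpha> ^ L) * (of_int B + 2) < 1" using L B by (simp add: norm_power field_simps)
      moreover have "cmod (\<alpha> ^ L) * (of_int B + 1) \<le> cmod (\<alpha> ^ L) * (of_int B + 2)" by (intro mult_left_mono) auto
      ultimately show ?thesis by linarith
    qed
    ultimately show ?thesis using that key[of L] by blast
  qed
qed

text \<open>Here the roots may lie on the unit circle, but \<open>f\<close> has roots of absolute value different from 1
  for the \<open>r\<close>-adic valuation, and these spread the powers of \<open>x ^ L\<close> apart.\<close>

lemma sparse_free_palindromic:
  assumes B: "B \<ge> 0" and a0: "a \<noteq> 0" and r: "prime r" "r dvd (a::int)" "\<not> r dvd b"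
  obtains L where "L > 0" "sparse_free B L [:a, b, a:]"
proof -
  \<comment> \<open>Chosen so that \<open>r^(L - 1) \<ge> 2^(L - 1) > B\<close>.\<close>
  define L where "L = nat B + 2"
  have "sparse_free B L [:a, b, a:]"
    unfolding sparse_free_def
  proof (intro allI impI, rule ccontr)
    fix q :: "nat \<Rightarrow> int" and J i0
    assume q: "\<forall>i. \<bar>q i\<bar> \<le> B" and dvd: "[:a, b, a:] dvd (\<Sum>i<J. monom (q i) (L * i))" and i0: "i0 < J" "q i0 \<noteq> 0"
    define Q where "Q = (\<Sum>i<J. monom (q i) (L * i))"
    have cQ: "coeff Q k = (\<Sum>i<J. if L * i = k then q i else 0)" for k by (simp add: Q_def coeff_sum)
    have L0: "L > 0" by (simp add: L_def)
    have cQ0: "coeff Q k = 0" if "\<not> L dvd k" for k unfolding cQ using that by (intro sum.neutral) auto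
    have cQle: "\<bar>coeff Q k\<bar> \<le> B" for k
    proof (cases "L dvd k")
      case True
      then obtain i where k: "k = L * i" by (auto elim: dvdE)
      have "coeff Q k = (\<Sum>i'<J. if i' = i then q i' else 0)" unfolding cQ using L0 by (intro sum.cong) (auto simp: k)
      thus ?thesis using q B by (simp add: sum.delta')
    qed (use cQ0 B in auto)
    have "coeff Q (L * i0) = (\<Sum>i<J. if i = i0 then q i else 0)" unfolding cQ using L0 by (intro sum.cong) auto
    hence "coeff Q (L * i0) \<noteq> 0" using i0 by (simp add: sum.delta')
    hence Q0: "Q \<noteq> 0" by auto
    obtain g where g: "Q = [:a, b, a:] * g" using dvd by (auto simp: Q_def elim: dvdE)
    have g0: "g \<noteq> 0" using g Q0 by auto
    \<comment> \<open>The coefficients of \<open>g\<close> shifted by two and padded with zeros, so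
      that one recurrence describes all coefficients of \<open>Q\<close>.\<close>
    define h where "h = (\<lambda>k. if k < 2 then 0 else coeff g (k - 2))"
    have cQh: "coeff Q k = a * h (k + 2) + b * h (k + 1) + a * h k" for k
    proof -
      consider "k = 0" | "k = 1" | k' where "k = Suc (Suc k')"
        by (metis One_nat_def not0_implies_Suc)
      thus ?thesis
        by cases (simp_all add: g h_def mult_pCons_left algebra_simps)
    qed
    define S where "S = (LEAST k. h k \<noteq> 0)"
    have "h (degree g + 2) \<noteq> 0" using g0 by (simp add: h_def)
    hence hS: "h S \<noteq> 0" unfolding S_def by (rule LeastI)
    have hlow: "h k = 0" if "k < S" for k using not_less_Least[of k "\<lambda>k. h k \<noteq> 0"] that by (auto simp: S_def)
    have S2: "S \<ge> 2" using hS by (auto simp: h_def split: if_splits)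
    have cS: "coeff Q (S - 2) = a * h S" using cQh[of "S - 2"] S2 hlow[of "S - 1"] hlow[of "S - 2"]
      by (simp add: Suc_diff_Suc numeral_2_eq_2)
    have LS: "L dvd S - 2" using cS hS a0 cQ0[of "S - 2"] by auto
    \<comment> \<open>\<open>L\<close> divides \<open>S - 2\<close>, so the next
      \<open>L - 1\<close> coefficients of \<open>Q\<close> vanish. Each use of the recurrence
      \<open>b h(j) = - a (h(j + 1) + h(j - 1))\<close> gains a factor \<open>r\<close>, which
      divides \<open>a\<close> but not \<open>b\<close>; descending to \<open>S\<close> yields
      \<open>r^(L - 1)\<close>.\<close>
    have div: "r ^ e dvd h (S + i)" if "i + e < L" for e i
      using that
    proof (induction e arbitrary: i)
      case (Suc e)
      have "\<not> L dvd (S - 2) + (i + 1)"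
      proof
        assume "L dvd (S - 2) + (i + 1)"
        hence "L dvd i + 1" using LS dvd_add_right_iff by blast
        thus False using Suc.prems dvd_imp_le[of L "i + 1"] by simp
      qed
      hence "0 = a * h (S + (i + 1)) + b * h (S + i) + a * h (S + i - 1)"
        using cQh[of "(S - 2) + (i + 1)"] cQ0[of "(S - 2) + (i + 1)"] S2 by (simp add: algebra_simps numeral_2_eq_2 Suc_diff_Suc)
      hence eq: "b * h (S + i) = - (a * (h (S + (i + 1)) + h (S + i - 1)))" by (simp add: algebra_simps)
      have "r ^ e dvd h (S + (i + 1))" by (rule Suc.IH) (use Suc.prems in simp)
      moreover have "r ^ e dvd h (S + i - 1)"
      proof (cases i)
        case 0
        thus ?thesis using hlow[of "S - 1"] S2 by simp
      next
        case i': (Suc i')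
        show ?thesis using Suc.IH[of i'] Suc.prems i' by simp
      qed
      ultimately have "r * r ^ e dvd a * (h (S + (i + 1)) + h (S + i - 1))" using r(2) by (intro mult_dvd_mono dvd_add)
      hence "r ^ Suc e dvd b * h (S + i)" unfolding eq by simp
      moreover have "coprime (r ^ Suc e) b" using r by (simp add: prime_imp_coprime)
      ultimately show ?case using coprime_dvd_mult_right_iff by blast
    qed simp
    have "r ^ (L - 1) dvd h S" using div[of 0 "L - 1"] L0 by simp
    hence "r ^ (L - 1) \<le> \<bar>h S\<bar>" using hS by (metis dvd_imp_le_int dvd_abs_iff abs_le_D1 order.trans)
    also have "1 * \<bar>h S\<bar> \<le> \<bar>a\<bar> * \<bar>h S\<bar>" using a0 by (intro mult_right_mono) auto
    hence "\<bar>h S\<bar> \<le> \<bar>a * h S\<bar>" by (simp add: abs_mult)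
    also have "\<dots> \<le> B" using cQle[of "S - 2"] cS by simp
    finally have "r ^ (L - 1) \<le> B" .
    moreover have "B < 2 ^ (L - 1)" using B of_nat_less_two_power[of "nat B", where 'a=int] by (simp add: L_def)
    moreover have "(2::int) ^ (L - 1) \<le> r ^ (L - 1)" using prime_ge_2_int[OF r(1)] by (intro power_mono) auto
    ultimately show False by linarith
  qed
  thus ?thesis using that[of L] by (simp add: L_def)
qed

text \<open>On the unit circle the conjugate of \<open>\<alpha>\<close> is its inverse, which makes
  \<open>f\<close> palindromic with \<open>|b| < 2 |a|\<close>. For \<open>|a| = 1\<close> this
  leaves three cyclotomic polynomials up to sign; otherwise a prime factor of \<open>a\<close>
  cannot divide \<open>b\<close> since the content is 1.\<close>

lemma degree_2_cases:
  assumes f: "content f = 1" "degree f = 2" "evi f \<alpha> = 0" "\<And>g. evi g \<alpha> = 0 \<Longrightarrow> f dvd g"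
    and \<alpha>: "\<alpha> \<noteq> 0" and B: "B \<ge> 0"
  shows "(\<exists>L>0. sparse_free B L f) \<or> (\<exists>\<epsilon> b. \<epsilon> \<in> {-1, 1} \<and> b \<in> {-1, 0, 1} \<and> f = smult \<epsilon> [:1, b, 1:])"
proof (cases "cmod \<alpha> = 1")
  case False
  obtain L where "L > 0" "sparse_free B L f" by (rule sparse_free_off_circle[OF B f(3) \<alpha> False])
  thus ?thesis by blast
next
  case True
  define a b c where "a = coeff f 2" and "b = coeff f 1" and "c = coeff f 0"
  have f_eq: "f = [:c, b, a:]"
  proof (rule poly_eqI)
    fix i :: nat
    consider "i = 0" | "i = 1" | "i = 2" | "i > 2" by linarith
    thus "coeff f i = coeff [:c, b, a:] i"
      by cases (auto simp: a_def b_def c_def numeral_2_eq_2 coeff_eq_0 f(2) coeff_pCons split: nat.split)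
  qed
  have a0: "a \<noteq> 0" using f(2) by (metis a_def leading_coeff_0_iff degree_0 zero_neq_numeral)
  \<comment> \<open>A real point of the circle is 1 or -1, whose minimal polynomial has degree
    1.\<close>
  have nonreal: "Im \<alpha> \<noteq> 0"
  proof
    assume im: "Im \<alpha> = 0"
    hence "\<bar>Re \<alpha>\<bar> = 1" using True by (simp add: cmod_eq_Re)
    hence "Re \<alpha> = 1 \<or> Re \<alpha> = -1" by linarith
    hence "\<alpha> = of_int 1 \<or> \<alpha> = of_int (-1)" using im by (auto simp: complex_eq_iff)
    then obtain \<epsilon> :: int where "\<alpha> = of_int \<epsilon>" by blast
    hence "evi [:-\<epsilon>, 1:] \<alpha> = 0" by simp
    hence "f dvd [:-\<epsilon>, 1:]" by (rule f(4))
    hence "degree f \<le> degree [:-\<epsilon>, 1:]" by (rule dvd_imp_degree_le) simp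
    thus False using f(2) by simp
  qed
  have "\<alpha> * cnj \<alpha> = 1" using True by (simp add: complex_norm_square[symmetric])
  have "0 = (of_int c + \<alpha> * (of_int b + \<alpha> * of_int a)) * cnj \<alpha>" using f(3) by (simp add: f_eq)
  also have "\<dots> = of_int c * cnj \<alpha> + of_int b * (\<alpha> * cnj \<alpha>) + of_int a * \<alpha> * (\<alpha> * cnj \<alpha>)"
    by (simp add: algebra_simps)
  finally have eq: "of_int c * cnj \<alpha> + of_int b + of_int a * \<alpha> = 0" using \<open>\<alpha> * cnj \<alpha> = 1\<close> by simp
  have "of_int a * Im \<alpha> - of_int c * Im \<alpha> = 0" using arg_cong[OF eq, of Im] by simp
  hence ac: "c = a" using nonreal by (simp flip: left_diff_distrib)
  have re: "of_int b = - 2 * of_int a * Re \<alpha>" using arg_cong[OF eq, of Re] ac by (simp add: algebra_simps)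
  have "(Re \<alpha>)\<^sup>2 + (Im \<alpha>)\<^sup>2 = 1" using True by (simp add: cmod_def)
  moreover have "(Im \<alpha>)\<^sup>2 > 0" using nonreal by simp
  ultimately have "(Re \<alpha>)\<^sup>2 < 1" by linarith
  hence "\<bar>Re \<alpha>\<bar> < 1" by (simp add: abs_square_less_1)
  hence "\<bar>real_of_int b\<bar> < 2 * \<bar>real_of_int a\<bar>" using a0 by (simp add: re abs_mult)
  hence b_lt: "\<bar>b\<bar> < 2 * \<bar>a\<bar>" by linarith
  show ?thesis
  proof (cases "\<bar>a\<bar> = 1")
    case True
    hence "b \<in> {-1, 0, 1}" using b_lt by auto
    moreover have "a = 1 \<or> a = -1" using True by linarith
    ultimately show ?thesis unfolding f_eq ac
      by (intro disjI2 exI[of _ a] exI[of _ "a * b"]) auto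
  next
    case False
    hence "\<not> is_unit a" by simp
    then obtain r where r: "prime r" "r dvd a" using a0 prime_divisorE by blast
    have "\<not> r dvd b"
    proof
      assume "r dvd b"
      hence "[:r:] dvd f" using r by (auto simp: const_poly_dvd_iff f_eq ac coeff_pCons split: nat.split)
      hence "r dvd 1" using f(1) by (simp add: const_poly_dvd_iff_dvd_content)
      thus False using r(1) by (simp add: not_prime_unit)
    qed
    obtain L where "L > 0" "sparse_free B L [:a, b, a:]"
      by (rule sparse_free_palindromic[OF B a0 r \<open>\<not> r dvd b\<close>])
    thus ?thesis unfolding f_eq ac by blast
  qed
qed

text \<open>The root is real, so on the unit circle it could only be 1 or -1;
  \<open>sparse_free_off_circle\<close> applies to all others.\<close>

lemma degree_1_sparse_free:
  assumes f: "degree f = 1" "evi f \<alpha> = 0" and \<alpha>: "\<alpha> \<noteq> 0" "\<alpha> \<noteq> 1" "\<alpha> \<noteq> -1" and B: "B \<ge> 0"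
  shows "\<exists>L>0. sparse_free B L f"
proof -
  define a b where "a = coeff f 1" and "b = coeff f 0"
  have "f = [:b, a:]"
  proof (rule poly_eqI)
    fix i :: nat
    consider "i = 0" | "i = 1" | "i > 1" by linarith
    thus "coeff f i = coeff [:b, a:] i"
      by cases (auto simp: a_def b_def coeff_eq_0 f(1) coeff_pCons split: nat.split)
  qed
  moreover have "a \<noteq> 0" using f(1) by (metis a_def leading_coeff_0_iff degree_0 zero_neq_one)
  ultimately have f_eq: "f = [:b, a:]" "a \<noteq> 0" by auto
  hence "\<alpha> = of_real (- of_int b / of_int a)" using f(2) by (simp add: field_simps add_eq_0_iff2)
  then obtain x where x: "\<alpha> = of_real x" by blast
  have "cmod \<alpha> \<noteq> 1"
  proof
    assume "cmod \<alpha> = 1"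
    hence "x = 1 \<or> x = -1" by (simp add: x abs_if split: if_splits)
    thus False using \<alpha> x by auto
  qed
  thus ?thesis using sparse_free_off_circle[OF B f(2) \<alpha>(1)] by blast
qed

section \<open>Periodic recurrences and the probability of individual factors of low degree\<close>

lemma pairing_monom: "pairing u (monom 1 L) = u L"
proof -
  have "pairing u (monom 1 L) = (\<Sum>j\<le>L. coeff (monom 1 L) j * u j)"
    by (rule pairing_upto) (rule degree_monom_le)
  also have "\<dots> = (\<Sum>j\<le>L. if j = L then u j else 0)" by (intro sum.cong) auto
  finally show ?thesis by (simp add: sum.delta')
qed

text \<open>The functional given by the shifted sequence kills every multiple of \<open>f\<close>,
  in particular \<open>x^L - 1\<close>.\<close>

lemma rec_seq_periodic:
  assumes f: "lead_coeff f = 1" "f dvd monom 1 L - 1"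
  shows "rec_seq f t (k + L) = rec_seq f t k"
proof -
  define u where "u = (\<lambda>j. rec_seq f t (k + j))"
  obtain h where h: "monom 1 L - 1 = f * h" using f(2) by (rule dvdE)
  have "pairing u (f * h) = 0"
    by (rule pairing_recurrence) (use rec_seq_recurrence[OF f(1), of t "k + _"] in \<open>simp add: u_def add.assoc\<close>)
  moreover have "pairing u (monom 1 L - 1) = u L - u 0"
  proof -
    have "monom 1 L - 1 = monom 1 L + smult (-1) (1 :: int poly)" by (simp only: smult_minus_left smult_1_left)
    thus ?thesis by (simp only: pairing_add pairing_smult pairing_monom) (simp add: pairing_def)
  qed
  ultimately show ?thesis using h by (simp add: u_def)
qed

text \<open>These are the conditions \<open>P(\<alpha>) = 0\<close> and
  \<open>P'(\<alpha>) = 0\<close> in terms of sequences. Applying the recurrence of \<open>f\<close>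
  once to \<open>j u_j\<close> leaves \<open>v\<close>, where the multiplier \<open>k\<close> has
  dropped out and which solves the recurrence again; so \<open>f^2\<close> annihilates
  \<open>j u_j\<close>.\<close>

lemma square_factor_pairing:
  assumes F: "ipoly n a = f * f * g" and rec: "\<And>k. (\<Sum>i\<le>degree f. coeff f i * u (k + i)) = 0"
  shows "(\<Sum>j\<le>n. a j * u j) = 0" "(\<Sum>j\<le>n. a j * (int j * u j)) = 0"
proof -
  show "(\<Sum>j\<le>n. a j * u j) = 0"
    using pairing_recurrence[OF rec, of "f * g"] F by (simp add: pairing_ipoly[symmetric] mult.assoc)
  define v where "v = (\<lambda>k. \<Sum>i\<le>degree f. coeff f i * (int (k + i) * u (k + i)))"
  have v: "v k = (\<Sum>i\<le>degree f. coeff f i * (int i * u (k + i)))" for k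
  proof -
    have "v k = int k * (\<Sum>i\<le>degree f. coeff f i * u (k + i)) + (\<Sum>i\<le>degree f. coeff f i * (int i * u (k + i)))"
      unfolding v_def sum_distrib_left sum.distrib[symmetric] by (intro sum.cong) (auto simp: algebra_simps)
    thus ?thesis by (simp only: rec)
  qed
  have "pairing (\<lambda>j. int j * u j) (f * (f * g)) = pairing v (f * g)" by (simp only: pairing_mult v_def)
  also have "\<dots> = 0"
  proof (rule pairing_recurrence)
    fix k
    have "(\<Sum>j\<le>degree f. coeff f j * v (k + j)) = (\<Sum>j\<le>degree f. \<Sum>i\<le>degree f. coeff f j * (coeff f i * (int i * u (k + j + i))))"
      by (simp only: v sum_distrib_left)
    also have "\<dots> = (\<Sum>i\<le>degree f. \<Sum>j\<le>degree f. coeff f i * int i * (coeff f j * u ((k + i) + j)))"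
      by (subst sum.swap) (intro sum.cong refl, simp add: algebra_simps)
    also have "\<dots> = 0" by (simp only: sum_distrib_left[symmetric] rec) simp
    finally show "(\<Sum>j\<le>degree f. coeff f j * v (k + j)) = 0" .
  qed
  finally show "(\<Sum>j\<le>n. a j * (int j * u j)) = 0" using F by (simp add: pairing_ipoly[symmetric] mult.assoc)
qed

context bounded_law_prime
begin

lemma prb_sparse_free_le:
  assumes L: "L > 0" "sparse_free (2 * m) L f"
  shows "prb n (\<lambda>a. f dvd ipoly n a) \<le> (1/2) ^ (n div L + 1)"
proof -
  define J where "J = (\<lambda>i. L * i) ` {..<n div L + 1}"
  have le: "L * i \<le> n" if "i < n div L + 1" for i
  proof -
    have "L * i \<le> L * (n div L)" using that by (intro mult_left_mono) auto
    also have "\<dots> \<le> n" by simp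
    finally show ?thesis .
  qed
  have "card J = n div L + 1" unfolding J_def using L by (subst card_image) (auto simp: inj_on_def)
  moreover have "prb n (\<lambda>a. f dvd ipoly n a) \<le> (1/2) ^ card J"
  proof (rule prb_fiber_inj)
    show "J \<subseteq> {..n}" using le by (auto simp: J_def)
    fix a b assume ab: "a \<in> box n" "b \<in> box n" "f dvd ipoly n a" "f dvd ipoly n b" "\<And>j. j \<notin> J \<Longrightarrow> a j = b j"
    define q where "q = (\<lambda>i. if i < n div L + 1 then a (L * i) - b (L * i) else 0)"
    have "f dvd ipoly n a - ipoly n b" using ab by (intro dvd_diff)
    also have "ipoly n a - ipoly n b = (\<Sum>i<n div L + 1. monom (a (L * i) - b (L * i)) (L * i))"
      by (rule ipoly_diff_sparse[OF _ L(1) le]) (use ab in \<open>auto simp: J_def\<close>)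
    also have "\<dots> = (\<Sum>i<n div L + 1. monom (q i) (L * i))" by (intro sum.cong) (auto simp: q_def)
    finally have "f dvd (\<Sum>i<n div L + 1. monom (q i) (L * i))" .
    moreover have "\<bar>q i\<bar> \<le> 2 * m" for i
    proof -
      have "m \<ge> 0" using box_abs_le[OF ab(1), of 0] by simp
      thus ?thesis using box_abs_le[OF ab(1) le, of i] box_abs_le[OF ab(2) le, of i] by (auto simp: q_def)
    qed
    ultimately have q0: "\<forall>i<n div L + 1. q i = 0" using L(2) unfolding sparse_free_def by blast
    show "a = b"
    proof
      fix j show "a j = b j"
      proof (cases "j \<in> J")
        case True
        thus ?thesis using q0 by (force simp: J_def q_def)
      qed (use ab in auto)
    qed
  qed
  ultimately show ?thesis by simp
qed

text \<open>For each residue \<open>t < d\<close> the Fourier family uses an independent pair of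
  offset and slope, so the second moment factorises over \<open>t\<close> into \<open>d\<close>
  copies of the estimate in \<open>sum_line_family_le\<close>.\<close>

lemma prb_cyclotomic_square_le:
  assumes f: "lead_coeff f = 1" "f dvd monom 1 L - 1" "L > 0" and K: "K \<ge> 2" "L * K \<le> n"
  shows "prb n (\<lambda>a. \<exists>g. ipoly n a = f * f * g) \<le> line_bound c K ^ degree f"
proof -
  define d where "d = degree f"
  define T where "T = {..<d}"
  define R where "R = {0..<int (K^2)}"
  define I where "I = PiE T (\<lambda>_. R \<times> R)"
  \<comment> \<open>At \<open>k = L i + t\<close> the value \<open>u p k\<close> is \<open>L (A + i B)\<close> with \<open>(A, B) = p t\<close>; the factors \<open>L\<close> and \<open>\<Delta>\<close> of
    the modulus \<open>N\<close> cancel against this \<open>L\<close> and the \<open>\<Delta>\<close> in \<open>char_le\<close>.\<close>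
  define e where "e = (\<lambda>t::nat. rec_seq f (\<lambda>j. if j = t then 1 else 0))"
  define u where "u = (\<lambda>p k. \<Sum>t\<in>T. (int L * fst (p t) + (int k - int t) * snd (p t)) * e t k)"
  define F where "F = (\<lambda>p p'. exp (- c * (\<Sum>i<K. (dist_int (of_int (fst p - fst p' + int i * (snd p - snd p')) / real (K^2)))\<^sup>2)))"
  let ?Z = "\<Sum>x\<in>R\<times>R. \<Sum>x'\<in>R\<times>R. F x x'"
  define N where "N = L * \<Delta> * K^2"
  have N: "N > 0" using f \<Delta> K by (simp add: N_def)
  \<comment> \<open>This makes the positions \<open>L i + t\<close> with \<open>t < d\<close>
    distinct.\<close>
  have dL: "d \<le> L"
  proof -
    have "coeff (monom 1 L - 1 :: int poly) L = 1" using f(3) by simp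
    hence "monom 1 L - 1 \<noteq> (0 :: int poly)" by (metis coeff_0 zero_neq_one)
    hence "degree f \<le> degree (monom 1 L - 1 :: int poly)" by (rule dvd_imp_degree_le[OF f(2)])
    also have "\<dots> \<le> L" by (intro degree_diff_le) (auto simp: degree_monom_le)
    finally show ?thesis by (simp add: d_def)
  qed
  have e_val: "e t (L * i + s) = (if s = t then 1 else 0)" if "s < d" for t i s
  proof (induction i)
    case 0
    thus ?case using that by (simp add: e_def rec_seq_init d_def)
  next
    case (Suc i)
    have "L * Suc i + s = (L * i + s) + L" by simp
    thus ?case using Suc rec_seq_periodic[OF f(1,2)] by (simp only: e_def)
  qed
  have fin: "finite R" "finite T" "R \<noteq> {}" using K by (auto simp: R_def T_def)
  have I: "finite I" "I \<noteq> {}" using fin by (auto simp: I_def PiE_eq_empty_iff intro!: finite_PiE)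
  have "prb n (\<lambda>a. \<exists>g. ipoly n a = f * f * g)
     \<le> (\<Sum>p\<in>I. \<Sum>p'\<in>I. \<Prod>j\<le>n. char_abs (of_int (u p j - u p' j) / real N)) / (real (card I))\<^sup>2"
  proof (rule prb_fourier[OF I N])
    fix a p assume "\<exists>g. ipoly n a = f * f * g"
    then obtain g where g: "ipoly n a = f * f * g" by blast
    note sq = square_factor_pairing[OF g rec_seq_recurrence[OF f(1)]]
    define v where "v = (\<lambda>t j. (int L * fst (p t) + (int j - int t) * snd (p t)) * e t j)"
    have "(\<Sum>j\<le>n. a j * u p j) = (\<Sum>t\<in>T. \<Sum>j\<le>n. a j * v t j)"
      unfolding u_def v_def sum_distrib_left by (rule sum.swap)
    also have "\<dots> = (\<Sum>t\<in>T. 0)"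
    proof (rule sum.cong[OF refl])
      fix t
      have "(\<Sum>j\<le>n. a j * v t j)
         = (int L * fst (p t) - int t * snd (p t)) * (\<Sum>j\<le>n. a j * e t j) + snd (p t) * (\<Sum>j\<le>n. a j * (int j * e t j))"
        unfolding v_def sum_distrib_left sum.distrib[symmetric] by (intro sum.cong) (auto simp: algebra_simps)
      thus "(\<Sum>j\<le>n. a j * v t j) = 0"
        by (simp only: e_def sq)
    qed
    finally show "int N dvd (\<Sum>j\<le>n. a j * u p j)" by simp
  qed
  also have "\<dots> \<le> (\<Sum>p\<in>I. \<Sum>p'\<in>I. \<Prod>t\<in>T. F (p t) (p' t)) / (real (card I))\<^sup>2"
  proof (intro divide_right_mono sum_mono)
    fix p p' assume "p \<in> I" "p' \<in> I"
    define G where "G = (\<lambda>j. (dist_int (real \<Delta> * (of_int (u p j - u p' j) / real N)))\<^sup>2)"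
    define \<psi> where "\<psi> = (\<lambda>(t, i). L * i + t)"
    have inj: "inj_on \<psi> (T \<times> {..<K})"
    proof (rule inj_onI, clarsimp simp: \<psi>_def T_def)
      fix t i t' i' assume eq: "L * i + t = L * i' + t'" and "t < d" "t' < d"
      hence "t < L" "t' < L" using dL by auto
      hence "(L * i + t) mod L = t" "(L * i' + t') mod L = t'" by auto
      hence "t = t'" using eq by simp
      thus "t = t' \<and> i = i'" using eq f(3) by simp
    qed
    have G_val: "G (L * i + t) = (dist_int (of_int (fst (p t) - fst (p' t) + int i * (snd (p t) - snd (p' t))) / real (K^2)))\<^sup>2"
      if "t \<in> T" for t i
    proof -
      have td: "t < d" using that by (simp add: T_def)
      have "u p (L * i + t) = int L * fst (p t) + int L * int i * snd (p t)" for p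
      proof -
        have "u p (L * i + t) = (\<Sum>s\<in>T. if s = t then int L * fst (p s) + int L * int i * snd (p s) else 0)"
          unfolding u_def by (intro sum.cong refl) (auto simp: e_val[OF td])
        thus ?thesis using that fin by (simp add: sum.delta')
      qed
      hence "real_of_int (u p (L * i + t) - u p' (L * i + t))
         = real L * of_int (fst (p t) - fst (p' t) + int i * (snd (p t) - snd (p' t)))" by (simp add: algebra_simps)
      hence "real \<Delta> * (of_int (u p (L * i + t) - u p' (L * i + t)) / real N)
         = of_int (fst (p t) - fst (p' t) + int i * (snd (p t) - snd (p' t))) / real (K^2)"
        using \<Delta>(1) f(3) K by (simp add: N_def)
      thus ?thesis by (simp only: G_def)
    qed
    have "(\<Sum>t\<in>T. \<Sum>i<K. G (L * i + t)) = (\<Sum>x\<in>T \<times> {..<K}. G (\<psi> x))"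
      by (simp add: sum.cartesian_product \<psi>_def case_prod_beta)
    also have "\<dots> = (\<Sum>j\<in>\<psi> ` (T \<times> {..<K}). G j)" by (simp add: sum.reindex[OF inj])
    also have "\<dots> \<le> (\<Sum>j\<le>n. G j)"
    proof (rule sum_mono2)
      show "\<psi> ` (T \<times> {..<K}) \<subseteq> {..n}"
      proof (clarsimp simp: \<psi>_def T_def)
        fix t i assume "t < d" "i < K"
        have "L * i + L \<le> L * K" using \<open>i < K\<close> by (metis Suc_leI mult_Suc_right add.commute mult_le_mono2)
        thus "L * i + t \<le> n" using \<open>t < d\<close> dL K(2) by linarith
      qed
    qed (auto simp: G_def)
    finally have "c * (\<Sum>t\<in>T. \<Sum>i<K. G (L * i + t)) \<le> c * (\<Sum>j\<le>n. G j)" using c_pos by (intro mult_left_mono) auto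
    hence "exp (- c * (\<Sum>j\<le>n. G j)) \<le> exp (- c * (\<Sum>t\<in>T. \<Sum>i<K. G (L * i + t)))" by simp
    also have "\<dots> = (\<Prod>t\<in>T. F (p t) (p' t))"
      using fin by (simp add: F_def G_val exp_sum[symmetric] sum_distrib_left)
    finally show "(\<Prod>j\<le>n. char_abs (of_int (u p j - u p' j) / real N)) \<le> (\<Prod>t\<in>T. F (p t) (p' t))"
      using prod_char_abs_le[OF char_le, of "\<lambda>j. of_int (u p j - u p' j) / real N" "{..n}"] by (simp add: G_def)
  qed simp
  \<comment> \<open>A sum over all functions on \<open>T\<close> of a product over \<open>t\<close>
    is the product of the sums, first for \<open>p'\<close>, then for \<open>p\<close>.\<close>
  also have "(\<Sum>p\<in>I. \<Sum>p'\<in>I. \<Prod>t\<in>T. F (p t) (p' t)) = (\<Sum>p\<in>I. \<Prod>t\<in>T. \<Sum>x'\<in>R\<times>R. F (p t) x')"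
    unfolding I_def using fin by (intro sum.cong refl) (subst prod_sum_PiE, auto)
  also have "\<dots> = (\<Prod>t\<in>T. \<Sum>x\<in>R\<times>R. \<Sum>x'\<in>R\<times>R. F x x')"
    unfolding I_def using fin by (subst prod_sum_PiE) auto
  also have "\<dots> = ?Z ^ d" by (simp add: T_def)
  also have "(real (card I))\<^sup>2 = ((real (card (R \<times> R)))\<^sup>2) ^ d"
    unfolding I_def using fin by (simp add: card_PiE T_def power_mult[symmetric] mult.commute)
  also have "?Z ^ d / ((real (card (R \<times> R)))\<^sup>2) ^ d
     = (?Z / (real (card (R \<times> R)))\<^sup>2) ^ d" by (simp add: power_divide)
  also have "\<dots> \<le> line_bound c K ^ d"
    unfolding F_def R_def using sum_line_family_le[OF c_pos K(1)] by (intro power_mono divide_nonneg_nonneg sum_nonneg) auto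
  finally show ?thesis by (simp add: d_def)
qed

end

section \<open>Double roots away from zero and the units\<close>

text \<open>The leading coefficient of \<open>f\<close> divides that of \<open>P\<close>, and
  \<open>coeff f 0\<close> divides the lowest nonzero coefficient of \<open>P\<close>; nonzero
  coefficients of \<open>P\<close> are too small to be divisible by \<open>l\<close>.\<close>

lemma dvd_bounded_coeff:
  assumes P: "P = f * (g :: int poly)" "P \<noteq> 0" "\<And>j. \<bar>coeff P j\<bar> \<le> B" and l: "B < int l" and f0: "coeff f 0 \<noteq> 0"
  shows "\<not> int l dvd lead_coeff f" "\<not> int l dvd coeff f 0"
proof -
  have key: "\<not> int l dvd x" if "x dvd coeff P j" "coeff P j \<noteq> 0" for x j
  proof
    assume "int l dvd x"
    hence "int l dvd coeff P j" using that(1) by (rule dvd_trans)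
    from dvd_imp_le_int[OF that(2) this] have "int l \<le> \<bar>coeff P j\<bar>" by simp
    thus False using P(3)[of j] l by linarith
  qed
  show "\<not> int l dvd lead_coeff f"
  proof (rule key)
    show "lead_coeff f dvd lead_coeff P" unfolding P(1) lead_coeff_mult by simp
    show "lead_coeff P \<noteq> 0" using P(2) by simp
  qed
  have g0: "g \<noteq> 0" using P(1,2) by auto
  define i where "i = (LEAST i. coeff g i \<noteq> 0)"
  have gi: "coeff g i \<noteq> 0" unfolding i_def by (rule LeastI[of _ "degree g"]) (use g0 in simp)
  have low: "coeff g j = 0" if "j < i" for j using not_less_Least[of j "\<lambda>i. coeff g i \<noteq> 0"] that by (auto simp: i_def)
  have "coeff P i = (\<Sum>j\<le>i. coeff f j * coeff g (i - j))" by (simp add: P(1) coeff_mult)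
  also have "\<dots> = (\<Sum>j\<le>i. if j = 0 then coeff f 0 * coeff g i else 0)"
    by (intro sum.cong refl) (auto simp: low)
  finally have "coeff P i = coeff f 0 * coeff g i" by simp
  thus "\<not> int l dvd coeff f 0" using f0 gi by (intro key[of _ i]) simp_all
qed

text \<open>The roots are roots of unity of order 1, 2, 3, 4 or 6, all divisors of 12.\<close>

lemma cyclotomic_dvd_12:
  "[:-1, 1:] dvd (monom 1 12 - 1 :: int poly)" "[:1, 1:] dvd (monom 1 12 - 1 :: int poly)"
  "b \<in> {-1, 0, 1} \<Longrightarrow> [:1, b, 1:] dvd (monom 1 12 - 1 :: int poly)"
proof -
  have m: "(monom 1 12 - 1 :: int poly) = [:-1,0,0,0,0,0,0,0,0,0,0,0,1:]"
    by (simp add: eval_nat_numeral monom_Suc monom_0 one_pCons)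
  show "[:-1, 1:] dvd (monom 1 12 - 1 :: int poly)"
    unfolding m by (rule dvdI[of _ _ "[:1,1,1,1,1,1,1,1,1,1,1,1:]"]) simp
  show "[:1, 1:] dvd (monom 1 12 - 1 :: int poly)"
    unfolding m by (rule dvdI[of _ _ "[:-1,1,-1,1,-1,1,-1,1,-1,1,-1,1:]"]) simp
  have 1: "[:1, 1, 1:] dvd (monom 1 12 - 1 :: int poly)"
    unfolding m by (rule dvdI[of _ _ "[:-1,1,0,-1,1,0,-1,1,0,-1,1:]"]) simp
  have 2: "[:1, 0, 1:] dvd (monom 1 12 - 1 :: int poly)"
    unfolding m by (rule dvdI[of _ _ "[:-1,0,1,0,-1,0,1,0,-1,0,1:]"]) simp
  have 3: "[:1, -1, 1:] dvd (monom 1 12 - 1 :: int poly)"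
    unfolding m by (rule dvdI[of _ _ "[:-1,-1,0,1,1,0,-1,-1,0,1,1:]"]) simp
  show "b \<in> {-1, 0, 1} \<Longrightarrow> [:1, b, 1:] dvd (monom 1 12 - 1 :: int poly)" using 1 2 3 by auto
qed

definition double_zero :: "int poly \<Rightarrow> complex \<Rightarrow> bool" where
  "double_zero P \<alpha> \<longleftrightarrow> evi P \<alpha> = 0 \<and> evi (pderiv P) \<alpha> = 0"

context bounded_law_prime
begin

lemma m_nonneg: "m \<ge> 0"
proof (rule ccontr)
  assume "\<not> m \<ge> 0"
  hence "{-m..m} = {}" by auto
  thus False using total by simp
qed

lemma coeff_ipoly_box: "a \<in> box n \<Longrightarrow> \<bar>coeff (ipoly n a) j\<bar> \<le> m"
  using m_nonneg by (simp add: coeff_ipoly box_abs_le)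

text \<open>Independent of \<open>n\<close>: one finite set contains the factors of degree at most 4
  of all nonzero \<open>P\<close>.\<close>

definition low_factors :: "int poly set" where
  "low_factors = {f. degree f \<le> 4 \<and> (\<exists>P. P \<noteq> 0 \<and> (\<forall>j. \<bar>coeff P j\<bar> \<le> m) \<and> f dvd P)}"

lemma finite_low_factors: "finite low_factors"
  unfolding low_factors_def using finite_low_degree_divisors[OF m_nonneg] .

definition sparse_factors :: "int poly set" where
  "sparse_factors = {f \<in> low_factors. \<exists>L>0. sparse_free (2 * m) L f}"

definition mid_factors :: "int poly set" where
  "mid_factors = {f \<in> low_factors. 3 \<le> degree f \<and> unit_ends f}"

definition square_event :: "int poly \<Rightarrow> nat \<Rightarrow> (nat \<Rightarrow> int) \<Rightarrow> bool" where
  "square_event f n a \<longleftrightarrow> (\<exists>g. ipoly n a = f * f * g)"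

lemma other_double_root_cases:
  assumes a: "a \<in> box n" and P: "ipoly n a \<noteq> 0" and \<alpha>: "double_zero (ipoly n a) \<alpha>" "\<alpha> \<notin> {0, -1, 1}"
  shows "(\<exists>f g. ipoly n a = f * f * g \<and> k \<le> degree f \<and> unit_ends f)
    \<or> (\<exists>d\<in>{5..<k}. \<exists>f g. ipoly n a = f * f * g \<and> degree f = d \<and> unit_ends f)
    \<or> (\<exists>f\<in>mid_factors. square_event f n a) \<or> (\<exists>f\<in>sparse_factors. f dvd ipoly n a)
    \<or> (\<exists>b\<in>{-1, 0, 1}. square_event [:1, b, 1:] n a)"
proof -
  have ev: "evi (ipoly n a) \<alpha> = 0" "evi (pderiv (ipoly n a)) \<alpha> = 0" using \<alpha> by (auto simp: double_zero_def)
  obtain f where f: "content f = 1" "degree f > 0" "evi f \<alpha> = 0" "\<And>g. evi g \<alpha> = 0 \<Longrightarrow> f dvd g"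
    by (rule minimal_int_poly[OF P ev(1)]) blast
  obtain g where g: "ipoly n a = f * f * g" by (rule double_root_imp_square_dvd[OF f(2,3,4) ev])
  \<comment> \<open>Otherwise \<open>f = x f'\<close> and, as \<open>\<alpha>\<close> is nonzero,
    \<open>f'\<close> would be an annihilating polynomial of smaller degree.\<close>
  have f0: "coeff f 0 \<noteq> 0"
  proof
    assume "coeff f 0 = 0"
    then obtain f' where f': "f = pCons 0 f'" by (cases f) auto
    hence "evi f' \<alpha> = 0" using f(3) \<alpha>(2) by simp
    hence "f dvd f'" by (rule f(4))
    moreover have "f' \<noteq> 0" using f' f(2) by auto
    ultimately have "degree f \<le> degree f'" by (rule dvd_imp_degree_le)
    thus False using f' \<open>f' \<noteq> 0\<close> by simp
  qed
  have ndvd: "\<not> int l dvd lead_coeff f" "\<not> int l dvd coeff f 0"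
    using dvd_bounded_coeff[of "ipoly n a" f "f * g" m l] P g coeff_ipoly_box[OF a] f0 l(2) m_nonneg
    by (auto simp: mult.assoc)
  have fdvd: "f dvd ipoly n a" using g by (simp add: mult.assoc)
  have B: "2 * m \<ge> 0" using m_nonneg by simp
  consider "k \<le> degree f" | "degree f \<in> {5..<k}" | "3 \<le> degree f" "degree f \<le> 4" | "degree f = 2" | "degree f = 1"
    using f(2) by fastforce
  thus ?thesis
  proof cases
    case 3
    hence "f \<in> mid_factors" using P coeff_ipoly_box[OF a] fdvd ndvd by (auto simp: mid_factors_def low_factors_def)
    thus ?thesis using g by (auto simp: square_event_def)
  next
    case 4
    have \<alpha>0: "\<alpha> \<noteq> 0" using \<alpha>(2) by simp
    from degree_2_cases[OF f(1) 4 f(3,4) \<alpha>0 B] show ?thesis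
    proof
      assume "\<exists>L>0. sparse_free (2 * m) L f"
      hence "f \<in> sparse_factors" using 4 P coeff_ipoly_box[OF a] fdvd by (auto simp: sparse_factors_def low_factors_def)
      thus ?thesis using fdvd by blast
    next
      assume "\<exists>\<epsilon> b. \<epsilon> \<in> {-1, 1} \<and> b \<in> {-1, 0, 1} \<and> f = smult \<epsilon> [:1, b, 1:]"
      then obtain \<epsilon> b where eb: "\<epsilon> \<in> {-1, 1 :: int}" "b \<in> {-1, 0, 1}" "f = smult \<epsilon> [:1, b, 1:]" by blast
      have "f * f = [:1, b, 1:] * [:1, b, 1:]" unfolding eb(3) using eb(1) by auto
      hence "square_event [:1, b, 1:] n a" using g by (auto simp: square_event_def)
      thus ?thesis using eb(2) by blast
    qed
  next
    case 5
    hence "\<exists>L>0. sparse_free (2 * m) L f" using degree_1_sparse_free[OF 5 f(3) _ _ _ B] \<alpha>(2) by auto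
    hence "f \<in> sparse_factors" using 5 P coeff_ipoly_box[OF a] fdvd by (auto simp: sparse_factors_def low_factors_def)
    thus ?thesis using fdvd by blast
  qed (use g ndvd in blast)+
qed

definition spacing :: "int poly \<Rightarrow> nat" where
  "spacing f = (SOME L. L > 0 \<and> sparse_free (2 * m) L f)"

lemma spacing: "f \<in> sparse_factors \<Longrightarrow> spacing f > 0 \<and> sparse_free (2 * m) (spacing f) f"
  unfolding spacing_def sparse_factors_def by (rule someI_ex) auto

lemma not_dvd_coprime_power: "\<not> int l dvd x \<Longrightarrow> coprime x (int (l ^ s))"
  using prime_int_l by (metis coprime_commute coprime_power_right_iff of_nat_power prime_imp_coprime)

text \<open>Union bound over the cases of \<open>other_double_root_cases\<close>. The period 12
  serves all three quadratic cyclotomic factors, and \<open>n \<ge> 24\<close> makes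
  \<open>n div 12 \<ge> 2\<close>.\<close>

lemma prb_other_double_root_le:
  assumes k: "1 \<le> k" "l * k + 1 \<le> n" and s: "s > 0" and n: "n \<ge> 24"
  defines "N \<equiv> l ^ s"
  shows "prb n (\<lambda>a. ipoly n a \<noteq> 0 \<and> (\<exists>\<alpha>. \<alpha> \<notin> {0, -1, 1} \<and> double_zero (ipoly n a) \<alpha>))
    \<le> ((\<Sum>d=k..<2*k. real l ^ d * sq_bound l n d) + (real n + 1) * (1/2) ^ k)
      + (\<Sum>d=5..<k. real N ^ d * sq_bound N n d) + (\<Sum>f\<in>mid_factors. sq_bound N n (degree f))
      + (\<Sum>f\<in>sparse_factors. (1/2) ^ (n div spacing f + 1)) + 3 * line_bound c (n div 12) ^ 2"
    (is "_ \<le> ?B")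
proof -
  have N1: "N > 1" using one_less_power[OF l_gt_1 s] by (simp add: N_def)
  have cop: "coprime \<Delta> N" unfolding N_def by (rule coprime_\<Delta>_power)
  define E1 where "E1 = (\<lambda>a. \<exists>f g. ipoly n a = f * f * g \<and> k \<le> degree f \<and> unit_ends f)"
  define E2 where "E2 = (\<lambda>d a. \<exists>f g. ipoly n a = f * f * g \<and> degree f = d \<and> unit_ends f)"
  define E3 where "E3 = (\<lambda>f. square_event f n)"
  define E4 where "E4 = (\<lambda>(f::int poly) a. f dvd ipoly n a)"
  have fin: "finite mid_factors" "finite sparse_factors"
    using finite_low_factors by (auto simp: mid_factors_def sparse_factors_def)
  have "prb n (\<lambda>a. ipoly n a \<noteq> 0 \<and> (\<exists>\<alpha>. \<alpha> \<notin> {0, -1, 1} \<and> double_zero (ipoly n a) \<alpha>))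
    \<le> prb n (\<lambda>a. ((((E1 a \<or> (\<exists>d\<in>{5..<k}. E2 d a)) \<or> (\<exists>f\<in>mid_factors. E3 f a))
       \<or> (\<exists>f\<in>sparse_factors. E4 f a)) \<or> (\<exists>b\<in>{-1,0,1}. E3 [:1, b, 1:] a)))"
  proof (rule prb_mono)
    fix a assume "a \<in> box n" "ipoly n a \<noteq> 0 \<and> (\<exists>\<alpha>. \<alpha> \<notin> {0, -1, 1} \<and> double_zero (ipoly n a) \<alpha>)"
    then obtain \<alpha> where "a \<in> box n" "ipoly n a \<noteq> 0" "double_zero (ipoly n a) \<alpha>" "\<alpha> \<notin> {0, -1, 1}" by blast
    from other_double_root_cases[OF this, of k]
    show "(((E1 a \<or> (\<exists>d\<in>{5..<k}. E2 d a)) \<or> (\<exists>f\<in>mid_factors. E3 f a))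
       \<or> (\<exists>f\<in>sparse_factors. E4 f a)) \<or> (\<exists>b\<in>{-1,0,1}. E3 [:1, b, 1:] a)"
      unfolding E1_def E2_def E3_def E4_def by argo
  qed
  also have "\<dots> \<le> prb n E1 + prb n (\<lambda>a. \<exists>d\<in>{5..<k}. E2 d a) + prb n (\<lambda>a. \<exists>f\<in>mid_factors. E3 f a)
     + prb n (\<lambda>a. \<exists>f\<in>sparse_factors. E4 f a) + prb n (\<lambda>a. \<exists>b\<in>{-1,0,1}. E3 [:1, b, 1:] a)"
    by (intro order.trans[OF prb_disj] add_mono order.refl)
  also have "\<dots> \<le> ?B"
  proof (intro add_mono)
    show "prb n E1 \<le> (\<Sum>d=k..<2*k. real l ^ d * sq_bound l n d) + (real n + 1) * (1/2) ^ k"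
      unfolding E1_def by (rule prb_high_degree_square_le[OF k])
    have "prb n (\<lambda>a. \<exists>d\<in>{5..<k}. E2 d a) \<le> (\<Sum>d=5..<k. prb n (E2 d))" by (rule prb_UN) simp
    also have "\<dots> \<le> (\<Sum>d=5..<k. real N ^ d * sq_bound N n d)"
    proof (rule sum_mono)
      fix d assume d: "d \<in> {5..<k}"
      have "prb n (E2 d) \<le> prb n (\<lambda>a. \<exists>f g. ipoly n a = f * f * g \<and> degree f = d \<and> coprime (lead_coeff f) (int N)
        \<and> coprime (coeff f 0) (int N))"
        unfolding E2_def N_def by (rule prb_mono) (use not_dvd_coprime_power in blast)
      also have "\<dots> \<le> real N ^ d * sq_bound N n d" using d N1 cop by (intro prb_square_degree_le) auto
      finally show "prb n (E2 d) \<le> real N ^ d * sq_bound N n d" .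
    qed
    finally show "prb n (\<lambda>a. \<exists>d\<in>{5..<k}. E2 d a) \<le> (\<Sum>d=5..<k. real N ^ d * sq_bound N n d)" .
    have "prb n (\<lambda>a. \<exists>f\<in>mid_factors. E3 f a) \<le> (\<Sum>f\<in>mid_factors. prb n (E3 f))" by (rule prb_UN) (rule fin)
    also have "\<dots> \<le> (\<Sum>f\<in>mid_factors. sq_bound N n (degree f))"
    proof (rule sum_mono)
      fix f assume f: "f \<in> mid_factors"
      show "prb n (E3 f) \<le> sq_bound N n (degree f)"
        unfolding E3_def square_event_def using f N1 cop not_dvd_coprime_power[of _ s]
        by (intro prb_fixed_square_le) (auto simp: mid_factors_def N_def)
    qed
    finally show "prb n (\<lambda>a. \<exists>f\<in>mid_factors. E3 f a) \<le> (\<Sum>f\<in>mid_factors. sq_bound N n (degree f))" .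
    have "prb n (\<lambda>a. \<exists>f\<in>sparse_factors. E4 f a) \<le> (\<Sum>f\<in>sparse_factors. prb n (E4 f))" by (rule prb_UN) (rule fin)
    also have "\<dots> \<le> (\<Sum>f\<in>sparse_factors. (1/2) ^ (n div spacing f + 1))"
      unfolding E4_def using spacing by (intro sum_mono prb_sparse_free_le) auto
    finally show "prb n (\<lambda>a. \<exists>f\<in>sparse_factors. E4 f a) \<le> (\<Sum>f\<in>sparse_factors. (1/2) ^ (n div spacing f + 1))" .
    have "prb n (\<lambda>a. \<exists>b\<in>{-1,0,1}. E3 [:1, b, 1:] a) \<le> real (card {-1,0,1::int}) * line_bound c (n div 12) ^ 2"
    proof (rule prb_UN_le)
      fix b :: int assume b: "b \<in> {-1,0,1}"
      have "prb n (E3 [:1, b, 1:]) \<le> line_bound c (n div 12) ^ degree [:1, b, 1:]"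
        unfolding E3_def square_event_def using n
        by (intro prb_cyclotomic_square_le[where L = 12] cyclotomic_dvd_12(3)[OF b]) auto
      thus "prb n (E3 [:1, b, 1:]) \<le> line_bound c (n div 12) ^ 2" by (simp add: numeral_2_eq_2)
    qed simp
    thus "prb n (\<lambda>a. \<exists>b\<in>{-1,0,1}. E3 [:1, b, 1:] a) \<le> 3 * line_bound c (n div 12) ^ 2" by simp
  qed
  finally show ?thesis .
qed

lemma prb_double_at_unit_le:
  assumes \<epsilon>: "\<epsilon> \<in> {-1, 1 :: int}" and n: "n \<ge> 24"
  shows "prb n (\<lambda>a. double_zero (ipoly n a) (of_int \<epsilon>)) \<le> line_bound c (n div 12)"
proof -
  define f where "f = [:-\<epsilon>, 1:]"
  have ev: "evi g (of_int \<epsilon>) = of_int (poly g \<epsilon>)" for g by (induction g) simp_all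
  have "prb n (\<lambda>a. double_zero (ipoly n a) (of_int \<epsilon>)) \<le> prb n (\<lambda>a. \<exists>g. ipoly n a = f * f * g)"
  proof (rule prb_mono)
    fix a assume "double_zero (ipoly n a) (of_int \<epsilon>)"
    hence "evi (ipoly n a) (of_int \<epsilon>) = 0" "evi (pderiv (ipoly n a)) (of_int \<epsilon>) = 0" by (auto simp: double_zero_def)
    moreover have "f dvd g" if "evi g (of_int \<epsilon>) = 0" for g
      using that by (simp add: ev f_def poly_eq_0_iff_dvd)
    moreover have "degree f > 0" "evi f (of_int \<epsilon>) = 0" by (simp_all add: f_def)
    ultimately show "\<exists>g. ipoly n a = f * f * g" using double_root_imp_square_dvd by metis
  qed
  also have "\<dots> \<le> line_bound c (n div 12) ^ degree f"
    using n \<epsilon> cyclotomic_dvd_12(1,2) by (intro prb_cyclotomic_square_le[where L = 12]) (auto simp: f_def)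
  finally show ?thesis by (simp add: f_def)
qed

lemma prb_const_zero: "w 0 = 0 \<Longrightarrow> prb n (\<lambda>a. a 0 = 0) = 0"
  unfolding prb_def by (intro sum.neutral) (auto intro!: prod_zero bexI[of _ 0])

end

section \<open>Asymptotics of the bounds\<close>

lemma line_bound_bigo:
  assumes "c > 0"
  shows "line_bound c \<in> O(\<lambda>K. 1 / real K ^ 2)"
  using assms unfolding line_bound_def by real_asymp

text \<open>The bound for degrees at least \<open>k\<close>, with \<open>k\<close> of order
  \<open>(ln n)^2\<close>: \<open>2^(- (ln n)^2)\<close> decays faster than every power of
  \<open>n\<close>.\<close>

lemma high_bound_smallo:
  assumes "c > 0" "l > (1::real)"
  shows "(\<lambda>n. ((ln (real n))^2 + 1) * ((1/2) powr ((ln (real n))^2) + exp (2 * ((ln (real n))^2 + 1) * ln l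
     - c * (real n / (4 * ((ln (real n))^2 + 1)) - 1) / l^2)) + (real n + 1) * (1/2) powr ((ln (real n))^2))
     \<in> o(\<lambda>n. 1 / real n ^ 2)"
  using assms by real_asymp

text \<open>Here \<open>N\<close> lies within a factor \<open>l\<close> of \<open>n^(9/20)\<close>.
  The exponent exceeds 2/5, so \<open>N^(-5)\<close> beats \<open>n^(-2)\<close> even with a factor
  \<open>(ln n)^2\<close>; it is below 1/2, so the Fourier error, with exponent of order
  \<open>n / (N^2 (ln n)^2)\<close>, is still negligible.\<close>

lemma medium_bound_smallo:
  assumes "c > 0" "l > (1::real)"
  shows "(\<lambda>n. ((ln (real n))^2 + 1) * (l^5 * real n powr (-9/4) + exp (9/20 * ln (real n) * ((ln (real n))^2 + 1)
     - c * (real n / (2 * ((ln (real n))^2 + 1)) - 1) / real n powr (9/10))))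
     \<in> o(\<lambda>n. 1 / real n ^ 2)"
  using assms by real_asymp

text \<open>Degrees 3 and 4: \<open>N^(-6)\<close> is at most \<open>l^6 n^(-27/10)\<close>, and
  \<open>2 d \<le> 8\<close> explains \<open>n / 8\<close>.\<close>

lemma mid_bound_smallo:
  assumes "c > 0" "l > (1::real)"
  shows "(\<lambda>n. l^6 * real n powr (-27/10) + exp (- c * (real n / 8 - 1) / real n powr (9/10)))
     \<in> o(\<lambda>n. 1 / real n ^ 2)"
  using assms by real_asymp

lemma exp_decay_smallo:
  assumes "\<kappa> > (0::real)"
  shows "(\<lambda>n. exp (- \<kappa> * real n)) \<in> o(\<lambda>n. 1 / real n ^ 2)"
  using assms by real_asymp

lemma smallo_dominated:
  fixes f g :: "nat \<Rightarrow> real"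
  assumes "eventually (\<lambda>n. 0 \<le> f n \<and> f n \<le> g n) sequentially" "g \<in> o(h)"
  shows "f \<in> o(h)"
proof -
  have "f \<in> O(g)"
    by (rule bigoI[of _ 1]) (use assms(1) in \<open>auto elim!: eventually_mono\<close>)
  thus ?thesis using assms(2) by (rule landau_o.big_small_trans)
qed

lemma nat_div_ge: "real (n div d) \<ge> real n / real d - 1"
proof (cases "d = 0")
  case False
  have "real n = real d * real (n div d) + real (n mod d)"
    by (metis mult_div_mod_eq of_nat_add of_nat_mult)
  moreover have "real (n mod d) \<le> real d" using False by (simp add: less_imp_le)
  ultimately have "real n \<le> real d * (real (n div d) + 1)" by (simp add: algebra_simps)
  thus ?thesis using False by (simp add: field_simps)
qed simp

context bounded_law_prime
begin

lemma sq_bound_le: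
  assumes "d > 0" "real n / (2 * real d) \<ge> y" "y \<ge> 1" "N > 0" "real N ^ 2 \<le> z"
  shows "sq_bound N n d \<le> 1 / real N ^ (2 * d) + exp (- c * (y - 1) / z)"
proof -
  have "real n / real (2 * d) - 1 \<le> real ((n + 1) div (2 * d))"
    using nat_div_ge[of n "2 * d"] div_le_mono[of n "n + 1" "2 * d"] by linarith
  hence W: "y - 1 \<le> real ((n + 1) div (2 * d))" using assms(2) by simp
  have "c * (y - 1) / z \<le> c * real ((n + 1) div (2 * d)) / real N ^ 2"
    using W assms c_pos by (intro frac_le mult_left_mono) auto
  thus ?thesis unfolding sq_bound_def by simp
qed

lemma line_bound_div_bigo: "(\<lambda>n. line_bound c (n div 12)) \<in> O(\<lambda>n. 1 / real n ^ 2)"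
proof -
  obtain C where C: "C > 0" "eventually (\<lambda>K. norm (line_bound c K) \<le> C * norm (1 / real K ^ 2)) sequentially"
    using landau_o.bigE[OF line_bound_bigo[OF c_pos]] by blast
  then obtain K0 where K0: "\<And>K. K \<ge> K0 \<Longrightarrow> norm (line_bound c K) \<le> C * norm (1 / real K ^ 2)"
    by (auto simp: eventually_sequentially)
  show ?thesis
  proof (rule bigoI[of _ "C * 576"])
    \<comment> \<open>For \<open>n \<ge> 24\<close> one has \<open>n div 12 \<ge> n / 24\<close>,
      and \<open>576 = 24^2\<close>.\<close>
    have "norm (line_bound c (n div 12)) \<le> C * 576 * norm (1 / real n ^ 2)" if n: "n \<ge> 12 * K0 + 24" for n
    proof -
      define K where "K = n div 12"
      have "K \<ge> K0" "24 * K \<ge> n" "n > 0" using n by (auto simp: K_def)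
      hence "real n / 24 \<le> real K" "real n > 0" by linarith+
      hence "(real n / 24)\<^sup>2 \<le> (real K)\<^sup>2" by (intro power_mono) auto
      hence "1 / (real K)\<^sup>2 \<le> 1 / (real n / 24)\<^sup>2" using \<open>real n > 0\<close> by (intro frac_le) auto
      hence "C * norm (1 / real K ^ 2) \<le> C * (576 * norm (1 / real n ^ 2))"
        using C(1) by (intro mult_left_mono) (simp_all add: power_divide)
      thus ?thesis using K0[OF \<open>K \<ge> K0\<close>] by (simp add: K_def)
    qed
    thus "eventually (\<lambda>n. norm (line_bound c (n div 12)) \<le> C * 576 * norm (1 / real n ^ 2)) sequentially"
      by (auto simp: eventually_sequentially)
  qed
qed

lemma power_between:
  assumes "y \<ge> 1"
  obtains s where "real l ^ s \<le> y" "y < real l * real l ^ s"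
proof -
  define s where "s = nat \<lfloor>log (real l) y\<rfloor>"
  have l: "real l > 1" using l_gt_1 by simp
  have "log (real l) y \<ge> 0" using assms l by simp
  hence s: "real s \<le> log (real l) y" "log (real l) y < real s + 1" by (simp_all add: s_def)
  have "real l powr real s \<le> y" using s(1) l assms by (simp add: le_log_iff)
  moreover have "y < real l powr (real s + 1)" using s(2) l assms by (simp add: log_less_iff)
  ultimately show ?thesis using that[of s] l by (simp add: powr_add powr_realpow mult.commute)
qed

text \<open>A bound uniform in \<open>d\<close>: the number \<open>l^d\<close> of candidates times
  \<open>l^(-2 d)\<close> is at most \<open>2^(-L)\<close> because \<open>d \<ge> L\<close>, and in
  the error term \<open>l^d\<close> is at most \<open>exp (2 (L + 1) ln l)\<close> because
  \<open>d < 2 k\<close>.\<close>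

lemma high_term_le:
  assumes k: "L \<le> real k" "real k \<le> L + 1" "L \<ge> 0" and n: "real n / (4 * (L + 1)) \<ge> 1"
  shows "(\<Sum>d=k..<2*k. real l ^ d * sq_bound l n d)
    \<le> (L + 1) * ((1/2) powr L + exp (2 * (L + 1) * ln (real l) - c * (real n / (4 * (L + 1)) - 1) / real l ^ 2))"
proof -
  define y where "y = real n / (4 * (L + 1))"
  have l1: "real l > 1" using l_gt_1 by simp
  let ?E = "(1/2) powr L + exp (2 * (L + 1) * ln (real l) - c * (y - 1) / real l ^ 2)"
  have "(\<Sum>d=k..<2*k. real l ^ d * sq_bound l n d) \<le> (\<Sum>d=k..<2*k. (1/2) powr L
     + exp (2 * (L + 1) * ln (real l) - c * (y - 1) / real l ^ 2))"
  proof (rule sum_mono)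
    fix d assume d: "d \<in> {k..<2*k}"
    have dk: "real k \<le> real d" "real d \<le> 2 * real k" "d > 0" using d by auto
    have "y \<le> real n / (2 * real d)" unfolding y_def using dk k by (intro divide_left_mono) auto
    hence "sq_bound l n d \<le> 1 / real l ^ (2 * d) + exp (- c * (y - 1) / real l ^ 2)"
      using dk n l1 by (intro sq_bound_le) (auto simp: y_def)
    hence "real l ^ d * sq_bound l n d \<le> real l ^ d * (1 / real l ^ (2 * d) + exp (- c * (y - 1) / real l ^ 2))"
      using l1 by (intro mult_left_mono) auto
    also have "\<dots> = 1 / real l ^ d + real l ^ d * exp (- c * (y - 1) / real l ^ 2)"
      using l1 by (simp add: distrib_left mult_2 power_add)
    also have "\<dots> \<le> (1/2) powr L + exp (2 * (L + 1) * ln (real l)) * exp (- c * (y - 1) / real l ^ 2)"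
    proof (intro add_mono mult_right_mono)
      show "1 / real l ^ d \<le> (1/2) powr L"
      proof -
        have "1 / real l ^ d \<le> 1 / 2 ^ d" using l_gt_1 by (intro frac_le power_mono) auto
        also have "\<dots> = (1/2) powr real d" by (simp add: powr_realpow power_divide)
        also have "\<dots> \<le> (1/2) powr L" using dk k by (intro powr_mono') auto
        finally show ?thesis .
      qed
      show "real l ^ d \<le> exp (2 * (L + 1) * ln (real l))"
      proof -
        have "real l ^ d = exp (real d * ln (real l))" using l1 by (simp add: exp_of_nat_mult)
        also have "\<dots> \<le> exp (2 * (L + 1) * ln (real l))" using dk k l1 by (simp add: mult_right_mono)
        finally show ?thesis .
      qed
    qed simp
    also have "exp (2 * (L + 1) * ln (real l)) * exp (- c * (y - 1) / real l ^ 2) = exp (2 * (L + 1) * ln (real l) - c * (y - 1) / real l ^ 2)"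
      by (simp add: exp_add[symmetric])
    finally show "real l ^ d * sq_bound l n d \<le> ?E" .
  qed
  also have "\<dots> = real k * (?E)" by simp
  also have "\<dots> \<le> (L + 1) * (?E)"
    using k by (intro mult_right_mono) auto
  finally show ?thesis by (simp add: y_def)
qed

text \<open>As \<open>high_term_le\<close>, with the size of \<open>N\<close> expressed by
  \<open>\<beta>\<close>, \<open>z\<close> and \<open>\<gamma>\<close>; \<open>d \<ge> 5\<close>
  gives the main term \<open>N^(-5)\<close>.\<close>

lemma medium_term_le:
  fixes N k :: nat
  assumes k: "real k \<le> L + 1" "L \<ge> 0" and n: "real n / (2 * (L + 1)) \<ge> 1" and z: "z > 0"
    and N: "N \<ge> 1" "real N \<le> exp \<beta>" "real N ^ 2 \<le> z" "1 / real N ^ 5 \<le> \<gamma>" "\<beta> \<ge> 0" "\<gamma> \<ge> 0"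
  shows "(\<Sum>d=5..<k. real N ^ d * sq_bound N n d)
    \<le> (L + 1) * (\<gamma> + exp (\<beta> * (L + 1) - c * (real n / (2 * (L + 1)) - 1) / z))"
proof -
  define y where "y = real n / (2 * (L + 1))"
  let ?E = "\<gamma> + exp (\<beta> * (L + 1) - c * (y - 1) / z)"
  have "(\<Sum>d=5..<k. real N ^ d * sq_bound N n d) \<le> (\<Sum>d=5..<k. ?E)"
  proof (rule sum_mono)
    fix d assume d: "d \<in> {5..<k}"
    have dk: "real d \<le> real k" "d > 0" "d \<ge> 5" using d by auto
    have "y \<le> real n / (2 * real d)" unfolding y_def using dk k by (intro divide_left_mono) auto
    hence "sq_bound N n d \<le> 1 / real N ^ (2 * d) + exp (- c * (y - 1) / z)"
      using dk n N by (intro sq_bound_le) (auto simp: y_def)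
    hence "real N ^ d * sq_bound N n d \<le> real N ^ d * (1 / real N ^ (2 * d) + exp (- c * (y - 1) / z))"
      using N by (intro mult_left_mono) auto
    also have "\<dots> = 1 / real N ^ d + real N ^ d * exp (- c * (y - 1) / z)"
      using N by (simp add: distrib_left mult_2 power_add)
    also have "\<dots> \<le> \<gamma> + exp (\<beta> * (L + 1)) * exp (- c * (y - 1) / z)"
    proof (intro add_mono mult_right_mono)
      show "1 / real N ^ d \<le> \<gamma>"
      proof -
        have "1 / real N ^ d \<le> 1 / real N ^ 5" using N dk by (intro frac_le power_increasing) auto
        thus ?thesis using N by simp
      qed
      show "real N ^ d \<le> exp (\<beta> * (L + 1))"
      proof -
        have "real N ^ d \<le> exp \<beta> ^ d" using N by (intro power_mono) auto
        also have "\<dots> = exp (real d * \<beta>)" by (simp add: exp_of_nat_mult)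
        also have "\<dots> \<le> exp (\<beta> * (L + 1))" using dk k N by (simp add: mult.commute mult_left_mono)
        finally show ?thesis .
      qed
    qed simp
    also have "exp (\<beta> * (L + 1)) * exp (- c * (y - 1) / z) = exp (\<beta> * (L + 1) - c * (y - 1) / z)"
      by (simp add: exp_add[symmetric])
    finally show "real N ^ d * sq_bound N n d \<le> ?E" .
  qed
  also have "\<dots> = real (k - 5) * (?E)" by simp
  also have "\<dots> \<le> (L + 1) * (?E)"
    using k N by (intro mult_right_mono) auto
  finally show ?thesis by (simp add: y_def)
qed

definition other_event :: "nat \<Rightarrow> (nat \<Rightarrow> int) \<Rightarrow> bool" where
  "other_event n a \<longleftrightarrow> ipoly n a \<noteq> 0 \<and> (\<exists>\<alpha>. \<alpha> \<notin> {0, -1, 1} \<and> double_zero (ipoly n a) \<alpha>)"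

lemma prb_other_event_smallo: "(\<lambda>n. prb n (other_event n)) \<in> o(\<lambda>n. 1 / real n ^ 2)"
proof -
  have l1: "real l > 1" using l_gt_1 by simp
  \<comment> \<open>Up to constant factors, \<open>g1\<close> to \<open>g5\<close> bound the five
    summands of \<open>prb_other_double_root_le\<close>.\<close>
  define g1 where "g1 = (\<lambda>n. ((ln (real n))^2 + 1) * ((1/2) powr ((ln (real n))^2) + exp (2 * ((ln (real n))^2 + 1) * ln (real l)
     - c * (real n / (4 * ((ln (real n))^2 + 1)) - 1) / real l^2)) + (real n + 1) * (1/2) powr ((ln (real n))^2))"
  define g2 where "g2 = (\<lambda>n. ((ln (real n))^2 + 1) * (real l^5 * real n powr (-9/4) + exp (9/20 * ln (real n) * ((ln (real n))^2 + 1)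
     - c * (real n / (2 * ((ln (real n))^2 + 1)) - 1) / real n powr (9/10))))"
  define g3 where "g3 = (\<lambda>n. real l^6 * real n powr (-27/10) + exp (- c * (real n / 8 - 1) / real n powr (9/10)))"
  define g4 where "g4 = (\<lambda>n. \<Sum>f\<in>sparse_factors. exp (- (ln 2 / real (spacing f)) * real n))"
  define g5 where "g5 = (\<lambda>n. line_bound c (n div 12) * line_bound c (n div 12))"
  define h where "h = (\<lambda>n. 1 / real n ^ 2)"
  have fin: "finite sparse_factors" using finite_low_factors by (auto simp: sparse_factors_def)
  have o1: "g1 \<in> o(h)" unfolding g1_def h_def by (rule high_bound_smallo[OF c_pos l1])
  have o2: "g2 \<in> o(h)" unfolding g2_def h_def by (rule medium_bound_smallo[OF c_pos l1])
  have o3: "g3 \<in> o(h)" unfolding g3_def h_def by (rule mid_bound_smallo[OF c_pos l1])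
  have o4: "g4 \<in> o(h)"
  proof -
    have "(\<lambda>n. \<Sum>f\<in>S. exp (- (ln 2 / real (spacing f)) * real n)) \<in> o(h)" if "S \<subseteq> sparse_factors" for S
      using finite_subset[OF that fin] that
    proof (induction S rule: finite_induct)
      case (insert f S)
      have "(\<lambda>n. exp (- (ln 2 / real (spacing f)) * real n)) \<in> o(h)"
        unfolding h_def by (rule exp_decay_smallo) (use spacing[of f] insert.prems in auto)
      moreover have "(\<lambda>n. \<Sum>f\<in>S. exp (- (ln 2 / real (spacing f)) * real n)) \<in> o(h)" using insert by auto
      ultimately show ?case using insert.hyps by (simp add: sum_in_smallo)
    qed simp
    thus ?thesis unfolding g4_def by blast
  qed
  have o5: "g5 \<in> o(h)"
  proof -
    have "g5 \<in> O(\<lambda>n. (1 / real n ^ 2) * (1 / real n ^ 2))"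
      unfolding g5_def by (intro landau_o.big.mult line_bound_div_bigo)
    moreover have "(\<lambda>n. (1 / real n ^ 2) * (1 / real n ^ 2)) \<in> o(h)" unfolding h_def by real_asymp
    ultimately show ?thesis by (rule landau_o.big_small_trans)
  qed
  define G where "G = (\<lambda>n. g1 n + g2 n + real (card mid_factors) * g3 n + g4 n + 3 * g5 n)"
  have "(\<lambda>n. real (card mid_factors) * g3 n) \<in> o(h)" "(\<lambda>n. 3 * g5 n) \<in> o(h)"
    using o3 o5 by (cases "card mid_factors = 0"; simp)+
  hence oG: "G \<in> o(h)" unfolding G_def by (intro sum_in_smallo o1 o2 o4)
  have bound: "prb n (other_event n) \<le> G n"
    if n: "n \<ge> 24" "real n / (4 * ((ln (real n))^2 + 1)) \<ge> 1" "real l * ((ln (real n))^2 + 1) + 1 \<le> real n"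
      "real n powr (9/20) \<ge> real l" "ln (real n) > 1" for n
  proof -
    define L where "L = (ln (real n))^2"
    define k where "k = nat \<lceil>L\<rceil>"
    have n0: "real n > 0" using n by simp
    have L: "L > 0" using n(5) by (simp add: L_def)
    hence k: "L \<le> real k" "real k \<le> L + 1" "k \<ge> 1" by (auto simp: k_def) linarith+
    have lk: "l * k + 1 \<le> n"
    proof -
      have "real l * real k + 1 \<le> real l * (L + 1) + 1" using k l1 by simp
      also have "\<dots> \<le> real n" using n(3) by (simp add: L_def)
      finally have "real (l * k + 1) \<le> real n" by simp
      thus ?thesis by (simp only: of_nat_le_iff)
    qed
    \<comment> \<open>Rounding \<open>n^(9/20)\<close> down to a power of \<open>l\<close> loses at
      most a factor \<open>l\<close>.\<close>
    obtain s where s: "real l ^ s \<le> real n powr (9/20)" "real n powr (9/20) < real l * real l ^ s"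
      by (rule power_between[of "real n powr (9/20)"]) (use n(4) l1 in auto)
    have s0: "s > 0" using s(2) n(4) by (cases s) auto
    define N where "N = l ^ s"
    have N: "real N \<le> real n powr (9/20)" "real n powr (9/20) < real l * real N" using s by (auto simp: N_def)
    have N1: "N \<ge> 1" using l_gt_1 by (simp add: N_def Suc_le_eq)
    have N2: "real N ^ 2 \<le> real n powr (9/10)"
    proof -
      have "real N ^ 2 \<le> (real n powr (9/20)) ^ 2" using N by (intro power_mono) auto
      also have "\<dots> = real n powr (9/10)" using n0 by (simp add: powr_power)
      finally show ?thesis .
    qed
    have Npow: "1 / real N ^ j \<le> real l ^ j * real n powr (- (9/20) * real j)" for j
    proof -
      have "(real n powr (9/20)) ^ j \<le> (real l * real N) ^ j" using N by (intro power_mono) auto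
      moreover have "(real n powr (9/20)) ^ j = real n powr (9/20 * real j)"
        using powr_power[of "real n" "9/20" j] n0 by (simp add: mult.commute)
      ultimately have "real n powr (9/20 * real j) \<le> real l ^ j * real N ^ j"
        by (simp only: power_mult_distrib)
      hence "1 \<le> (real l ^ j * real N ^ j) * real n powr (- (9/20 * real j))"
        using n0 by (simp add: powr_minus field_simps)
      thus ?thesis using N1 by (simp add: field_simps)
    qed
    have T1: "(\<Sum>d=k..<2*k. real l ^ d * sq_bound l n d) + (real n + 1) * (1/2) ^ k \<le> g1 n"
    proof -
      have "(1/2::real) ^ k = (1/2) powr real k" by (simp add: powr_realpow)
      also have "\<dots> \<le> (1/2) powr L" using k by (intro powr_mono') auto
      finally have "(real n + 1) * (1/2) ^ k \<le> (real n + 1) * (1/2) powr L" by (intro mult_left_mono) auto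
      moreover have "(\<Sum>d=k..<2*k. real l ^ d * sq_bound l n d)
        \<le> (L + 1) * ((1/2) powr L + exp (2 * (L + 1) * ln (real l) - c * (real n / (4 * (L + 1)) - 1) / real l ^ 2))"
        using k L n(2) by (intro high_term_le) (auto simp: L_def)
      ultimately show ?thesis unfolding g1_def L_def[symmetric] by linarith
    qed
    have T2: "(\<Sum>d=5..<k. real N ^ d * sq_bound N n d) \<le> g2 n"
    proof -
      have "real n / (4 * (L + 1)) \<le> real n / (2 * (L + 1))" using L by (intro divide_left_mono) auto
      hence y: "real n / (2 * (L + 1)) \<ge> 1" using n(2) by (simp add: L_def)
      have "1 / real N ^ 5 \<le> real l ^ 5 * real n powr (-9/4)" using Npow[of 5] by simp
      moreover have "real N \<le> exp (9/20 * ln (real n))" using N(1) n0 by (simp add: powr_def)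
      ultimately show ?thesis unfolding g2_def L_def[symmetric] using k L y N1 N2 n0 n(5)
        by (intro medium_term_le) auto
    qed
    have T3: "(\<Sum>f\<in>mid_factors. sq_bound N n (degree f)) \<le> real (card mid_factors) * g3 n"
    proof -
      have "(\<Sum>f\<in>mid_factors. sq_bound N n (degree f)) \<le> (\<Sum>f\<in>mid_factors. g3 n)"
      proof (rule sum_mono)
        fix f assume "f \<in> mid_factors"
        hence d: "3 \<le> degree f" "degree f \<le> 4" by (auto simp: mid_factors_def low_factors_def)
        have "sq_bound N n (degree f) \<le> 1 / real N ^ (2 * degree f) + exp (- c * (real n / 8 - 1) / real n powr (9/10))"
          using d n N1 N2 by (intro sq_bound_le divide_left_mono) auto
        moreover have "1 / real N ^ (2 * degree f) \<le> 1 / real N ^ 6"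
          using N1 d by (intro frac_le power_increasing) auto
        moreover have "1 / real N ^ 6 \<le> real l ^ 6 * real n powr (-27/10)" using Npow[of 6] by simp
        ultimately show "sq_bound N n (degree f) \<le> g3 n" by (simp add: g3_def)
      qed
      thus ?thesis by simp
    qed
    have T4: "(\<Sum>f\<in>sparse_factors. (1/2) ^ (n div spacing f + 1)) \<le> g4 n"
      unfolding g4_def
    proof (rule sum_mono)
      fix f assume "f \<in> sparse_factors"
      hence S: "spacing f > 0" using spacing by blast
      have "(1/2::real) ^ (n div spacing f + 1) = (1/2) powr real (n div spacing f + 1)" by (subst powr_realpow) simp_all
      also have "\<dots> \<le> (1/2) powr (real n / real (spacing f))"
        using nat_div_ge[of n "spacing f"] by (intro powr_mono') auto
      also have "\<dots> = exp (- (ln 2 / real (spacing f)) * real n)" by (simp add: powr_def ln_div)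
      finally show "(1/2) ^ (n div spacing f + 1) \<le> exp (- (ln 2 / real (spacing f)) * real n)" .
    qed
    have "3 * line_bound c (n div 12) ^ 2 = 3 * g5 n" by (simp add: g5_def power2_eq_square)
    with T1 T2 T3 T4 prb_other_double_root_le[OF k(3) lk s0 n(1)] show ?thesis
      unfolding other_event_def G_def N_def[symmetric] by linarith
  qed
  have ev: "eventually (\<lambda>n. n \<ge> (24::nat)) sequentially"
    "eventually (\<lambda>n. real n / (4 * ((ln (real n))^2 + 1)) \<ge> 1) sequentially"
    "eventually (\<lambda>n. real l * ((ln (real n))^2 + 1) + 1 \<le> real n) sequentially"
    "eventually (\<lambda>n. real n powr (9/20) \<ge> real l) sequentially"
    "eventually (\<lambda>n. ln (real n) > 1) sequentially"
    using l1 by (real_asymp | rule eventually_ge_at_top)+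
  have "eventually (\<lambda>n. 0 \<le> prb n (other_event n) \<and> prb n (other_event n) \<le> G n) sequentially"
    using ev by eventually_elim (use bound prb_nonneg in blast)
  from smallo_dominated[OF this oG] show ?thesis by (simp add: h_def)
qed

end

section \<open>Transfer from the probability space\<close>

lemma rand_poly_eq: "rand_poly \<xi> n \<omega> = map_poly of_int (ipoly n (\<lambda>j. \<xi> j \<omega>))"
proof (rule poly_eqI)
  fix i
  have "coeff (rand_poly \<xi> n \<omega>) i = (\<Sum>j\<le>n. if j = i then of_int (\<xi> j \<omega>) else 0)"
    by (simp add: rand_poly_def coeff_sum)
  thus "coeff (rand_poly \<xi> n \<omega>) i = coeff (map_poly of_int (ipoly n (\<lambda>j. \<xi> j \<omega>))) i"
    by (simp add: sum.delta' coeff_map_poly coeff_ipoly)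
qed

lemma double_root_rand_poly:
  "double_root (rand_poly \<xi> n \<omega>) \<alpha> \<longleftrightarrow> double_zero (ipoly n (\<lambda>j. \<xi> j \<omega>)) \<alpha>"
proof -
  have "pderiv (map_poly complex_of_int F) = map_poly complex_of_int (pderiv F)" for F
    by (rule poly_eqI) (simp add: coeff_pderiv coeff_map_poly)
  thus ?thesis by (simp add: double_root_def double_zero_def rand_poly_eq evi_def)
qed

text \<open>Almost surely the first \<open>n + 1\<close> variables lie in the box, so the event is,
  up to a null set, a finite disjoint union of cylinders, whose probabilities are products by
  independence.\<close>

lemma (in prob_space) prob_eq_prb:
  fixes \<xi> :: "nat \<Rightarrow> 'a \<Rightarrow> int"
  assumes law: "bounded_law w m"
    and indep: "indep_vars (\<lambda>_. count_space UNIV) \<xi> UNIV"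
    and w: "\<And>j x. prob {\<omega> \<in> space M. \<xi> j \<omega> = x} = w x"
    and bound: "\<And>j. AE \<omega> in M. \<xi> j \<omega> \<in> {-m..m}"
  shows "prob {\<omega> \<in> space M. Q (ipoly n (\<lambda>j. \<xi> j \<omega>))} = bounded_law.prb w m n (\<lambda>a. Q (ipoly n a))"
proof -
  interpret bounded_law w m by (rule law)
  have meas: "\<xi> j \<in> measurable M (count_space UNIV)" for j using indep by (auto simp: indep_vars_def)
  define A where "A = (\<lambda>a. \<Inter>j\<in>{..n}. \<xi> j -` {a j} \<inter> space M)"
  have A_sets: "A a \<in> sets M" for a
    unfolding A_def by (intro sets.finite_INT measurable_sets[OF meas]) auto
  have A_eq: "A a = {\<omega> \<in> space M. \<forall>j\<le>n. \<xi> j \<omega> = a j}" for a by (auto simp: A_def)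
  have prob_A: "prob (A a) = (\<Prod>j\<le>n. w (a j))" for a
  proof -
    have vimage: "\<xi> j -` {a j} \<inter> space M = {\<omega> \<in> space M. \<xi> j \<omega> = a j}" for j by auto
    have "prob (A a) = (\<Prod>j\<in>{..n}. prob (\<xi> j -` {a j} \<inter> space M))"
      unfolding A_def by (rule indep_varsD[OF indep]) auto
    thus ?thesis by (simp only: vimage w)
  qed
  have ipoly_cong: "ipoly n (\<lambda>j. \<xi> j \<omega>) = ipoly n a" if "\<omega> \<in> A a" for \<omega> a
    using that by (intro poly_eqI) (simp add: coeff_ipoly A_eq)
  define E where "E = {\<omega> \<in> space M. Q (ipoly n (\<lambda>j. \<xi> j \<omega>))}"
  define S where "S = {a \<in> box n. Q (ipoly n a)}"
  \<comment> \<open>Only countably many integer vectors exist, so \<open>E\<close> is a countable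
    union of cylinders and is measurable for any predicate \<open>Q\<close>.\<close>
  define C where "C = {b \<in> PiE {..n} (\<lambda>_. UNIV). Q (ipoly n b)}"
  have "countable C" unfolding C_def by (rule countable_subset[OF _ countable_PiE[of "{..n}" "\<lambda>_. UNIV"]]) auto
  have "E = (\<Union>b\<in>C. A b)"
  proof (intro equalityI subsetI)
    fix \<omega> assume \<omega>: "\<omega> \<in> E"
    define b where "b = restrict (\<lambda>j. \<xi> j \<omega>) {..n}"
    have bA: "\<omega> \<in> A b" using \<omega> by (auto simp: A_eq b_def E_def)
    have "b \<in> C" using ipoly_cong[OF bA] \<omega> by (auto simp: C_def E_def b_def)
    with bA show "\<omega> \<in> (\<Union>b\<in>C. A b)" by blast
  next
    fix \<omega> assume "\<omega> \<in> (\<Union>b\<in>C. A b)"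
    then obtain b where "b \<in> C" "\<omega> \<in> A b" by blast
    thus "\<omega> \<in> E" using ipoly_cong[of \<omega> b] by (auto simp: C_def E_def A_eq)
  qed
  hence E_sets: "E \<in> sets M" using \<open>countable C\<close> A_sets by (auto intro!: sets.countable_UN')
  have U_sets: "(\<Union>a\<in>S. A a) \<in> sets M"
    using A_sets by (intro sets.finite_UN) (auto simp: S_def)
  have "AE \<omega> in M. \<forall>j\<in>{..n}. \<xi> j \<omega> \<in> {-m..m}" using bound by (intro AE_finite_allI) auto
  hence "AE \<omega> in M. \<omega> \<in> E \<longleftrightarrow> \<omega> \<in> (\<Union>a\<in>S. A a)"
  proof (rule AE_mp[OF _ AE_I2], intro impI)
    fix \<omega> assume \<omega>: "\<omega> \<in> space M" and b: "\<forall>j\<in>{..n}. \<xi> j \<omega> \<in> {-m..m}"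
    define a where "a = restrict (\<lambda>j. \<xi> j \<omega>) {..n}"
    have a: "\<omega> \<in> A a" "a \<in> box n" using \<omega> b by (auto simp: A_eq a_def box_def)
    show "\<omega> \<in> E \<longleftrightarrow> \<omega> \<in> (\<Union>a\<in>S. A a)"
    proof
      assume "\<omega> \<in> E"
      thus "\<omega> \<in> (\<Union>a\<in>S. A a)" using a ipoly_cong[OF a(1)] by (auto simp: E_def S_def)
    next
      assume "\<omega> \<in> (\<Union>a\<in>S. A a)"
      then obtain a' where "a' \<in> S" "\<omega> \<in> A a'" by blast
      thus "\<omega> \<in> E" using ipoly_cong[of \<omega> a'] \<omega> by (auto simp: S_def E_def)
    qed
  qed
  hence "prob E = prob (\<Union>a\<in>S. A a)" by (rule finite_measure_eq_AE[OF _ E_sets U_sets])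
  also have "\<dots> = (\<Sum>a\<in>S. prob (A a))"
  proof (rule finite_measure_finite_Union)
    show "disjoint_family_on A S"
      unfolding disjoint_family_on_def
    proof (intro ballI impI)
      fix a b assume ab: "a \<in> S" "b \<in> S" "a \<noteq> b"
      have "\<exists>j\<in>{..n}. a j \<noteq> b j" using ab PiE_ext[of a "{..n}" "\<lambda>_. {-m..m}" b] by (auto simp: S_def box_def)
      thus "A a \<inter> A b = {}" by (auto simp: A_eq)
    qed
  qed (use A_sets in \<open>auto simp: S_def\<close>)
  finally show ?thesis by (simp add: prob_A prb_def E_def S_def)
qed

theorem theorem1p1:
  fixes \<Omega> :: "'a measure" and \<xi> :: "nat \<Rightarrow> 'a \<Rightarrow> int" and M :: real
  assumes "prob_space \<Omega>"
    and indep: "prob_space.indep_vars \<Omega> (\<lambda>_. count_space UNIV) \<xi> UNIV"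
    and ident: "\<And>j. distr \<Omega> (count_space UNIV) (\<xi> j) = distr \<Omega> (count_space UNIV) (\<xi> 0)"
    and "M \<ge> 1"
    and bounded: "measure \<Omega> {\<omega> \<in> space \<Omega>. \<bar>real_of_int (\<xi> 0 \<omega>)\<bar> \<le> M} = 1"
    and atoms: "\<And>x. measure \<Omega> {\<omega> \<in> space \<Omega>. \<xi> 0 \<omega> = x} \<le> 1 / 2"
  shows "(\<lambda>n. measure \<Omega> {\<omega> \<in> space \<Omega>. \<exists>\<alpha>. double_root (rand_poly \<xi> n \<omega>) \<alpha>}
            - measure \<Omega> {\<omega> \<in> space \<Omega>. \<exists>\<alpha>\<in>{0, -1, 1}. double_root (rand_poly \<xi> n \<omega>) \<alpha>})
         \<in> o(\<lambda>n. 1 / real n ^ 2)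
       \<and> (measure \<Omega> {\<omega> \<in> space \<Omega>. \<xi> 0 \<omega> = 0} = 0 \<longrightarrow>
           (\<lambda>n. measure \<Omega> {\<omega> \<in> space \<Omega>. \<exists>\<alpha>. double_root (rand_poly \<xi> n \<omega>) \<alpha>})
           \<in> O(\<lambda>n. 1 / real n ^ 2))"
proof -
  interpret prob_space \<Omega> by fact
  define w where "w = (\<lambda>x. prob {\<omega> \<in> space \<Omega>. \<xi> 0 \<omega> = x})"
  define m where "m = \<lfloor>M\<rfloor>"
  have meas [measurable]: "\<xi> j \<in> measurable \<Omega> (count_space UNIV)" for j using indep by (auto simp: indep_vars_def)
  have prob_distr: "prob {\<omega> \<in> space \<Omega>. \<xi> j \<omega> \<in> B} = measure (distr \<Omega> (count_space UNIV) (\<xi> 0)) B" for j B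
  proof -
    have "{\<omega> \<in> space \<Omega>. \<xi> j \<omega> \<in> B} = \<xi> j -` B \<inter> space \<Omega>" by auto
    thus ?thesis using measure_distr[OF meas[of j], of B] ident[of j] by simp
  qed
  have w: "prob {\<omega> \<in> space \<Omega>. \<xi> j \<omega> = x} = w x" for j x
    using prob_distr[of j "{x}"] prob_distr[of 0 "{x}"] by (simp add: w_def)
  have iff: "\<bar>real_of_int x\<bar> \<le> M \<longleftrightarrow> x \<in> {-m..m}" for x
  proof -
    have "\<bar>real_of_int x\<bar> \<le> M \<longleftrightarrow> real_of_int \<bar>x\<bar> \<le> M" by simp
    also have "\<dots> \<longleftrightarrow> \<bar>x\<bar> \<le> m" unfolding m_def by (simp only: le_floor_iff)
    finally show ?thesis by auto
  qed
  have full: "prob {\<omega> \<in> space \<Omega>. \<xi> j \<omega> \<in> {-m..m}} = 1" for j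
    using bounded prob_distr[of j "{-m..m}"] prob_distr[of 0 "{-m..m}"] by (simp only: iff)
  have AE: "AE \<omega> in \<Omega>. \<xi> j \<omega> \<in> {-m..m}" for j
    using full[of j] by (subst (asm) prob_Collect_eq_1) simp_all
  have law: "bounded_law w m"
  proof
    show "0 \<le> w x" "w x \<le> 1/2" for x using atoms by (simp_all add: w_def)
    define D where "D = distr \<Omega> (count_space UNIV) (\<xi> 0)"
    interpret D: prob_space D unfolding D_def by (rule prob_space_distr) simp
    have "(\<Sum>x\<in>{-m..m}. w x) = (\<Sum>x\<in>{-m..m}. measure D {x})"
    proof (rule sum.cong[OF refl])
      show "w x = measure D {x}" for x using prob_distr[of 0 "{x}"] by (simp add: w_def D_def)
    qed
    also have "\<dots> = measure D {-m..m}"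
      by (rule D.finite_measure_eq_sum_singleton[symmetric]) (auto simp: D_def)
    also have "\<dots> = 1" using full[of 0] prob_distr[of 0 "{-m..m}"] by (simp only: D_def)
    finally show "(\<Sum>x\<in>{-m..m}. w x) = 1" .
  qed
  interpret bounded_law w m by (rule law)
  obtain c \<Delta> where c: "c > 0" "\<Delta> \<ge> 1" "int \<Delta> \<le> 2 * m"
    "\<And>\<theta>. char_abs \<theta> \<le> exp (- c * (dist_int (real \<Delta> * \<theta>))\<^sup>2)" by (rule char_abs_bound) blast
  obtain l :: nat where l: "prime l" "l > nat (2 * m)" using bigger_prime by blast
  interpret bounded_law_prime w m c \<Delta> l
    by standard (use c l in auto)
  have prob_prb: "prob {\<omega> \<in> space \<Omega>. Q (ipoly n (\<lambda>j. \<xi> j \<omega>))} = prb n (\<lambda>a. Q (ipoly n a))" for Q n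
    by (rule prob_eq_prb[OF law indep w AE])
  define D where "D = (\<lambda>n. prb n (\<lambda>a. \<exists>\<alpha>. double_zero (ipoly n a) \<alpha>))"
  define D3 where "D3 = (\<lambda>n. prb n (\<lambda>a. \<exists>\<alpha>\<in>{0, -1, 1}. double_zero (ipoly n a) \<alpha>))"
  have D: "prob {\<omega> \<in> space \<Omega>. \<exists>\<alpha>. double_root (rand_poly \<xi> n \<omega>) \<alpha>} = D n" for n
    unfolding D_def double_root_rand_poly by (rule prob_prb)
  have D3: "prob {\<omega> \<in> space \<Omega>. \<exists>\<alpha>\<in>{0, -1, 1}. double_root (rand_poly \<xi> n \<omega>) \<alpha>} = D3 n" for n
    unfolding D3_def double_root_rand_poly by (rule prob_prb)
  have D_le: "D n \<le> D3 n + prb n (other_event n)" for n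
  proof -
    have "D n \<le> prb n (\<lambda>a. (\<exists>\<alpha>\<in>{0, -1, 1}. double_zero (ipoly n a) \<alpha>) \<or> other_event n a)"
      unfolding D_def
    proof (rule prb_mono)
      fix a assume "\<exists>\<alpha>. double_zero (ipoly n a) \<alpha>"
      then obtain \<alpha> where \<alpha>: "double_zero (ipoly n a) \<alpha>" by blast
      show "(\<exists>\<alpha>\<in>{0, -1, 1}. double_zero (ipoly n a) \<alpha>) \<or> other_event n a"
      proof (cases "ipoly n a = 0")
        case True
        \<comment> \<open>The zero polynomial has 0 as a double root, so it falls under
          \<open>D3\<close>.\<close>
        have "\<exists>\<alpha>\<in>{0, -1, 1}. double_zero (ipoly n a) \<alpha>"
          by (rule bexI[of _ 0]) (simp_all add: True double_zero_def)
        thus ?thesis ..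
      next
        case P: False
        show ?thesis
        proof (cases "\<alpha> \<in> {0, -1, 1}")
          case True
          with \<alpha> have "\<exists>\<alpha>\<in>{0, -1, 1}. double_zero (ipoly n a) \<alpha>" by (rule bexI)
          thus ?thesis ..
        next
          case False
          hence "other_event n a" unfolding other_event_def using P \<alpha> by (intro conjI exI[of _ \<alpha>])
          thus ?thesis ..
        qed
      qed
    qed
    also have "\<dots> \<le> D3 n + prb n (other_event n)" unfolding D3_def by (rule prb_disj)
    finally show ?thesis .
  qed
  have D3_le: "D3 n \<le> D n" for n unfolding D_def D3_def by (rule prb_mono) blast
  have part1: "(\<lambda>n. D n - D3 n) \<in> o(\<lambda>n. 1 / real n ^ 2)"
  proof (rule smallo_dominated[OF _ prb_other_event_smallo])
    have "0 \<le> D n - D3 n \<and> D n - D3 n \<le> prb n (other_event n)" for n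
      using D_le[of n] D3_le[of n] by linarith
    thus "eventually (\<lambda>n. 0 \<le> D n - D3 n \<and> D n - D3 n \<le> prb n (other_event n)) sequentially" by simp
  qed
  have part2: "D \<in> O(\<lambda>n. 1 / real n ^ 2)" if w0: "w 0 = 0"
  proof -
    have "D3 \<in> O(\<lambda>n. line_bound c (n div 12))"
    proof (rule bigoI[of _ 2])
      have "norm (D3 n) \<le> 2 * norm (line_bound c (n div 12))" if n: "n \<ge> 24" for n
      proof -
        \<comment> \<open>A double root at 0 forces \<open>a 0 = 0\<close>, a null event when
          \<open>w 0 = 0\<close>; only -1 and 1 remain, each of probability
          \<open>O(n^(-2))\<close>.\<close>
        have "D3 n \<le> prb n (\<lambda>a. a 0 = 0 \<or> (double_zero (ipoly n a) (of_int (-1)) \<or> double_zero (ipoly n a) (of_int 1)))"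
          unfolding D3_def
        proof (rule prb_mono)
          fix a assume "\<exists>\<alpha>\<in>{0, -1, 1}. double_zero (ipoly n a) \<alpha>"
          moreover have "a 0 = 0" if "double_zero (ipoly n a) 0"
          proof -
            have "coeff (map_poly complex_of_int (ipoly n a)) 0 = 0"
              using that by (simp add: double_zero_def evi_def poly_0_coeff_0)
            thus ?thesis by (simp add: coeff_map_poly coeff_ipoly)
          qed
          ultimately show "a 0 = 0 \<or> (double_zero (ipoly n a) (of_int (-1)) \<or> double_zero (ipoly n a) (of_int 1))" by auto
        qed
        also have "\<dots> \<le> prb n (\<lambda>a. a 0 = 0) + (prb n (\<lambda>a. double_zero (ipoly n a) (of_int (-1)))
            + prb n (\<lambda>a. double_zero (ipoly n a) (of_int 1)))"
          by (intro order.trans[OF prb_disj] add_mono order.refl)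
        also have "\<dots> \<le> 0 + (line_bound c (n div 12) + line_bound c (n div 12))"
          using prb_const_zero[OF w0, of n] prb_double_at_unit_le[OF _ n, of 1] prb_double_at_unit_le[OF _ n, of "-1"]
          by (intro add_mono) auto
        finally have "D3 n \<le> 2 * line_bound c (n div 12)" by simp
        moreover have "0 \<le> D3 n" unfolding D3_def by (rule prb_nonneg)
        ultimately show ?thesis by simp
      qed
      thus "eventually (\<lambda>n. norm (D3 n) \<le> 2 * norm (line_bound c (n div 12))) sequentially"
        by (auto simp: eventually_sequentially)
    qed
    hence "D3 \<in> O(\<lambda>n. 1 / real n ^ 2)" using line_bound_div_bigo by (rule landau_o.big_trans)
    moreover have "(\<lambda>n. D n - D3 n) \<in> O(\<lambda>n. 1 / real n ^ 2)" using part1 by (rule landau_o.small_imp_big)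
    ultimately have "(\<lambda>n. (D n - D3 n) + D3 n) \<in> O(\<lambda>n. 1 / real n ^ 2)" by (rule sum_in_bigo(1)[rotated])
    thus ?thesis by simp
  qed
  show ?thesis unfolding D D3 using part1 part2 by (simp add: w_def)
qed

end
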